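(* For all $k=\Omega(\log m)$, $\mathsf{MIR_{Gen}}(m,k)=\Theta(m/k)$. In particular, the best possible approximation guarantee for monotone valuations by maximal-in-range mechanisms with $\mathrm{poly}(m)$ communication is $\Theta(m/\log m)$. Moreover, the mechanism achieving the upper bound can be implemented using $2^{O(k)}$ simultaneous value queries, or in time $2^{O(k)}$ in the succinct representation model.
   Context: Setting: items $M=[m]$, bidders $N=[n]$; bidder $i$ privately holds a monotone valuation $v_i:2^M\to\mathbb{R}_{\ge 0}$. An allocation is a tuple $A=(A_1,\dots,A_n)$ of pairwise disjoint subsets of $M$; its welfare is $\sum_i v_i(A_i)$. $\mathrm{OPT}(\vec v)$ is the maximum welfare over all allocations. An allocation bank $\mathcal A$ is a set of allocations, and $\mathrm{MIR}_{\mathcal A}(\vec v)=\max_{A\in\mathcal A}\sum_i v_i(A_i)$. The maximal-in-range (MIR) mechanism for $\mathcal A$ outputs, for every valuation profile, an allocation in $\mathcal A$ of maximum welfare among allocations in $\mathcal A$ (together with VCG payments, computable by $n+1$ welfare maximizations over $\mathcal A$, which make it truthful). It is $\alpha$-approximate on a valuation class if $\mathrm{MIR}_{\mathcal A}(\vec v)\ge \mathrm{OPT}(\vec v)/\alpha$ for all profiles from the class. Communication is measured in the blackboard model (bidder $i$ knows only $v_i$). $\mathsf{MIR_{Gen}}(m,k)$ is the optimal (smallest) approximation guarantee that can be achieved by an MIR mechanism using at most $2^k$ communication between bidders with general (arbitrary monotone) valuations over $m$ items. When considering mechanisms that run in $2^{O(k)}$ communication/value queries/computation, all numbers are assumed to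 be integers less than $2^{2^{O(k)}}$. A value query asks a bidder for $v_i(S)$ for a set $S$; queries are simultaneous if all are fixed in advance (non-adaptive). In the succinct representation model each $v_i$ can be represented by an explicit circuit of size at most $\mathrm{poly}(m)$. The mechanism may depend on fixed combinatorial objects that are shown to exist but are not required to be efficiently constructible.
   Formalization: With an exact budget of 2^k the claim fails for unbounded n, larger numbers or small constants in k = Ω(log m); proved for n ≤ 2^(γk) bidders, integer values below 2^(2^(βk)), β+γ<1, and c0·log m ≤ k ≤ m with c0·γ ≥ 1. *)

theory Defs
  imports Complex_Main "HOL-Library.Extended_Real" "HOL-Library.FuncSet" "HOL-Library.Disjoint_Sets"
begin

section \<open>Valuations, allocations and maximal-in-range mechanisms\<close>

text \<open>Items are \<open>{..<m}\<close>, bidders are \<open>{..<n}\<close>.\<close>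

type_synonym valuation = "nat set \<Rightarrow> real"
type_synonym allocation = "nat \<Rightarrow> nat set"

text \<open>An outcome consists of an allocation and the payments of the bidders.\<close>
type_synonym outcome = "allocation \<times> (nat \<Rightarrow> real)"

definition monotone_valuations :: "nat \<Rightarrow> valuation set" where
  "monotone_valuations m =
     {v. (\<forall>S. S \<subseteq> {..<m} \<longrightarrow> 0 \<le> v S) \<and> (\<forall>S T. S \<subseteq> T \<and> T \<subseteq> {..<m} \<longrightarrow> v S \<le> v T)}"

text \<open>Communication is only meaningful for numbers of bounded length: in
  \<open>bounded_valuations m B\<close> all values are integers less than \<open>B\<close>.\<close>
definition bounded_valuations :: "nat \<Rightarrow> real \<Rightarrow> valuation set" where
  "bounded_valuations m B =
     {v \<in> monotone_valuations m. \<forall>S. S \<subseteq> {..<m} \<longrightarrow> v S \<in> \<nat> \<and> v S < B}"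

definition allocations :: "nat \<Rightarrow> nat \<Rightarrow> allocation set" where
  "allocations n m = {A \<in> {..<n} \<rightarrow>\<^sub>E Pow {..<m}. disjoint_family_on A {..<n}}"

definition welfare :: "nat \<Rightarrow> (nat \<Rightarrow> valuation) \<Rightarrow> allocation \<Rightarrow> real" where
  "welfare n v A = (\<Sum>i<n. v i (A i))"

definition OPT :: "nat \<Rightarrow> nat \<Rightarrow> (nat \<Rightarrow> valuation) \<Rightarrow> real" where
  "OPT n m v = Max (welfare n v ` allocations n m)"

definition allocation_bank :: "nat \<Rightarrow> nat \<Rightarrow> allocation set \<Rightarrow> bool" where
  "allocation_bank n m \<A> \<longleftrightarrow> \<A> \<noteq> {} \<and> \<A> \<subseteq> allocations n m"

definition MIR :: "nat \<Rightarrow> allocation set \<Rightarrow> (nat \<Rightarrow> valuation) \<Rightarrow> real" where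
  "MIR n \<A> v = Max (welfare n v ` \<A>)"

definition welfare_others :: "nat \<Rightarrow> (nat \<Rightarrow> valuation) \<Rightarrow> nat \<Rightarrow> allocation \<Rightarrow> real" where
  "welfare_others n v i A = (\<Sum>j\<in>{..<n} - {i}. v j (A j))"

text \<open>The VCG payment of bidder \<open>i\<close> when \<open>A\<close> is chosen, normalised by the Clarke pivot rule;
  all payments together with \<open>A\<close> amount to \<open>n + 1\<close> welfare maximizations over the bank.\<close>
definition vcg_payment ::
    "nat \<Rightarrow> allocation set \<Rightarrow> (nat \<Rightarrow> valuation) \<Rightarrow> allocation \<Rightarrow> nat \<Rightarrow> real" where
  "vcg_payment n \<A> v A i = Max (welfare_others n v i ` \<A>) - welfare_others n v i A"

text \<open>Ties between allocations of maximum welfare may be broken arbitrarily.\<close>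
definition mir_outcome :: "nat \<Rightarrow> allocation set \<Rightarrow> (nat \<Rightarrow> valuation) \<Rightarrow> outcome \<Rightarrow> bool" where
  "mir_outcome n \<A> v x \<longleftrightarrow>
     fst x \<in> \<A> \<and> welfare n v (fst x) = MIR n \<A> v \<and>
     (\<forall>i<n. snd x i = vcg_payment n \<A> v (fst x) i)"

definition mir_approx ::
    "nat \<Rightarrow> nat \<Rightarrow> valuation set \<Rightarrow> allocation set \<Rightarrow> real \<Rightarrow> bool" where
  "mir_approx n m V \<A> \<alpha> \<longleftrightarrow>
     0 < \<alpha> \<and> (\<forall>v. (\<forall>i<n. v i \<in> V) \<longrightarrow> MIR n \<A> v \<ge> OPT n m v / \<alpha>)"


section \<open>Blackboard communication\<close>

text \<open>A deterministic protocol is a decision tree: at \<open>Speak i f l r\<close> the public transcript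
  determines that bidder \<open>i\<close> writes the bit \<open>f (v i)\<close>, which depends on her own valuation only;
  the protocol continues with \<open>r\<close> if the bit is set and with \<open>l\<close> otherwise.\<close>
datatype 'o protocol =
    Done 'o
  | Speak nat "valuation \<Rightarrow> bool" "'o protocol" "'o protocol"

primrec speakers :: "'o protocol \<Rightarrow> nat set" where
  "speakers (Done x) = {}"
| "speakers (Speak i f l r) = insert i (speakers l \<union> speakers r)"

primrec protocol_outcome :: "'o protocol \<Rightarrow> (nat \<Rightarrow> valuation) \<Rightarrow> 'o" where
  "protocol_outcome (Done x) v = x"
| "protocol_outcome (Speak i f l r) v =
     (if f (v i) then protocol_outcome r v else protocol_outcome l v)"

text \<open>The number of bits written on the blackboard.\<close>
primrec protocol_cost :: "'o protocol \<Rightarrow> (nat \<Rightarrow> valuation) \<Rightarrow> nat" where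
  "protocol_cost (Done x) v = 0"
| "protocol_cost (Speak i f l r) v =
     Suc (if f (v i) then protocol_cost r v else protocol_cost l v)"

definition mir_communication ::
    "nat \<Rightarrow> valuation set \<Rightarrow> allocation set \<Rightarrow> real \<Rightarrow> bool" where
  "mir_communication n V \<A> b \<longleftrightarrow>
     (\<exists>\<pi>. speakers \<pi> \<subseteq> {..<n} \<and>
          (\<forall>v. (\<forall>i<n. v i \<in> V) \<longrightarrow>
               mir_outcome n \<A> v (protocol_outcome \<pi> v) \<and> real (protocol_cost \<pi> v) \<le> b))"

text \<open>The best approximation guarantee for \<open>m\<close> items of an MIR mechanism with at most \<open>b\<close> bits
  of communication. The guarantee has to hold for every number \<open>n \<le> N\<close> of bidders and for all
  general valuations with integer values less than \<open>B\<close>. It is \<open>\<infinity>\<close> if no such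
  mechanism exists.\<close>
definition mir_guarantee :: "real \<Rightarrow> real \<Rightarrow> real \<Rightarrow> nat \<Rightarrow> ereal" where
  "mir_guarantee N B b m =
     Inf {ereal \<alpha> |\<alpha>. 0 < \<alpha> \<and> (\<forall>n. 1 \<le> n \<and> real n \<le> N \<longrightarrow>
            (\<exists>\<A>. allocation_bank n m \<A> \<and>
                 mir_approx n m (bounded_valuations m B) \<A> \<alpha> \<and>
                 mir_communication n (bounded_valuations m B) \<A> b))}"

text \<open>With a budget of \<open>2\<^sup>k\<close> bits, the number of bidders is at most \<open>2\<close> to the power \<open>\<gamma> k\<close>
  and all values are integers less than \<open>2\<close> to the power \<open>2\<close> to the power \<open>\<beta> k\<close>. The exponents
  have to be compatible with the budget, as already announcing one value per bidder takes
  about \<open>2\<close> to the power \<open>(\<beta> + \<gamma>) k\<close> bits.\<close>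
definition MIR_Gen :: "real \<Rightarrow> real \<Rightarrow> nat \<Rightarrow> real \<Rightarrow> ereal" where
  "MIR_Gen \<beta> \<gamma> m k =
     mir_guarantee (2 powr (\<gamma> * k)) (2 powr (2 powr (\<beta> * k))) (2 powr k) m"


section \<open>Simultaneous value queries\<close>

text \<open>Bidder \<open>i\<close> is asked for her values of all sets in \<open>Q i\<close>. The queries are fixed in advance, and
  the outcome is a function \<open>g\<close> of the answers only.\<close>
definition mir_value_queries ::
    "nat \<Rightarrow> nat \<Rightarrow> valuation set \<Rightarrow> allocation set \<Rightarrow> real \<Rightarrow> bool" where
  "mir_value_queries n m V \<A> q \<longleftrightarrow>
     (\<exists>Q g. (\<forall>i<n. Q i \<subseteq> Pow {..<m}) \<and> real (\<Sum>i<n. card (Q i)) \<le> q \<and>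
            (\<forall>v. (\<forall>i<n. v i \<in> V) \<longrightarrow>
                 mir_outcome n \<A> v (g (\<lambda>i\<in>{..<n}. restrict (v i) (Q i)))))"


section \<open>Succinct representation\<close>

text \<open>A Boolean circuit is a list of gates, whose arguments are the positions of earlier gates,
  together with the list of gates that hold the binary digits of the output, least
  significant digit first. \<open>Input j\<close> tells whether item \<open>j\<close> belongs to the set.\<close>
datatype gate = Input nat | Neg nat | Conj nat nat | Disj nat nat

type_synonym circuit = "gate list \<times> nat list"

primrec gate_wf :: "nat \<Rightarrow> nat \<Rightarrow> gate \<Rightarrow> bool" where
  "gate_wf m p (Input j) \<longleftrightarrow> j < m"
| "gate_wf m p (Neg a) \<longleftrightarrow> a < p"
| "gate_wf m p (Conj a b) \<longleftrightarrow> a < p \<and> b < p"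
| "gate_wf m p (Disj a b) \<longleftrightarrow> a < p \<and> b < p"

definition circuit_wf :: "nat \<Rightarrow> circuit \<Rightarrow> bool" where
  "circuit_wf m c \<longleftrightarrow>
     (\<forall>p < length (fst c). gate_wf m p (fst c ! p)) \<and> (\<forall>a \<in> set (snd c). a < length (fst c))"

definition circuit_size :: "circuit \<Rightarrow> nat" where
  "circuit_size c = length (fst c) + length (snd c)"

primrec gate_bit :: "nat set \<Rightarrow> bool list \<Rightarrow> gate \<Rightarrow> bool" where
  "gate_bit S bs (Input j) = (j \<in> S)"
| "gate_bit S bs (Neg a) = (\<not> bs ! a)"
| "gate_bit S bs (Conj a b) = (bs ! a \<and> bs ! b)"
| "gate_bit S bs (Disj a b) = (bs ! a \<or> bs ! b)"

definition circuit_bits :: "nat set \<Rightarrow> gate list \<Rightarrow> bool list" where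
  "circuit_bits S gs = foldl (\<lambda>bs g. bs @ [gate_bit S bs g]) [] gs"

definition circuit_valuation :: "circuit \<Rightarrow> valuation" where
  "circuit_valuation c S =
     (\<Sum>l < length (snd c). if circuit_bits S (fst c) ! (snd c ! l) then 2 ^ l else 0)"

text \<open>Running time is measured on a random access machine with a structured control flow. Its state
  consists of registers and of an indirectly addressable memory. Every operation takes
  unit time. As addition and truncated subtraction are the only arithmetic operations, \<open>t\<close>
  steps lengthen the numbers by at most \<open>t\<close> bits, so that this measure is polynomially
  related to the time of a Turing machine.\<close>
datatype program =
    Const nat nat
  | Add nat nat nat
  | Sub nat nat nat
  | Load nat nat
  | Store nat nat
  | Seq program program
  | If_Nonzero nat program program
  | While_Nonzero nat program

type_synonym state = "(nat \<Rightarrow> nat) \<times> (nat \<Rightarrow> nat)"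

inductive exec :: "program \<Rightarrow> state \<Rightarrow> nat \<Rightarrow> state \<Rightarrow> bool" where
  Const: "exec (Const x a) (r, mem) 1 (r(x := a), mem)"
| Add: "exec (Add x y z) (r, mem) 1 (r(x := r y + r z), mem)"
| Sub: "exec (Sub x y z) (r, mem) 1 (r(x := r y - r z), mem)"
| Load: "exec (Load x y) (r, mem) 1 (r(x := mem (r y)), mem)"
| Store: "exec (Store x y) (r, mem) 1 (r, mem(r x := r y))"
| Seq: "exec P s t s' \<Longrightarrow> exec Q s' t' s'' \<Longrightarrow> exec (Seq P Q) s (t + t') s''"
| If_True: "fst s x \<noteq> 0 \<Longrightarrow> exec P s t s' \<Longrightarrow> exec (If_Nonzero x P Q) s (Suc t) s'"
| If_False: "fst s x = 0 \<Longrightarrow> exec Q s t s' \<Longrightarrow> exec (If_Nonzero x P Q) s (Suc t) s'"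
| While_True: "fst s x \<noteq> 0 \<Longrightarrow> exec P s t s' \<Longrightarrow> exec (While_Nonzero x P) s' t' s'' \<Longrightarrow>
    exec (While_Nonzero x P) s (Suc (t + t')) s''"
| While_False: "fst s x = 0 \<Longrightarrow> exec (While_Nonzero x P) s 1 s"

primrec encode_gate :: "gate \<Rightarrow> nat list" where
  "encode_gate (Input j) = [0, j, 0]"
| "encode_gate (Neg a) = [1, a, 0]"
| "encode_gate (Conj a b) = [2, a, b]"
| "encode_gate (Disj a b) = [3, a, b]"

definition encode_circuit :: "circuit \<Rightarrow> nat list" where
  "encode_circuit c =
     [length (fst c), length (snd c)] @ concat (map encode_gate (fst c)) @ snd c"

text \<open>The list \<open>adv\<close> describes the combinatorial object on which the mechanism depends; it need
  not be efficiently constructible.\<close>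
definition encode_input :: "nat \<Rightarrow> nat list \<Rightarrow> circuit list \<Rightarrow> nat list" where
  "encode_input m adv cs = [m, length cs, length adv] @ adv @ concat (map encode_circuit cs)"

definition initial_state :: "nat list \<Rightarrow> state" where
  "initial_state xs = (\<lambda>_. 0, \<lambda>a. if a < length xs then xs ! a else 0)"

text \<open>The final memory holds, in its cell \<open>j < m\<close>, the bidder who receives item \<open>j\<close> (any number
  \<open>\<ge> n\<close> if nobody does), and, in its cell \<open>m + i\<close>, the payment of bidder \<open>i\<close>.\<close>
definition decode_outcome :: "nat \<Rightarrow> nat \<Rightarrow> state \<Rightarrow> outcome" where
  "decode_outcome n m s =
     ((\<lambda>i\<in>{..<n}. {j. j < m \<and> snd s j = i}), \<lambda>i. real (snd s (m + i)))"

text \<open>The program \<open>P\<close> with advice \<open>adv\<close> implements the MIR mechanism in time \<open>T\<close> if the monotone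
  valuations are given by circuits of size at most \<open>z\<close>.\<close>
definition mir_succinct_time ::
    "nat \<Rightarrow> nat \<Rightarrow> real \<Rightarrow> allocation set \<Rightarrow> program \<Rightarrow> nat list \<Rightarrow> real \<Rightarrow> bool" where
  "mir_succinct_time n m z \<A> P adv T \<longleftrightarrow>
     (\<forall>cs. length cs = n \<and>
           (\<forall>c \<in> set cs. circuit_wf m c \<and> real (circuit_size c) \<le> z \<and>
                         circuit_valuation c \<in> monotone_valuations m) \<longrightarrow>
        (\<exists>t s. exec P (initial_state (encode_input m adv cs)) t s \<and> real t \<le> T \<and>
               mir_outcome n \<A> (\<lambda>i. circuit_valuation (cs ! i)) (decode_outcome n m s)))"

end

theory Submission
  imports Defs "HOL-Combinatorics.Permutations" "HOL-Real_Asymp.Real_Asymp"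
begin

text \<open>Lower bound: let \<open>n\<close> bidders be single-minded on the parts of a partition of the items
  into \<open>n\<close> sets of size \<open>d\<close>. An approximation guarantee below \<open>n\<close> forces the bank to satisfy two of them
  simultaneously, for every such partition. Averaging over swaps of the items of two bidders shows that, for some
  pair of bidders, the bank realizes a \<open>1 / n\<^sup>2\<close> fraction of all \<open>2\<^sup>d\<close> ways to split some \<open>d\<close> items between
  them, and hence, by the Sauer-Shelah lemma, all splits of a set of size proportional to \<open>d\<close>. Exact
  maximization over these splits requires communication exponential in \<open>d\<close>, by a fooling set
  of valuations that differ on the middle layer only. With \<open>d\<close> a large multiple of \<open>k\<close> this
  gives a guarantee of at least \<open>n = \<Omega>(m / k)\<close>.

  Upper bound: for \<open>s = \<epsilon> k\<close> there are \<open>2\<^bsup>O(s)\<^esup> s log m\<close> partitions of the items into \<open>s\<close> bundles such that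
  every set of \<open>s\<close> items is split completely by one of them. The bank assigns the bundles of one of these
  partitions arbitrarily. It contains allocations that satisfy any group of bidders who receive at most \<open>s\<close> items in
  total, and the bidders of an optimal allocation fall into \<open>O(m / s)\<close> such groups and single bidders.
  The optimum is found by dynamic programming over sets of bundles. As the advice may depend on \<open>m\<close>, \<open>n\<close> and \<open>k\<close>, it
  can contain an unrolled, oblivious straight-line program for this; the uniform program merely interprets it.\<close>

section \<open>Shattered families and the lower bound\<close>

text \<open>The partitions of the lower bound come from \<open>d\<close> rows of \<open>n\<close>
  items, with an independent permutation in each row. Exchanging two bidders in any set of rows then
  yields a partition of the same kind, so the exchanges form a cube on which a dense family of
  subsets can be counted. Fixing the pair of bidders costs a factor n^2, which is affordable as soon
  as n^4 < 2^d; here \<open>d\<close> has to exceed a multiple of log m, and k = Omega(log m)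
  enters. In the upper bound, the number of bidders, the length of the values and the number of
  bundles share one budget, so the fraction of \<open>k\<close> used for bundles is dictated by the
  exponent that the first two leave. For the running time, the obstacle is that circuits vary in
  size and the optimal allocation depends on them, while straight-line code cannot index its own
  results. Circuit fields are therefore read at computed addresses, positions behind the end of a
  circuit are masked, and an input-dependent allocation is represented by numbers only: the owners
  of the items, the values of the shares and the total welfare.\<close>

definition shatters :: "'a set set \<Rightarrow> 'a set \<Rightarrow> bool" where
  "shatters F S \<longleftrightarrow> (\<forall>R\<subseteq>S. \<exists>A\<in>F. A \<inter> S = R)"

lemma shatters_mono: "shatters F S \<Longrightarrow> S' \<subseteq> S \<Longrightarrow> shatters F S'"
  unfolding shatters_def
proof (intro allI impI)
  fix R assume *: "\<forall>R\<subseteq>S. \<exists>A\<in>F. A \<inter> S = R" "S' \<subseteq> S" "R \<subseteq> S'"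
  then obtain A where "A \<in> F" "A \<inter> S = R" by (meson subset_trans)
  then show "\<exists>A\<in>F. A \<inter> S' = R" using *(2,3) by blast
qed

text \<open>Pajor's form of the Sauer-Shelah lemma. Deleting \<open>x\<close> maps \<open>F\<close>
  onto \<open>F0 \<union> F1\<close>, and the loss in cardinality is \<open>F0 \<inter> F1\<close>.
  A set shattered by the union is shattered by \<open>F\<close>; a set shattered by the intersection
  remains so after adding \<open>x\<close>, because each trace occurs in \<open>F\<close> both with
  and without \<open>x\<close>. The two kinds of sets differ in whether they contain
  \<open>x\<close>.\<close>

lemma card_le_card_shattered:
  assumes "finite X" "F \<subseteq> Pow X"
  shows "card F \<le> card {S. S \<subseteq> X \<and> shatters F S}"
  using assms
proof (induction X arbitrary: F rule: finite_induct)
  case empty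
  show ?case
  proof (cases "F = {}")
    case False
    then have F: "F = {{}}" using empty by auto
    have "{S. S \<subseteq> {} \<and> shatters F S} = {{}}" unfolding F shatters_def by auto
    then show ?thesis using F by simp
  qed simp
next
  case (insert x X)
  define F0 where "F0 = {A\<in>F. x \<notin> A}"
  define F1 where "F1 = {A. x \<notin> A \<and> insert x A \<in> F}"
  have sub0: "F0 \<subseteq> Pow X" "F1 \<subseteq> Pow X" using insert.prems by (auto simp: F0_def F1_def)
  then have fin: "finite F0" "finite F1" using insert.hyps(1) finite_subset by blast+
  have "F = F0 \<union> insert x ` F1"
  proof (intro equalityI subsetI)
    fix A assume A: "A \<in> F"
    show "A \<in> F0 \<union> insert x ` F1"
    proof (cases "x \<in> A")
      case True
      then have "A = insert x (A - {x})" by auto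
      then show ?thesis using A F1_def by (metis (mono_tags, lifting) Diff_iff UnI2 image_eqI mem_Collect_eq singletonI)
    qed (use A F0_def in auto)
  qed (auto simp: F0_def F1_def)
  moreover have "F0 \<inter> insert x ` F1 = {}" by (auto simp: F0_def)
  moreover have "inj_on (insert x) F1" by (rule inj_onI) (auto simp: F1_def)
  ultimately have "card F = card F0 + card F1"
    using fin by (simp add: card_Un_disjoint card_image)
  also have "\<dots> = card (F0 \<union> F1) + card (F0 \<inter> F1)" using card_Un_Int[OF fin] .
  also have "\<dots> \<le> card {S. S \<subseteq> X \<and> shatters (F0 \<union> F1) S} + card {S. S \<subseteq> X \<and> shatters (F0 \<inter> F1) S}"
    using insert.IH[of "F0 \<union> F1"] insert.IH[of "F0 \<inter> F1"] sub0 by (intro add_mono) auto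
  also have "card {S. S \<subseteq> X \<and> shatters (F0 \<inter> F1) S} = card (insert x ` {S. S \<subseteq> X \<and> shatters (F0 \<inter> F1) S})"
    using insert.hyps(2) by (intro card_image[symmetric] inj_onI) (metis (mono_tags, lifting) insert_ident mem_Collect_eq subsetD)
  also have "card {S. S \<subseteq> X \<and> shatters (F0 \<union> F1) S} + \<dots> =
      card ({S. S \<subseteq> X \<and> shatters (F0 \<union> F1) S} \<union> insert x ` {S. S \<subseteq> X \<and> shatters (F0 \<inter> F1) S})"
    using insert.hyps by (intro card_Un_disjoint[symmetric]) auto
  also have "\<dots> \<le> card {S. S \<subseteq> insert x X \<and> shatters F S}"
  proof (rule card_mono)
    show "finite {S. S \<subseteq> insert x X \<and> shatters F S}" using insert.hyps(1) by simp
    have "shatters F S" if "S \<subseteq> X" "shatters (F0 \<union> F1) S" for S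
      unfolding shatters_def
    proof (intro allI impI)
      fix R assume "R \<subseteq> S"
      then obtain A where A: "A \<in> F0 \<union> F1" "A \<inter> S = R" using \<open>shatters (F0 \<union> F1) S\<close> unfolding shatters_def by blast
      have "insert x A \<inter> S = R" using A(2) \<open>S \<subseteq> X\<close> insert.hyps(2) by auto
      then show "\<exists>A\<in>F. A \<inter> S = R" using A by (auto simp: F0_def F1_def)
    qed
    moreover have "shatters F (insert x S)" if "S \<subseteq> X" "shatters (F0 \<inter> F1) S" for S
      unfolding shatters_def
    proof (intro allI impI)
      fix R assume R: "R \<subseteq> insert x S"
      then have "R - {x} \<subseteq> S" by auto
      then obtain A where A: "A \<in> F0 \<inter> F1" "A \<inter> S = R - {x}"
        using \<open>shatters (F0 \<inter> F1) S\<close> unfolding shatters_def by blast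
      show "\<exists>A\<in>F. A \<inter> insert x S = R"
      proof (cases "x \<in> R")
        case True
        then have "insert x A \<inter> insert x S = R" using A(2) by auto
        moreover have "insert x A \<in> F" using A(1) by (simp add: F1_def)
        ultimately show ?thesis by blast
      next
        case False
        moreover have "A \<in> F" "x \<notin> A" using A(1) by (simp_all add: F0_def)
        ultimately show ?thesis using A(2) by blast
      qed
    qed
    ultimately show "{S. S \<subseteq> X \<and> shatters (F0 \<union> F1) S} \<union> insert x ` {S. S \<subseteq> X \<and> shatters (F0 \<inter> F1) S}
        \<subseteq> {S. S \<subseteq> insert x X \<and> shatters F S}" by auto
  qed
  finally show ?case .
qed

lemma sum_Pow_power_card:
  fixes x :: "'a :: comm_semiring_1"
  assumes "finite X"
  shows "(\<Sum>S\<in>Pow X. x ^ card S) = (1 + x) ^ card X"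
  using assms
proof (induction rule: finite_induct)
  case (insert a X)
  have "(\<Sum>S\<in>Pow (insert a X). x ^ card S) = (\<Sum>S\<in>Pow X. x ^ card S) + (\<Sum>S\<in>insert a ` Pow X. x ^ card S)"
    unfolding Pow_insert using insert.hyps by (intro sum.union_disjoint) auto
  also have "(\<Sum>S\<in>insert a ` Pow X. x ^ card S) = (\<Sum>S\<in>Pow X. x ^ card (insert a S))"
    using insert.hyps(2) by (intro sum.reindex_cong[of "insert a"] inj_onI) (auto intro: insert_ident)
  also have "\<dots> = (\<Sum>S\<in>Pow X. x * x ^ card S)"
  proof (intro sum.cong refl)
    fix S assume "S \<in> Pow X"
    then have "finite S" "a \<notin> S" using insert.hyps finite_subset by blast+
    then show "x ^ card (insert a S) = x * x ^ card S" by simp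
  qed
  finally show ?case using insert by (simp add: sum_distrib_left[symmetric] algebra_simps)
qed simp

text \<open>Exponential moment bound: with weights (1/8)^|S|, each small set weighs at least
  (1/8)^y, and all subsets together weigh (9/8)^|X|.\<close>

lemma card_small_subsets_le:
  assumes "finite X"
  shows "real (card {S. S \<subseteq> X \<and> card S < y}) \<le> (9/8) ^ card X * 8 ^ y"
proof -
  let ?L = "{S. S \<subseteq> X \<and> card S < y}"
  have "real (card ?L) * (1/8) ^ y = (\<Sum>S\<in>?L. (1/8) ^ y)" by simp
  also have "\<dots> \<le> (\<Sum>S\<in>?L. (1/8) ^ card S)" by (intro sum_mono power_decreasing) auto
  also have "\<dots> \<le> (\<Sum>S\<in>Pow X. (1/8) ^ card S)" using assms by (intro sum_mono2) auto
  also have "\<dots> = (9/8) ^ card X" using sum_Pow_power_card[OF assms, of "1/8::real"] by simp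
  finally show ?thesis by (simp add: power_divide field_simps)
qed

text \<open>If all shattered sets were smaller than \<open>y\<close>, then |F| \<le> (9/8)^d 8^y.
  Fourth powers remove the roots: (9/8)^4 < 2 and 8^(4y) = 2^(12y) \<le> 2^d, so |F| is at most
  2^(d/2). But a family of density 1/n^2 with n^4 < 2^d is larger than that.\<close>

lemma large_shattered_set:
  fixes X :: "'a set"
  assumes X: "finite X" "card X = d" and F: "F \<subseteq> Pow X"
    and large: "2 ^ d \<le> n ^ 2 * card F" and n: "n ^ 4 < (2::nat) ^ d" and y: "12 * y \<le> d"
  shows "\<exists>S\<subseteq>X. card S = y \<and> shatters F S"
proof -
  have "\<exists>S\<subseteq>X. card S \<ge> y \<and> shatters F S"
  proof (rule ccontr)
    assume no: "\<not> ?thesis"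
    have "card F \<le> card {S. S \<subseteq> X \<and> shatters F S}" by (rule card_le_card_shattered[OF X(1) F])
    also have "\<dots> \<le> card {S. S \<subseteq> X \<and> card S < y}"
      using no X(1) by (intro card_mono) (auto simp: not_le[symmetric])
    finally have "real (card F) \<le> (9/8) ^ d * 8 ^ y"
      using card_small_subsets_le[OF X(1), of y] X(2) by (simp add: order_trans of_nat_mono)
    then have "real (card F) ^ 4 \<le> ((9/8) ^ d * 8 ^ y) ^ 4" by (intro power_mono) auto
    also have "\<dots> = ((9/8) ^ 4) ^ d * 2 ^ (12 * y)"
    proof -
      have "((8::real) ^ y) ^ 4 = (8 ^ 4) ^ y" by (simp only: power_mult[symmetric] mult.commute)
      also have "\<dots> = (2 ^ 12) ^ y" by simp
      finally have "((8::real) ^ y) ^ 4 = 2 ^ (12 * y)" by (simp only: power_mult)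
      moreover have "(((9::real)/8) ^ d) ^ 4 = ((9/8) ^ 4) ^ d" by (simp only: power_mult[symmetric] mult.commute)
      ultimately show ?thesis by (simp only: power_mult_distrib)
    qed
    also have "\<dots> \<le> 2 ^ d * 2 ^ d"
      using y by (intro mult_mono power_mono power_increasing) (auto simp: power_divide)
    finally have F4: "real (card F) ^ 4 \<le> 2 ^ d * 2 ^ d" .
    have "(2::real) ^ d \<le> real n ^ 2 * real (card F)"
      using of_nat_mono[OF large, where 'a = real] by simp
    then have "((2::real) ^ d) ^ 4 \<le> (real n ^ 2 * real (card F)) ^ 4" by (intro power_mono) auto
    also have "\<dots> = (real n ^ 4) ^ 2 * real (card F) ^ 4"
      by (simp add: power_mult_distrib power_mult[symmetric])
    also have "\<dots> \<le> (real n ^ 4) ^ 2 * (2 ^ d * 2 ^ d)" using F4 by (intro mult_left_mono) auto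
    also have "\<dots> < (2 ^ d) ^ 2 * (2 ^ d * 2 ^ d)"
      using of_nat_less_iff[of "n ^ 4" "2 ^ d", where 'a = real] n
      by (intro mult_strict_right_mono power_strict_mono) auto
    finally show False by (simp add: power_mult[symmetric] power_add[symmetric] mult.commute algebra_simps)
  qed
  then obtain S where S: "S \<subseteq> X" "y \<le> card S" "shatters F S" by blast
  obtain S' where "S' \<subseteq> S" "card S' = y" using obtain_subset_with_card_n[OF S(2)] by metis
  then show ?thesis using S shatters_mono by blast
qed

section \<open>Fooling sets and exact maximization over splits\<close>

text \<open>Rectangle property along the diagonal. If all profiles in which both bidders carry the
  same label follow one path, then so do the mixed profiles (f, g) and (g, f), since each bit
  depends on one bidder and hence on at most one label. Keeping the larger side of \<open>W\<close>
  at every bit at most halves it, so two labels survive at a leaf.\<close>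

lemma fooling_pair:
  assumes "finite W" "card W > 2 ^ c" "i \<noteq> i'"
    and "\<And>f. f \<in> W \<Longrightarrow> protocol_cost \<pi> (\<lambda>j. if j = i then x f else if j = i' then y f else z) \<le> c"
  shows "\<exists>f\<in>W. \<exists>g\<in>W. f \<noteq> g \<and>
    protocol_outcome \<pi> (\<lambda>j. if j = i then x f else if j = i' then y g else z) =
    protocol_outcome \<pi> (\<lambda>j. if j = i then x g else if j = i' then y f else z)"
  using assms
proof (induction \<pi> arbitrary: W c)
  case (Done o')
  have "(1::nat) \<le> 2 ^ c" by simp
  then have "card W > 1" using Done.prems(2) by linarith
  then obtain f g where "f \<in> W" "g \<in> W" "f \<noteq> g"
    by (metis Done.prems(1) card_le_Suc0_iff_eq One_nat_def not_le)
  then show ?case by auto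
next
  case (Speak j p l r)
  define v where "v = (\<lambda>f j. if j = i then x f else if j = i' then y f else z)"
  have c: "c > 0"
  proof (rule ccontr)
    assume "\<not> c > 0"
    moreover obtain f where "f \<in> W" using Speak.prems(2) by fastforce
    ultimately show False using Speak.prems(4)[of f] by simp
  qed
  define W1 where "W1 = {f\<in>W. p (v f j)}"
  define W0 where "W0 = {f\<in>W. \<not> p (v f j)}"
  have "W = W1 \<union> W0" "W1 \<inter> W0 = {}" by (auto simp: W1_def W0_def)
  then have "card W = card W1 + card W0" using Speak.prems(1) by (metis card_Un_disjoint finite_Un)
  moreover have "(2::nat) ^ c = 2 * 2 ^ (c - 1)" using c by (cases c) auto
  ultimately consider "card W1 > 2 ^ (c - 1)" | "card W0 > 2 ^ (c - 1)" using Speak.prems(2) by linarith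
  then show ?case
  proof cases
    case 1
    have "\<exists>f\<in>W1. \<exists>g\<in>W1. f \<noteq> g \<and>
      protocol_outcome r (\<lambda>j. if j = i then x f else if j = i' then y g else z) =
      protocol_outcome r (\<lambda>j. if j = i then x g else if j = i' then y f else z)"
    proof (rule Speak.IH(2)[OF _ 1 Speak.prems(3)])
      show "finite W1" using Speak.prems(1) by (simp add: W1_def)
      fix f assume "f \<in> W1"
      then have "f \<in> W" "p (v f j)" by (auto simp: W1_def)
      then show "protocol_cost r (\<lambda>j. if j = i then x f else if j = i' then y f else z) \<le> c - 1"
        using Speak.prems(4)[of f] by (simp add: v_def)
    qed
    then obtain f g where "f \<in> W1" "g \<in> W1" "f \<noteq> g"
      "protocol_outcome r (\<lambda>j. if j = i then x f else if j = i' then y g else z) =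
      protocol_outcome r (\<lambda>j. if j = i then x g else if j = i' then y f else z)" by blast
    then show ?thesis using Speak.prems(3) by (intro bexI[of _ f] bexI[of _ g]) (auto simp: W1_def v_def)
  next
    case 2
    have "\<exists>f\<in>W0. \<exists>g\<in>W0. f \<noteq> g \<and>
      protocol_outcome l (\<lambda>j. if j = i then x f else if j = i' then y g else z) =
      protocol_outcome l (\<lambda>j. if j = i then x g else if j = i' then y f else z)"
    proof (rule Speak.IH(1)[OF _ 2 Speak.prems(3)])
      show "finite W0" using Speak.prems(1) by (simp add: W0_def)
      fix f assume "f \<in> W0"
      then have "f \<in> W" "\<not> p (v f j)" by (auto simp: W0_def)
      then show "protocol_cost l (\<lambda>j. if j = i then x f else if j = i' then y f else z) \<le> c - 1"
        using Speak.prems(4)[of f] by (simp add: v_def)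
    qed
    then obtain f g where "f \<in> W0" "g \<in> W0" "f \<noteq> g"
      "protocol_outcome l (\<lambda>j. if j = i then x f else if j = i' then y g else z) =
      protocol_outcome l (\<lambda>j. if j = i then x g else if j = i' then y f else z)" by blast
    then show ?thesis using Speak.prems(3) by (intro bexI[of _ f] bexI[of _ g]) (auto simp: W0_def v_def)
  qed
qed

lemma finite_allocations [simp]: "finite (allocations n m)"
proof -
  have "finite ({..<n} \<rightarrow>\<^sub>E Pow {..<m})" by (intro finite_PiE) auto
  then show ?thesis unfolding allocations_def by simp
qed

lemma allocations_disjoint:
  "A \<in> allocations n m \<Longrightarrow> i < n \<Longrightarrow> i' < n \<Longrightarrow> i \<noteq> i' \<Longrightarrow> A i \<inter> A i' = {}"
  unfolding allocations_def disjoint_family_on_def by auto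

lemma allocation_subset: "A \<in> allocations n m \<Longrightarrow> i < n \<Longrightarrow> A i \<subseteq> {..<m}"
  unfolding allocations_def by auto

lemma welfare_le_MIR:
  assumes "allocation_bank n m \<A>" "A \<in> \<A>"
  shows "welfare n v A \<le> MIR n \<A> v"
  using assms finite_subset[of \<A> "allocations n m"] unfolding MIR_def allocation_bank_def by (intro Max_ge) auto

lemma MIR_attained:
  assumes "allocation_bank n m \<A>"
  obtains A where "A \<in> \<A>" "welfare n v A = MIR n \<A> v"
proof -
  have "finite \<A>" using assms finite_subset[of \<A> "allocations n m"] by (auto simp: allocation_bank_def)
  then have "MIR n \<A> v \<in> welfare n v ` \<A>"
    using assms unfolding MIR_def allocation_bank_def by (intro Max_in) auto
  then show ?thesis using that by auto
qed

lemma welfare_le_OPT: "A \<in> allocations n m \<Longrightarrow> welfare n v A \<le> OPT n m v"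
  unfolding OPT_def by (intro Max_ge) auto

lemma central_binomial_ge: "2 ^ t \<le> (2 * t) choose t"
proof (induction t)
  case (Suc t)
  have "2 ^ Suc t \<le> 2 * ((2 * t) choose t)" using Suc by simp
  also have "\<dots> \<le> (2 * t choose t) + (2 * t choose Suc t) + (2 * t + 1 choose t)"
    by (cases t) (auto simp: Suc_eq_plus1[symmetric] simp del: Suc_eq_plus1)
  also have "\<dots> = (2 * Suc t) choose Suc t" by simp
  finally show ?case .
qed simp

text \<open>Sets of the middle size are pairwise incomparable, so every choice of \<open>f\<close>
  gives a monotone valuation. This makes doubly exponentially many valuations with the values 0, 1
  and 2 only.\<close>

definition middle_valuation :: "nat set \<Rightarrow> nat \<Rightarrow> nat set set \<Rightarrow> valuation" where
  "middle_valuation Y t f S =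
     (if card (S \<inter> Y) < t then 0 else if card (S \<inter> Y) = t \<and> S \<inter> Y \<notin> f then 1 else 2)"

lemma middle_valuation_bounded:
  assumes "finite Y" "2 < B"
  shows "middle_valuation Y t f \<in> bounded_valuations m B"
proof -
  have "middle_valuation Y t f S \<le> middle_valuation Y t f T" if "S \<subseteq> T" for S T
  proof -
    have le: "card (S \<inter> Y) \<le> card (T \<inter> Y)" using that assms(1) by (intro card_mono) auto
    show ?thesis
    proof (cases "card (S \<inter> Y) = card (T \<inter> Y)")
      case True
      then have "S \<inter> Y = T \<inter> Y" using that assms(1) by (intro card_subset_eq) auto
      then show ?thesis by (simp add: middle_valuation_def)
    next
      case False
      then show ?thesis using le by (auto simp: middle_valuation_def)
    qed
  qed
  moreover have "middle_valuation Y t f S \<in> \<nat>" "middle_valuation Y t f S < B" "0 \<le> middle_valuation Y t f S" for S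
    using assms by (auto simp: middle_valuation_def)
  ultimately show ?thesis unfolding bounded_valuations_def monotone_valuations_def by auto
qed

lemma zero_bounded: "0 < B \<Longrightarrow> (\<lambda>_. 0) \<in> bounded_valuations m B"
  unfolding bounded_valuations_def monotone_valuations_def by auto

text \<open>Bidder \<open>i\<close> carries \<open>f\<close> and bidder \<open>i'\<close> the
  complementary family \<open>dual g\<close>, so that giving a middle set \<open>S\<close> to
  \<open>i\<close> and \<open>Y - S\<close> to \<open>i'\<close> is worth 2 + [S \<in> f] +
  [S \<notin> g]. For f = g every such split is worth 3. For f \<noteq> g one of the profiles (f, g)
  and (g, f) admits 4; an allocation attaining this is a balanced split and worth only 2 in the
  other profile, where 3 is possible. Hence no outcome is correct for both, against
  \<open>fooling_pair\<close>.\<close>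

lemma mir_communication_shattered:
  assumes bank: "allocation_bank n m \<A>" and i: "i < n" "i' < n" "i \<noteq> i'"
    and Y: "finite Y" "card Y = 2 * t" "t > 0"
    and sh: "\<And>R. R \<subseteq> Y \<Longrightarrow> \<exists>A\<in>\<A>. R \<subseteq> A i \<and> Y - R \<subseteq> A i'"
    and B: "2 < B" and comm: "mir_communication n (bounded_valuations m B) \<A> b"
  shows "real ((2 * t) choose t) \<le> b"
proof (rule ccontr)
  assume "\<not> ?thesis"
  then have b: "b < real ((2 * t) choose t)" by simp
  define Mid where "Mid = {S. S \<subseteq> Y \<and> card S = t}"
  define dual where "dual f = {S. Y - S \<notin> f}" for f :: "nat set set"
  \<comment> \<open>Every label has a member, which guarantees welfare at least 3 in the profile (f,
    g) for any \<open>g\<close>.\<close>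
  define W where "W = Pow Mid - {{}}"
  define prof where "prof f g = (\<lambda>j. if j = i then middle_valuation Y t f else
      if j = i' then middle_valuation Y t (dual g) else (\<lambda>_. 0))" for f g
  obtain \<pi> where \<pi>: "\<And>v. (\<forall>i<n. v i \<in> bounded_valuations m B) \<Longrightarrow>
      mir_outcome n \<A> v (protocol_outcome \<pi> v) \<and> real (protocol_cost \<pi> v) \<le> b"
    using comm unfolding mir_communication_def by blast
  have valid: "\<forall>j<n. prof f g j \<in> bounded_valuations m B" for f g
    using middle_valuation_bounded[OF Y(1) B] zero_bounded B by (auto simp: prof_def)
  have welf: "welfare n (prof f g) A = middle_valuation Y t f (A i) + middle_valuation Y t (dual g) (A i')" for f g A
  proof -
    have "welfare n (prof f g) A = (\<Sum>j\<in>{i, i'}. prof f g j (A j))"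
      unfolding welfare_def using i by (intro sum.mono_neutral_right) (auto simp: prof_def)
    then show ?thesis using i by (simp add: prof_def)
  qed
  define c where "c = nat \<lfloor>b\<rfloor>"
  have c: "protocol_cost \<pi> (prof f g) \<le> c" for f g
    using \<pi>[OF valid[of f g]] unfolding c_def by (simp add: le_nat_floor)
  have Midfin: "finite Mid" using Y(1) by (simp add: Mid_def)
  have cardMid: "card Mid = (2 * t) choose t" unfolding Mid_def using n_subsets[OF Y(1)] Y(2) by simp
  have b0: "0 \<le> b" using \<pi>[OF valid[of "{}" "{}"]] by (meson of_nat_0_le_iff order_trans)
  have "c < card Mid" using b b0 cardMid unfolding c_def by (metis floor_less_iff nat_less_iff of_int_of_nat_eq zero_le_floor)
  \<comment> \<open>Leaving out the empty family costs one label. This would be fatal only if there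
    were a single middle set, which t > 0 excludes.\<close>
  moreover have "2 \<le> card Mid"
  proof -
    have "(2::nat) ^ 1 \<le> 2 ^ t" using Y(3) by (intro power_increasing) auto
    then show ?thesis using cardMid central_binomial_ge[of t] by simp
  qed
  moreover have "card W = 2 ^ card Mid - 1" unfolding W_def using Midfin by (simp add: card_Pow card_Diff_subset)
  ultimately have "2 ^ c < card W"
  proof -
    assume *: "c < card Mid" "2 \<le> card Mid" "card W = 2 ^ card Mid - 1"
    have "(2::nat) ^ c \<le> 2 ^ (card Mid - 1)" using *(1) by (intro power_increasing) auto
    moreover have "(2::nat) ^ card Mid = 2 * 2 ^ (card Mid - 1)" using *(2) by (cases "card Mid") auto
    moreover have "(2::nat) \<le> 2 ^ (card Mid - 1)" using *(2) power_increasing[of 1 "card Mid - 1" "2::nat"] by simp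
    ultimately show ?thesis using *(3) by linarith
  qed
  moreover have "finite W" using Midfin by (simp add: W_def)
  ultimately have "\<exists>f\<in>W. \<exists>g\<in>W. f \<noteq> g \<and> protocol_outcome \<pi> (prof f g) = protocol_outcome \<pi> (prof g f)"
    unfolding prof_def using i(3) c[unfolded prof_def] by (intro fooling_pair) auto
  then obtain f g where fg: "f \<in> W" "g \<in> W" "f \<noteq> g"
    and eq: "protocol_outcome \<pi> (prof f g) = protocol_outcome \<pi> (prof g f)" by blast
  define A where "A = fst (protocol_outcome \<pi> (prof f g))"
  have A: "A \<in> \<A>" "welfare n (prof f g) A = MIR n \<A> (prof f g)" "welfare n (prof g f) A = MIR n \<A> (prof g f)"
    using \<pi>[OF valid[of f g]] \<pi>[OF valid[of g f]] eq by (auto simp: A_def mir_outcome_def)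
  have bank': "\<A> \<subseteq> allocations n m" using bank by (simp add: allocation_bank_def)
  have split: "\<exists>A'\<in>\<A>. A' i \<inter> Y = S \<and> A' i' \<inter> Y = Y - S" if SY: "S \<subseteq> Y" for S
  proof -
    obtain A' where A': "A' \<in> \<A>" "S \<subseteq> A' i" "Y - S \<subseteq> A' i'" using sh[OF SY] by blast
    moreover have "A' i \<inter> A' i' = {}" using A'(1) bank' i allocations_disjoint by blast
    ultimately show ?thesis using SY by (intro bexI[of _ A']) auto
  qed
  have value_split: "\<exists>A'\<in>\<A>. welfare n (prof f g) A' = 2 + of_bool (S \<in> f) + of_bool (S \<notin> g)"
    if S: "S \<in> Mid" for S f g
  proof -
    obtain A' where A': "A' \<in> \<A>" "A' i \<inter> Y = S" "A' i' \<inter> Y = Y - S"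
      using split[of S] S unfolding Mid_def by blast
    have "card S = t" "card (Y - S) = t" "Y - (Y - S) = S"
      using S Y by (auto simp: Mid_def card_Diff_subset finite_subset)
    then have "welfare n (prof f g) A' = 2 + of_bool (S \<in> f) + of_bool (S \<notin> g)"
      unfolding welf middle_valuation_def using A' by (auto simp: dual_def)
    then show ?thesis using A' by blast
  qed
  have MIR3: "3 \<le> MIR n \<A> (prof f g)" if fW: "f \<in> W" for f g
  proof -
    obtain S where "S \<in> f" "S \<in> Mid" using fW by (auto simp: W_def)
    then obtain A' where "A' \<in> \<A>" "welfare n (prof f g) A' \<ge> 3" using value_split[of S f g] by force
    then show ?thesis using welfare_le_MIR[OF bank] by (meson order_trans)
  qed
  have no4: False if S: "f \<in> W" "g \<in> W" "S \<in> f" "S \<notin> g" and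
      A: "A \<in> \<A>" "welfare n (prof f g) A = MIR n \<A> (prof f g)" "welfare n (prof g f) A = MIR n \<A> (prof g f)" for f g S A
  proof -
    have "S \<in> Mid" using S(1,3) by (auto simp: W_def)
    then obtain A' where "A' \<in> \<A>" "welfare n (prof f g) A' \<ge> 4" using value_split[of S f g] S(3,4) by force
    then have "4 \<le> welfare n (prof f g) A" using welfare_le_MIR[OF bank] A(2) by (metis order_trans)
    then have two: "middle_valuation Y t f (A i) = 2" "middle_valuation Y t (dual g) (A i') = 2"
      unfolding welf by (auto simp: middle_valuation_def split: if_splits)
    let ?S = "A i \<inter> Y" and ?S' = "A i' \<inter> Y"
    have fin: "finite ?S" "finite ?S'" using Y by auto
    have dis: "?S \<inter> ?S' = {}" using A(1) bank' i allocations_disjoint by blast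
    have ge: "t \<le> card ?S" "t \<le> card ?S'" using two by (auto simp: middle_valuation_def split: if_splits)
    have un: "card (?S \<union> ?S') = card ?S + card ?S'" using fin dis by (rule card_Un_disjoint)
    moreover have "card (?S \<union> ?S') \<le> 2 * t" using Y(1) unfolding Y(2)[symmetric] by (intro card_mono) auto
    ultimately have ct: "card ?S = t" "card ?S' = t" using ge by linarith+
    then have "?S \<union> ?S' = Y" using Y un by (intro card_subset_eq) auto
    then have S': "?S' = Y - ?S" "Y - ?S' = ?S" using dis by auto
    have "?S \<in> f" "?S \<notin> g" using two ct S' by (auto simp: middle_valuation_def dual_def split: if_splits)
    then have "welfare n (prof g f) A = 2" unfolding welf middle_valuation_def using ct S' by (auto simp: dual_def)
    then show False using MIR3[OF S(2), of f] A(3) by simp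
  qed
  consider S where "S \<in> f" "S \<notin> g" | S where "S \<in> g" "S \<notin> f" using fg(3) by blast
  then show False
  proof cases
    case 1 then show False using no4 fg A by blast
  next
    case 2 then show False using no4 fg A by blast
  qed
qed

lemma single_minded_bounded: "1 < B \<Longrightarrow> (\<lambda>S. of_bool (P \<subseteq> S)) \<in> bounded_valuations m B"
  unfolding bounded_valuations_def monotone_valuations_def by auto

text \<open>Settles the case where \<open>m\<close> is below a constant multiple of
  \<open>k\<close>, so that no bidders remain for the partition argument.\<close>

lemma mir_approx_ge_1:
  assumes bank: "allocation_bank n m \<A>" and "mir_approx n m (bounded_valuations m B) \<A> \<alpha>" and "1 < B" "1 \<le> n"
  shows "1 \<le> \<alpha>"
proof -
  let ?v = "\<lambda>_ S. of_bool ({} \<subseteq> S) :: real"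
  obtain A where A: "A \<in> \<A>" "welfare n ?v A = MIR n \<A> ?v" using MIR_attained[OF bank] by blast
  have "welfare n ?v A \<le> OPT n m ?v" using A(1) bank by (intro welfare_le_OPT) (auto simp: allocation_bank_def)
  moreover have "OPT n m ?v / \<alpha> \<le> MIR n \<A> ?v" and \<alpha>: "0 < \<alpha>"
    using assms single_minded_bounded[of B "{}" m] unfolding mir_approx_def by auto
  moreover have "welfare n ?v A = real n" by (simp add: welfare_def)
  ultimately have "OPT n m ?v / \<alpha> \<le> OPT n m ?v" "0 < OPT n m ?v" using assms(4) A by auto
  then show ?thesis using \<alpha> by (simp add: pos_divide_le_eq mult_le_cancel_left1)
qed

section \<open>From an approximation guarantee to a shattered set of items\<close>

text \<open>Each choice \<sigma> of row permutations forces some pair of bidders to be satisfied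
  together, so one pair is satisfied for a 1/n^2 fraction of them. The exchanges
  \<open>\<tau> R\<close> act as involutions on \<open>\<Sigma>\<close> and preserve this density;
  double counting of the pairs (\<sigma>, R) yields one \<sigma> for which the row sets
  \<open>R\<close> have the same density, and \<open>large_shattered_set\<close> applies to
  them.\<close>

lemma shattering_pair:
  assumes bank: "allocation_bank n m \<A>" and appr: "mir_approx n m (bounded_valuations m B) \<A> \<alpha>"
    and B: "1 < B" and \<alpha>: "\<alpha> < real n" and nd: "n * d \<le> m" and n: "n ^ 4 < 2 ^ d" and y: "12 * y \<le> d"
  shows "\<exists>i<n. \<exists>i'<n. i \<noteq> i' \<and> (\<exists>Y\<subseteq>{..<m}. card Y = y \<and> (\<forall>R\<subseteq>Y. \<exists>A\<in>\<A>. R \<subseteq> A i \<and> Y - R \<subseteq> A i'))"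
proof -
  have \<alpha>0: "0 < \<alpha>" using appr by (simp add: mir_approx_def)
  have n0: "0 < n" using \<alpha> \<alpha>0 by (cases n) auto
  have bank': "\<A> \<subseteq> allocations n m" using bank by (simp add: allocation_bank_def)
  \<comment> \<open>The items below n * d form \<open>d\<close> rows, with r * n + p at place
    \<open>p\<close> of row \<open>r\<close>. Bidder \<open>i\<close> wants one item from each row,
    the one at place \<open>\<sigma> r i\<close>.\<close>
  define \<Sigma> where "\<Sigma> = ({..<d} \<rightarrow>\<^sub>E {p. p permutes {..<n}})"
  define P where "P \<sigma> i = (\<lambda>r. r * n + \<sigma> r i) ` {..<d}" for \<sigma> :: "nat \<Rightarrow> nat \<Rightarrow> nat" and i
  have \<Sigma>fin: "finite \<Sigma>" unfolding \<Sigma>_def by (intro finite_PiE) (auto intro: finite_permutations)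
  have "(\<lambda>r\<in>{..<d}. id) \<in> \<Sigma>" unfolding \<Sigma>_def by (auto intro: permutes_id)
  then have \<Sigma>pos: "0 < card \<Sigma>" using \<Sigma>fin card_gt_0_iff by blast
  have item: "r * n + p < m" "(r * n + p) div n = r" "(r * n + p) mod n = p" if "r < d" "p < n" for r p
  proof -
    have "r * n + p < (r + 1) * n" using that by simp
    also have "\<dots> \<le> d * n" using that by (intro mult_right_mono) auto
    finally show "r * n + p < m" using nd by (simp add: mult.commute)
  qed (use that in auto)
  have perm: "\<sigma> r i < n" if "\<sigma> \<in> \<Sigma>" "r < d" "i < n" for \<sigma> r i
    using that permutes_in_image[of "\<sigma> r" "{..<n}" i] unfolding \<Sigma>_def by (auto simp: PiE_iff)
  have perm_inj: "\<sigma> r i = \<sigma> r i' \<longleftrightarrow> i = i'" if "\<sigma> \<in> \<Sigma>" "r < d" for \<sigma> r i i'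
    using that permutes_inj[of "\<sigma> r" "{..<n}"] unfolding \<Sigma>_def by (auto simp: PiE_iff inj_def)
  define pairs where "pairs = {(i, i'). i < n \<and> i' < n \<and> i \<noteq> i'}"
  define G where "G p = {\<sigma>\<in>\<Sigma>. \<exists>A\<in>\<A>. P \<sigma> (fst p) \<subseteq> A (fst p) \<and> P \<sigma> (snd p) \<subseteq> A (snd p)}" for p
  have pairs: "finite pairs" "card pairs \<le> n ^ 2"
  proof -
    have sub: "pairs \<subseteq> {..<n} \<times> {..<n}" by (auto simp: pairs_def)
    show "finite pairs" using finite_subset[OF sub] by simp
    show "card pairs \<le> n ^ 2" using card_mono[OF _ sub] by (simp add: card_cartesian_product power2_eq_square)
  qed
  have cover: "\<Sigma> \<subseteq> (\<Union>p\<in>pairs. G p)"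
  proof
    fix \<sigma> assume \<sigma>: "\<sigma> \<in> \<Sigma>"
    define v where "v = (\<lambda>i S. of_bool (P \<sigma> i \<subseteq> S) :: real)"
    define A0 where "A0 = (\<lambda>i\<in>{..<n}. P \<sigma> i)"
    have disj: "P \<sigma> i \<inter> P \<sigma> i' = {}" if "i < n" "i' < n" "i \<noteq> i'" for i i'
    proof (rule ccontr)
      assume "P \<sigma> i \<inter> P \<sigma> i' \<noteq> {}"
      then obtain r r' where r: "r < d" "r' < d" "r * n + \<sigma> r i = r' * n + \<sigma> r' i'" by (auto simp: P_def)
      have "r = r'" using item(2)[OF r(1) perm[OF \<sigma> r(1) that(1)]] item(2)[OF r(2) perm[OF \<sigma> r(2) that(2)]] r(3) by metis
      then have "\<sigma> r i = \<sigma> r i'" using r(3) by simp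
      then show False using perm_inj[OF \<sigma> r(1)] that(3) by simp
    qed
    have "A0 \<in> allocations n m"
      unfolding allocations_def disjoint_family_on_def using disj item(1) perm[OF \<sigma>]
      by (auto simp: A0_def P_def)
    then have "welfare n v A0 \<le> OPT n m v" by (rule welfare_le_OPT)
    moreover have "welfare n v A0 = real n" by (simp add: welfare_def v_def A0_def)
    moreover have "OPT n m v / \<alpha> \<le> MIR n \<A> v"
      using appr single_minded_bounded[OF B] by (auto simp: mir_approx_def v_def)
    moreover have "1 < real n / \<alpha>" using \<alpha> \<alpha>0 by simp
    ultimately have "1 < MIR n \<A> v" using \<alpha>0 by (smt (verit) divide_right_mono)
    then obtain A where A: "A \<in> \<A>" "1 < welfare n v A" using MIR_attained[OF bank] by metis
    \<comment> \<open>Welfare counts satisfied bidders, so a value above 1 produces two of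
      them.\<close>
    have "welfare n v A = real (card {i. i < n \<and> P \<sigma> i \<subseteq> A i})"
      by (simp add: welfare_def v_def sum.If_cases of_bool_def Int_def)
    then have "1 < card {i. i < n \<and> P \<sigma> i \<subseteq> A i}" using A by simp
    then obtain i i' where "i < n" "P \<sigma> i \<subseteq> A i" "i' < n" "P \<sigma> i' \<subseteq> A i'" "i \<noteq> i'"
      using card_le_Suc0_iff_eq[of "{i. i < n \<and> P \<sigma> i \<subseteq> A i}"] by auto
    then show "\<sigma> \<in> (\<Union>p\<in>pairs. G p)" using A(1) \<sigma>
      by (intro UN_I[of "(i, i')"]) (auto simp: pairs_def G_def)
  qed
  have "\<exists>p\<in>pairs. card \<Sigma> \<le> n ^ 2 * card (G p)"
  proof (rule ccontr)
    assume no: "\<not> ?thesis"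
    have Gfin: "finite (G p)" for p using \<Sigma>fin by (simp add: G_def)
    have "card \<Sigma> \<le> (\<Sum>p\<in>pairs. card (G p))"
      using card_mono[OF _ cover] card_UN_le[OF pairs(1), of G] pairs(1) Gfin by (meson finite_UN_I order_trans)
    moreover have "n ^ 2 * (\<Sum>p\<in>pairs. card (G p)) < n ^ 2 * card \<Sigma>"
    proof -
      have ne: "pairs \<noteq> {}" using cover \<Sigma>pos by (auto simp: card_gt_0_iff)
      have "n ^ 2 * (\<Sum>p\<in>pairs. card (G p)) = (\<Sum>p\<in>pairs. n ^ 2 * card (G p))" by (rule sum_distrib_left)
      also have "\<dots> < (\<Sum>p\<in>pairs. card \<Sigma>)" using no pairs(1) ne by (intro sum_strict_mono) (auto simp: not_le)
      also have "\<dots> \<le> n ^ 2 * card \<Sigma>" using pairs(2) by (simp add: mult_right_mono)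
      finally show ?thesis .
    qed
    ultimately show False by (metis mult_le_mono2 not_le)
  qed
  then obtain i i' where i: "i < n" "i' < n" "i \<noteq> i'" and large: "card \<Sigma> \<le> n ^ 2 * card (G (i, i'))"
    by (auto simp: pairs_def)
  \<comment> \<open>The exchange moves the item at place \<open>\<sigma> r i\<close> from
    \<open>i\<close> to \<open>i'\<close> exactly in the rows r \<in> R. The sets \<open>R\<close>
    for which the pair is satisfied thus describe how the bank splits these items between
    \<open>i\<close> and \<open>i'\<close>.\<close>
  define \<tau> where "\<tau> R \<sigma> = (\<lambda>r\<in>{..<d}. if r \<in> R then \<sigma> r \<circ> transpose i i' else \<sigma> r)"
    for R and \<sigma> :: "nat \<Rightarrow> nat \<Rightarrow> nat"
  have \<tau>: "\<tau> R \<sigma> \<in> \<Sigma>" "\<tau> R (\<tau> R \<sigma>) = \<sigma>" if "\<sigma> \<in> \<Sigma>" for R \<sigma>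
  proof -
    have "transpose i i' permutes {..<n}" using i by (intro permutes_swap_id) auto
    then show "\<tau> R \<sigma> \<in> \<Sigma>" using that unfolding \<tau>_def \<Sigma>_def by (auto simp: PiE_iff intro: permutes_compose)
    show "\<tau> R (\<tau> R \<sigma>) = \<sigma>"
    proof
      fix r show "\<tau> R (\<tau> R \<sigma>) r = \<sigma> r"
        using that by (cases "r < d") (auto simp: \<tau>_def \<Sigma>_def PiE_iff extensional_def comp_assoc)
    qed
  qed
  have card_\<tau>: "card {\<sigma>\<in>\<Sigma>. \<tau> R \<sigma> \<in> G (i, i')} = card (G (i, i'))" for R
  proof (rule bij_betw_same_card)
    have G\<Sigma>: "G (i, i') \<subseteq> \<Sigma>" by (auto simp: G_def)
    show "bij_betw (\<tau> R) {\<sigma>\<in>\<Sigma>. \<tau> R \<sigma> \<in> G (i, i')} (G (i, i'))"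
      by (rule bij_betw_byWitness[where f' = "\<tau> R"]) (use G\<Sigma> in \<open>auto simp: \<tau> subset_iff\<close>)
  qed
  have "\<exists>\<sigma>\<in>\<Sigma>. 2 ^ d \<le> n ^ 2 * card {R\<in>Pow {..<d}. \<tau> R \<sigma> \<in> G (i, i')}"
  proof (rule ccontr)
    assume no: "\<not> ?thesis"
    have "(\<Sum>\<sigma>\<in>\<Sigma>. n ^ 2 * card {R\<in>Pow {..<d}. \<tau> R \<sigma> \<in> G (i, i')}) < (\<Sum>\<sigma>\<in>\<Sigma>. 2 ^ d)"
      using no \<Sigma>fin \<Sigma>pos by (intro sum_strict_mono) (auto simp: not_le card_gt_0_iff)
    moreover have "(\<Sum>\<sigma>\<in>\<Sigma>. card {R\<in>Pow {..<d}. \<tau> R \<sigma> \<in> G (i, i')}) = 2 ^ d * card (G (i, i'))"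
    proof -
      have "(\<Sum>\<sigma>\<in>\<Sigma>. card {R\<in>Pow {..<d}. \<tau> R \<sigma> \<in> G (i, i')}) =
          (\<Sum>R\<in>Pow {..<d}. card {\<sigma>\<in>\<Sigma>. \<tau> R \<sigma> \<in> G (i, i')})"
        using sum_multicount_gen[of \<Sigma> "Pow {..<d}" "\<lambda>\<sigma> R. \<tau> R \<sigma> \<in> G (i, i')"
            "\<lambda>R. card {\<sigma>\<in>\<Sigma>. \<tau> R \<sigma> \<in> G (i, i')}"] \<Sigma>fin by simp
      then show ?thesis by (simp add: card_\<tau> card_Pow)
    qed
    ultimately have "2 ^ d * (n ^ 2 * card (G (i, i'))) < 2 ^ d * card \<Sigma>"
      by (simp add: sum_distrib_left[symmetric] mult_ac)
    then show False using large by simp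
  qed
  then obtain \<sigma> where \<sigma>: "\<sigma> \<in> \<Sigma>" "2 ^ d \<le> n ^ 2 * card {R\<in>Pow {..<d}. \<tau> R \<sigma> \<in> G (i, i')}" by blast
  obtain S where S: "S \<subseteq> {..<d}" "card S = y" "shatters {R\<in>Pow {..<d}. \<tau> R \<sigma> \<in> G (i, i')} S"
    using large_shattered_set[of "{..<d}" d "{R\<in>Pow {..<d}. \<tau> R \<sigma> \<in> G (i, i')}" n y] \<sigma>(2) n y by auto
  define e where "e r = r * n + \<sigma> r i" for r
  have einj: "inj_on e S"
  proof (rule inj_onI)
    fix r r' assume r: "r \<in> S" "r' \<in> S" "e r = e r'"
    then have "r < d" "r' < d" using S(1) by auto
    then show "r = r'" using item(2)[OF _ perm[OF \<sigma>(1) _ i(1)]] r(3) unfolding e_def by metis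
  qed
  have "\<exists>A\<in>\<A>. R \<subseteq> A i \<and> e ` S - R \<subseteq> A i'" if "R \<subseteq> e ` S" for R
  proof -
    \<comment> \<open>Exchanged rows give their item to \<open>i'\<close>, so the trace of
      \<open>R'\<close> is the complement of the set \<open>R\<close> meant for
      \<open>i\<close>.\<close>
    obtain R' where R': "R' \<subseteq> {..<d}" "\<tau> R' \<sigma> \<in> G (i, i')" "R' \<inter> S = {r\<in>S. e r \<notin> R}"
      using S(3) unfolding shatters_def by (smt (verit) Collect_mem_eq Pow_iff mem_Collect_eq subset_eq)
    then obtain A where A: "A \<in> \<A>" "P (\<tau> R' \<sigma>) i \<subseteq> A i" "P (\<tau> R' \<sigma>) i' \<subseteq> A i'" by (auto simp: G_def)
    have "e r \<in> A i" if "r \<in> S" "e r \<in> R" for r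
    proof -
      have "r < d" "r \<notin> R'" using that R' S(1) by auto
      then have "e r \<in> P (\<tau> R' \<sigma>) i" by (auto simp: P_def \<tau>_def e_def)
      then show ?thesis using A(2) by blast
    qed
    moreover have "e r \<in> A i'" if "r \<in> S" "e r \<notin> R" for r
    proof -
      have "r < d" "r \<in> R'" using that R' S(1) by auto
      then have "e r \<in> P (\<tau> R' \<sigma>) i'" by (auto simp: P_def \<tau>_def e_def intro!: image_eqI[of _ _ r])
      then show ?thesis using A(3) by blast
    qed
    ultimately show ?thesis using that A(1) by (intro bexI[of _ A]) auto
  qed
  moreover have "e ` S \<subseteq> {..<m}" using S(1) item(1) perm[OF \<sigma>(1) _ i(1)] by (auto simp: e_def)
  moreover have "card (e ` S) = y" using einj S(2) by (simp add: card_image)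
  ultimately show ?thesis using i by blast
qed

section \<open>Calibration of the lower bound\<close>

lemma mir_guarantee_lower_bound:
  fixes \<kappa> :: real
  assumes "0 < \<kappa>"
  shows "\<exists>c>0. \<forall>m k N B. 1 \<le> m \<and> 1 \<le> k \<and> log 2 (real m) \<le> \<kappa> * k \<and> real m \<le> N \<and> 2 < B \<longrightarrow>
    ereal (c * (real m / k)) \<le> mir_guarantee N B (2 powr k) m"
proof -
  \<comment> \<open>The rows will satisfy d > K * k - 1. The summand 96 leaves room for 24 * t \<le>
    d, where t \<le> k + 1 \<le> 2 * k, and the other one for 4 * log 2 n \<le> 4 * \<kappa> * k <
    d.\<close>
  define K where "K = 96 + 5 * \<kappa>"
  have K: "96 \<le> K" "5 * \<kappa> < K" using assms by (auto simp: K_def)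
  have "ereal (1 / (2 * K) * (real m / k)) \<le> mir_guarantee N B (2 powr k) m"
    if m: "1 \<le> m" and k: "1 \<le> k" and mk: "log 2 (real m) \<le> \<kappa> * k" and N: "real m \<le> N" and B: "2 < B" for m k N B
    unfolding mir_guarantee_def
  proof (rule Inf_greatest, clarify)
    fix \<alpha> assume \<alpha>: "0 < \<alpha>" and ex: "\<forall>n. 1 \<le> n \<and> real n \<le> N \<longrightarrow> (\<exists>\<A>. allocation_bank n m \<A> \<and>
        mir_approx n m (bounded_valuations m B) \<A> \<alpha> \<and>
        mir_communication n (bounded_valuations m B) \<A> (2 powr k))"
    define q where "q = real m / (K * k)"
    define n where "n = nat \<lfloor>q\<rfloor>"
    have Kk: "0 < K * k" "0 < K" using K k by auto
    have q0: "0 < q" using Kk m by (simp add: q_def)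
    have \<alpha>1: "1 \<le> \<alpha>"
    proof -
      have "real 1 \<le> N" using m N by simp
      then obtain \<A> where "allocation_bank 1 m \<A>" "mir_approx 1 m (bounded_valuations m B) \<A> \<alpha>" using ex by blast
      then show ?thesis using mir_approx_ge_1 B by fastforce
    qed
    have q_eq: "1 / (2 * K) * (real m / k) = q / 2" by (simp add: q_def)
    show "ereal (1 / (2 * K) * (real m / k)) \<le> ereal \<alpha>"
    proof (cases "n = 0")
      case True
      then have "q < 1" using q0 unfolding n_def by linarith
      then show ?thesis using \<alpha>1 q_eq by simp
    next
      case False
      have nq: "real n \<le> q" "q < real n + 1" using q0 unfolding n_def by linarith+
      have "q / 2 \<le> real n" using nq False by linarith
      moreover have "real n \<le> \<alpha>"
      proof (rule ccontr)
        assume "\<not> real n \<le> \<alpha>"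
        then have lt: "\<alpha> < real n" by simp
        define d where "d = m div n"
        \<comment> \<open>The least natural number above \<open>k\<close>: the number of middle
          sets, at least 2^t, then exceeds the budget 2^k.\<close>
        define t where "t = nat \<lfloor>k\<rfloor> + 1"
        have "real n * (K * k) \<le> real m" using nq(1) Kk by (simp add: q_def pos_le_divide_eq)
        moreover have "real m < real n * (real d + 1)"
        proof -
          have "m < n * (d + 1)" using False unfolding d_def by (metis add.commute dividend_less_div_times mult.commute mult_Suc_right neq0_conv plus_1_eq_Suc)
          then show ?thesis by (metis of_nat_less_iff of_nat_mult of_nat_add of_nat_1)
        qed
        ultimately have "real n * (K * k) < real n * (real d + 1)" by linarith
        then have d: "K * k < real d + 1" using False by simp
        have nm: "n \<le> m"
        proof -
          have "1 \<le> K * k" using K k mult_mono[of 1 K 1 k] by simp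
          then have "q \<le> real m" using Kk by (simp add: q_def divide_le_eq mult_le_cancel_left1)
          then show ?thesis using nq(1) by linarith
        qed
        have t: "k < real t" "real t \<le> k + 1" "t > 0" using k unfolding t_def by linarith+
        have "K * k = 96 * k + 5 * (\<kappa> * k)" by (simp add: K_def algebra_simps)
        then have dk: "96 * k + 5 * (\<kappa> * k) < real d + 1" using d by simp
        have \<kappa>k: "0 < \<kappa> * k" using assms k by simp
        have "real (12 * (2 * t)) \<le> real d" using dk t k \<kappa>k by simp
        then have "12 * (2 * t) \<le> d" using of_nat_le_iff by blast
        moreover have "n ^ 4 < 2 ^ d"
        proof -
          have "log 2 (real n) \<le> \<kappa> * k" using mk nm False m by (meson log_le_cancel_iff of_nat_0_less_iff of_nat_le_iff one_less_numeral_iff order_trans semiring_norm(76) neq0_conv le_trans less_le_trans)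
          then have "4 * log 2 (real n) < real d" using dk k \<kappa>k by linarith
          moreover have "log 2 (real n ^ 4) = 4 * log 2 (real n)" using False by (simp add: log_nat_power)
          ultimately have "real n ^ 4 < 2 powr real d" using False by (simp add: log_less_iff[symmetric])
          then have "real (n ^ 4) < real (2 ^ d)" by (simp add: powr_realpow)
          then show ?thesis using of_nat_less_iff by blast
        qed
        moreover have "n * d \<le> m" by (simp add: d_def)
        moreover obtain \<A> where \<A>: "allocation_bank n m \<A>" "mir_approx n m (bounded_valuations m B) \<A> \<alpha>"
            "mir_communication n (bounded_valuations m B) \<A> (2 powr k)"
        proof -
          have "1 \<le> n" "real n \<le> N" using False nm N by auto
          then show ?thesis using ex that by blast
        qed
        ultimately obtain i i' Y where *: "i < n" "i' < n" "i \<noteq> i'" "Y \<subseteq> {..<m}" "card Y = 2 * t"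
            "\<And>R. R \<subseteq> Y \<Longrightarrow> \<exists>A\<in>\<A>. R \<subseteq> A i \<and> Y - R \<subseteq> A i'"
          using shattering_pair[OF \<A>(1,2) _ lt, of d "2 * t"] B by auto
        have "real ((2 * t) choose t) \<le> 2 powr k"
          using mir_communication_shattered[OF \<A>(1) *(1-3) _ *(5) t(3) *(6) B \<A>(3)] *(4) finite_subset by blast
        moreover have "2 powr k < 2 powr real t" using t by simp
        moreover have "2 powr real t \<le> real ((2 * t) choose t)"
          using of_nat_mono[OF central_binomial_ge[of t], where 'a = real] by (simp add: powr_realpow)
        ultimately show False by linarith
      qed
      ultimately show ?thesis using q_eq by simp
    qed
  qed
  then show ?thesis using K by (intro exI[of _ "1 / (2 * K)"]) auto
qed

section \<open>Perfect hashing and the upper bound\<close>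

text \<open>Averaging: as every \<open>X\<close> is hit by a fraction \<open>p\<close> of
  \<open>H\<close>, some \<open>h\<close> hits a fraction \<open>p\<close> of the sets that are
  still missed, and each round leaves at most a fraction 1 - p of them.\<close>

lemma greedy_hitting_family:
  fixes p :: real
  assumes "finite H" "H \<noteq> {}" "finite XX" "0 \<le> p" "p \<le> 1"
    and hit: "\<And>X. X \<in> XX \<Longrightarrow> p * real (card H) \<le> real (card {h\<in>H. hit h X})"
  shows "\<exists>F\<subseteq>H. card F \<le> N \<and> real (card {X\<in>XX. \<forall>h\<in>F. \<not> hit h X}) \<le> (1 - p) ^ N * real (card XX)"
proof (induction N)
  case 0
  show ?case by (intro exI[of _ "{}"]) simp
next
  case (Suc N)
  then obtain F where F: "F \<subseteq> H" "card F \<le> N"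
    "real (card {X\<in>XX. \<forall>h\<in>F. \<not> hit h X}) \<le> (1 - p) ^ N * real (card XX)" by blast
  define U where "U = {X\<in>XX. \<forall>h\<in>F. \<not> hit h X}"
  have Ufin: "finite U" "U \<subseteq> XX" using assms(3) by (auto simp: U_def)
  have "\<exists>h\<in>H. p * real (card U) \<le> real (card {X\<in>U. hit h X})"
  proof (rule ccontr)
    assume no: "\<not> ?thesis"
    have "(\<Sum>h\<in>H. real (card {X\<in>U. hit h X})) < (\<Sum>h\<in>H. p * real (card U))"
      using no assms(1,2) by (intro sum_strict_mono) (auto simp: not_le)
    moreover have "(\<Sum>h\<in>H. card {X\<in>U. hit h X}) = (\<Sum>X\<in>U. card {h\<in>H. hit h X})"
      using sum_multicount_gen[of H U hit "\<lambda>X. card {h\<in>H. hit h X}"] assms(1) Ufin by simp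
    then have "(\<Sum>h\<in>H. real (card {X\<in>U. hit h X})) = (\<Sum>X\<in>U. real (card {h\<in>H. hit h X}))"
      by (metis (mono_tags, lifting) of_nat_sum sum.cong)
    moreover have "(\<Sum>X\<in>U. p * real (card H)) \<le> (\<Sum>X\<in>U. real (card {h\<in>H. hit h X}))"
      using hit Ufin(2) by (intro sum_mono) auto
    ultimately show False by (simp add: mult_ac)
  qed
  then obtain h where h: "h \<in> H" "p * real (card U) \<le> real (card {X\<in>U. hit h X})" by blast
  have "{X\<in>XX. \<forall>h'\<in>insert h F. \<not> hit h' X} = U - {X\<in>U. hit h X}" by (auto simp: U_def)
  then have "real (card {X\<in>XX. \<forall>h'\<in>insert h F. \<not> hit h' X}) = real (card U) - real (card {X\<in>U. hit h X})"
    using Ufin(1) by (simp add: card_Diff_subset card_mono of_nat_diff)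
  also have "\<dots> \<le> (1 - p) * real (card U)" using h(2) by (simp add: algebra_simps)
  also have "\<dots> \<le> (1 - p) * ((1 - p) ^ N * real (card XX))"
    using F(3) assms(5) by (intro mult_left_mono) (auto simp: U_def)
  finally have "real (card {X\<in>XX. \<forall>h'\<in>insert h F. \<not> hit h' X}) \<le> (1 - p) ^ Suc N * real (card XX)" by simp
  moreover have "card (insert h F) \<le> Suc N" using F(2) finite_subset[OF F(1) assms(1)] by (simp add: card_insert_if)
  ultimately show ?case using F(1) h(1) by (intro exI[of _ "insert h F"]) auto
qed

definition perfect_hash_family :: "nat \<Rightarrow> nat \<Rightarrow> (nat \<Rightarrow> nat) set \<Rightarrow> bool" where
  "perfect_hash_family m s F \<longleftrightarrow> F \<subseteq> ({..<m} \<rightarrow>\<^sub>E {..<s}) \<and>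
     (\<forall>X\<subseteq>{..<m}. card X \<le> s \<longrightarrow> (\<exists>h\<in>F. inj_on h X))"

lemma power_div_fact_le_exp: "real s ^ s / fact s \<le> exp (real s)"
proof -
  have "(\<Sum>n\<in>{s}. inverse (fact n) * real s ^ n) \<le> (\<Sum>n. inverse (fact n) * real s ^ n)"
    by (intro sum_le_suminf summable_exp) auto
  then show ?thesis by (simp add: exp_def divide_inverse mult.commute)
qed

text \<open>A uniformly random map to \<open>s\<close> values is injective on a given s-set with
  probability p = s!/s^s \<ge> e^(-s). There are at most m^s such sets, and \<open>N\<close> just
  above s ln m / p rounds leave at most m^s e^(-pN) < 1 of them, that is, none.\<close>

lemma perfect_hash_family_exists:
  assumes "1 \<le> s" "s \<le> m"
  shows "\<exists>F. perfect_hash_family m s F \<and> real (card F) \<le> exp (real s) * (real s * ln (real m)) + 1"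
proof -
  define p where "p = fact s / real s ^ s"
  define H where "H = ({..<m} \<rightarrow>\<^sub>E {..<s})"
  define XX where "XX = {X. X \<subseteq> {..<m} \<and> card X = s}"
  define N where "N = nat \<lfloor>real s * ln (real m) / p\<rfloor> + 1"
  have p: "0 < p" "p \<le> 1" using assms fact_le_power[of s, where 'a = real] by (auto simp: p_def)
  have Hfin: "finite H" by (auto simp: H_def intro: finite_PiE)
  have H: "card H = s ^ m" by (simp add: H_def card_funcsetE)
  then have Hne: "H \<noteq> {}" using assms by auto
  have XXfin: "finite XX" by (simp add: XX_def)
  have "\<exists>F\<subseteq>H. card F \<le> N \<and> real (card {X\<in>XX. \<forall>h\<in>F. \<not> inj_on h X}) \<le> (1 - p) ^ N * real (card XX)"
  proof (rule greedy_hitting_family[OF Hfin Hne XXfin])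
    fix X assume "X \<in> XX"
    then have X: "X \<subseteq> {..<m}" "card X = s" by (auto simp: XX_def)
    have "card {h\<in>H. inj_on h X} = s ^ (m - s) * fact s"
      using card_inj_on_subset_funcset[of "{..<m}" "{..<s}" X] X by (simp add: H_def fact_prod_rev)
    moreover have "s ^ m = s ^ (m - s) * s ^ s" using assms(2) by (simp add: power_add[symmetric])
    ultimately show "p * real (card H) \<le> real (card {h\<in>H. inj_on h X})"
      using assms(1) by (simp add: p_def H)
  qed (use p in auto)
  then obtain F where F: "F \<subseteq> H" "card F \<le> N"
    "real (card {X\<in>XX. \<forall>h\<in>F. \<not> inj_on h X}) \<le> (1 - p) ^ N * real (card XX)" by blast
  have "real (card XX) \<le> real m ^ s"
  proof -
    have "card XX \<le> m ^ s" unfolding XX_def using n_subsets[of "{..<m}" s] binomial_le_pow[OF assms(2)] by simp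
    then show ?thesis by (metis of_nat_le_iff of_nat_power)
  qed
  then have "(1 - p) ^ N * real (card XX) \<le> exp (- p) ^ N * real m ^ s"
    using p exp_ge_add_one_self[of "-p"] by (intro mult_mono power_mono) auto
  also have "\<dots> = exp (real s * ln (real m) - p * real N)"
  proof -
    have "real m ^ s = exp (real s * ln (real m))" using assms by (simp add: exp_of_nat_mult)
    moreover have "exp (- p) ^ N = exp (- (p * real N))" by (simp add: exp_of_nat2_mult[symmetric])
    ultimately show ?thesis by (simp add: exp_diff exp_minus divide_inverse mult.commute)
  qed
  also have "\<dots> < 1"
  proof -
    have "0 \<le> ln (real m)" using assms by simp
    then have "real s * ln (real m) / p < real N" unfolding N_def using p by (simp add: zero_le_divide_iff) linarith
    then show ?thesis using p by (simp add: divide_less_eq mult.commute)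
  qed
  finally have "card {X\<in>XX. \<forall>h\<in>F. \<not> inj_on h X} = 0" using F(3) by linarith
  then have all: "\<exists>h\<in>F. inj_on h X" if "X \<in> XX" for X using that XXfin by auto
  have "perfect_hash_family m s F"
    unfolding perfect_hash_family_def
  proof (intro conjI allI impI)
    show "F \<subseteq> ({..<m} \<rightarrow>\<^sub>E {..<s})" using F(1) by (simp add: H_def)
    fix X assume X: "X \<subseteq> {..<m}" "card X \<le> s"
    obtain X' where "X \<subseteq> X'" "X' \<subseteq> {..<m}" "card X' = s"
      using exists_subset_between[OF X(2) _ X(1)] assms(2) by auto
    then show "\<exists>h\<in>F. inj_on h X" using all[of X'] by (auto simp: XX_def intro: inj_on_subset)
  qed
  moreover have "real (card F) \<le> exp (real s) * (real s * ln (real m)) + 1"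
  proof -
    have l: "0 \<le> real s * ln (real m)" using assms by simp
    have "real (card F) \<le> real N" using F(2) by simp
    also have "\<dots> \<le> real s * ln (real m) / p + 1" unfolding N_def using p l by (simp add: zero_le_divide_iff)
    also have "real s * ln (real m) / p = (real s ^ s / fact s) * (real s * ln (real m))" by (simp add: p_def)
    also have "\<dots> \<le> exp (real s) * (real s * ln (real m))" using l by (intro mult_right_mono power_div_fact_le_exp)
    finally show ?thesis by simp
  qed
  ultimately show ?thesis by blast
qed

section \<open>The bank of bundle assignments and its approximation ratio\<close>

definition owner_allocation :: "nat \<Rightarrow> nat \<Rightarrow> (nat \<Rightarrow> nat) \<Rightarrow> allocation" where
  "owner_allocation n m ow = (\<lambda>i\<in>{..<n}. {j. j < m \<and> ow j = i})"

text \<open>Bundle \<open>b\<close> of the partition given by \<open>h\<close> goes to bidder \<open>\<phi> b\<close>, where \<open>\<phi> b = n\<close> means that it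
  is not allocated.\<close>
definition hash_bank :: "nat \<Rightarrow> nat \<Rightarrow> nat \<Rightarrow> (nat \<Rightarrow> nat) set \<Rightarrow> allocation set" where
  "hash_bank n m s F = {owner_allocation n m (\<lambda>j. \<phi> (h j)) |h \<phi>. h \<in> F \<and> (\<forall>b<s. \<phi> b \<le> n)}"

text \<open>The unions of bundles of one partition are the only possible shares in the bank. Their
  number is exponential in \<open>s\<close> only, not in \<open>m\<close>.\<close>

definition hash_queries :: "nat \<Rightarrow> nat \<Rightarrow> (nat \<Rightarrow> nat) set \<Rightarrow> nat set set" where
  "hash_queries m s F = (\<lambda>(h, T). {j. j < m \<and> h j \<in> T}) ` (F \<times> Pow {..<s})"

lemma owner_allocation_in: "owner_allocation n m ow \<in> allocations n m"
  unfolding owner_allocation_def allocations_def disjoint_family_on_def by auto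

lemma perfect_hash_family_nonempty: "perfect_hash_family m s F \<Longrightarrow> F \<noteq> {}"
  unfolding perfect_hash_family_def by force

lemma perfect_hash_family_finite: "perfect_hash_family m s F \<Longrightarrow> finite F"
  unfolding perfect_hash_family_def using finite_subset finite_PiE[of "{..<m}" "\<lambda>_. {..<s}"] by blast

lemma hash_bank_is_bank:
  assumes "perfect_hash_family m s F"
  shows "allocation_bank n m (hash_bank n m s F)"
proof -
  obtain h where "h \<in> F" using perfect_hash_family_nonempty[OF assms] by blast
  then have "owner_allocation n m (\<lambda>j. (\<lambda>_. n) (h j)) \<in> hash_bank n m s F"
    unfolding hash_bank_def mem_Collect_eq by (intro exI[of _ h] exI[of _ "\<lambda>_. n"]) simp
  then show ?thesis unfolding allocation_bank_def by (auto simp: hash_bank_def owner_allocation_in)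
qed

lemma hash_queries_card:
  assumes "perfect_hash_family m s F"
  shows "card (hash_queries m s F) \<le> card F * 2 ^ s" "finite (hash_queries m s F)" "hash_queries m s F \<subseteq> Pow {..<m}"
proof -
  have "card (hash_queries m s F) \<le> card (F \<times> Pow {..<s})"
    unfolding hash_queries_def using perfect_hash_family_finite[OF assms] by (intro card_image_le) auto
  then show "card (hash_queries m s F) \<le> card F * 2 ^ s" by (simp add: card_cartesian_product card_Pow)
qed (auto simp: hash_queries_def perfect_hash_family_finite[OF assms])

lemma hash_bank_query:
  assumes "perfect_hash_family m s F" "A \<in> hash_bank n m s F" "i < n"
  shows "A i \<in> hash_queries m s F"
proof -
  obtain h \<phi> where h: "h \<in> F" "A = owner_allocation n m (\<lambda>j. \<phi> (h j))" using assms(2) by (auto simp: hash_bank_def)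
  have "h j < s" if "j < m" for j using h(1) assms(1) that by (auto simp: perfect_hash_family_def PiE_iff)
  then have "A i = {j. j < m \<and> h j \<in> {b. b < s \<and> \<phi> b = i}}"
    using assms(3) by (auto simp: h owner_allocation_def)
  then have "A i = (case (h, {b. b < s \<and> \<phi> b = i}) of (h, T) \<Rightarrow> {j. j < m \<and> h j \<in> T})" by simp
  moreover have "(h, {b. b < s \<and> \<phi> b = i}) \<in> F \<times> Pow {..<s}" using h(1) by auto
  ultimately show ?thesis unfolding hash_queries_def by (rule image_eqI)
qed

text \<open>As long as more than \<open>s\<close> items are allocated to the bidders in \<open>I\<close>, split off an inclusion
  minimal set of bidders receiving more than \<open>s\<close> items: it consists of one bidder and of a set of bidders with
  at most \<open>s\<close> items.\<close>
lemma grouping_bound: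
  fixes w :: "nat \<Rightarrow> real" and a :: "nat \<Rightarrow> nat"
  assumes "finite I" "0 < s" "\<And>J. J \<subseteq> I \<Longrightarrow> sum a J \<le> s \<Longrightarrow> sum w J \<le> M" "\<And>i. i \<in> I \<Longrightarrow> w i \<le> M" "0 \<le> M"
  shows "sum w I \<le> (2 * real (sum a I) / real s + 1) * M"
  using assms
proof (induction "card I" arbitrary: I rule: less_induct)
  case less
  show ?case
  proof (cases "sum a I \<le> s")
    case True
    have "sum w I \<le> 1 * M" using less.prems(3)[of I] True by simp
    also have "\<dots> \<le> (2 * real (sum a I) / real s + 1) * M" using less.prems(5) by (intro mult_right_mono) (simp_all add: sum_nonneg)
    finally show ?thesis .
  next
    case False
    obtain J where J: "J \<subseteq> I" "s < sum a J" "\<And>J'. J' \<subset> J \<Longrightarrow> \<not> s < sum a J'"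
    proof -
      obtain J where J: "J \<subseteq> I \<and> s < sum a J" "\<And>J'. J' \<subseteq> I \<and> s < sum a J' \<Longrightarrow> card J \<le> card J'"
        using ex_has_least_nat[of "\<lambda>J. J \<subseteq> I \<and> s < sum a J" I card] False by auto
      have "\<not> s < sum a J'" if "J' \<subset> J" for J'
        using psubset_card_mono[OF _ that] J(2)[of J'] J(1) that less.prems(1) finite_subset by fastforce
      then show ?thesis using J(1) that by blast
    qed
    have finJ: "finite J" using J(1) less.prems(1) finite_subset by blast
    have "J \<noteq> {}" using J(2) by auto
    then obtain i where i: "i \<in> J" by blast
    have "sum w (J - {i}) \<le> M" 
    proof (rule less.prems(3))
      show "J - {i} \<subseteq> I" using J(1) by blast
      show "sum a (J - {i}) \<le> s" using J(3)[of "J - {i}"] i by (metis Diff_subset insert_Diff_single insert_absorb not_less psubsetI singletonI Diff_iff)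
    qed
    moreover have "w i \<le> M" using J(1) i by (intro less.prems(4)) auto
    moreover have "sum w J = w i + sum w (J - {i})" using finJ i by (rule sum.remove)
    ultimately have wJ: "sum w J \<le> 2 * M" by linarith
    have "sum w (I - J) \<le> (2 * real (sum a (I - J)) / real s + 1) * M"
    proof (rule less.hyps)
      show "card (I - J) < card I" using J(1) less.prems(1) i by (intro psubset_card_mono) blast+
      show "finite (I - J)" "0 < s" "0 \<le> M" using less.prems by simp_all
      show "sum w J' \<le> M" if "J' \<subseteq> I - J" "sum a J' \<le> s" for J' using less.prems(3)[of J'] that by blast
      show "w i \<le> M" if "i \<in> I - J" for i using less.prems(4)[of i] that by blast
    qed
    moreover have wI: "sum w I = sum w (I - J) + sum w J"
      using J(1) less.prems(1) by (rule sum.subset_diff)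
    moreover have "2 * real (sum a I) / real s + 1 = (2 * real (sum a (I - J)) / real s + 1) + 2 * real (sum a J) / real s"
      unfolding sum.subset_diff[OF J(1) less.prems(1)] by (simp add: add_divide_distrib del: of_nat_sum)
    then have "(2 * real (sum a I) / real s + 1) * M =
        (2 * real (sum a (I - J)) / real s + 1) * M + (2 * real (sum a J) / real s) * M"
      by (simp only: distrib_right)
    moreover have "2 * M \<le> (2 * real (sum a J) / real s) * M"
    proof -
      have "2 \<le> 2 * real (sum a J) / real s" using J(2) less.prems(2) by (simp add: le_divide_eq del: of_nat_sum)
      then show ?thesis using less.prems(5) by (intro mult_right_mono) auto
    qed
    ultimately show ?thesis using wJ by linarith
  qed
qed

text \<open>A group receiving at most \<open>s\<close> items is satisfied by a hash function
  injective on these items, as each bundle then contains at most one of them; a single bidder may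
  simply get all bundles. The factor 2 * m / s + 1 from the grouping is at most 3 * m / s because s
  \<le> m.\<close>

lemma hash_bank_approx:
  assumes F: "perfect_hash_family m s F" and s: "1 \<le> s" "s \<le> m" and n: "1 \<le> n" and \<alpha>: "3 * real m / real s \<le> \<alpha>"
  shows "mir_approx n m (monotone_valuations m) (hash_bank n m s F) \<alpha>"
  unfolding mir_approx_def
proof (intro conjI allI impI)
  have "0 < 3 * real m / real s" using s by simp
  then show \<alpha>0: "0 < \<alpha>" using \<alpha> by linarith
  fix v assume v: "\<forall>i<n. v i \<in> monotone_valuations m"
  let ?M = "MIR n (hash_bank n m s F) v"
  have nonneg: "0 \<le> v i S" if "i < n" "S \<subseteq> {..<m}" for i S using v that by (auto simp: monotone_valuations_def)
  have mono: "v i S \<le> v i T" if "i < n" "S \<subseteq> T" "T \<subseteq> {..<m}" for i S T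
    using v that by (auto simp: monotone_valuations_def)
  have part: "(\<Sum>i\<in>J. v i (A i)) \<le> ?M"
    if A: "A \<in> allocations n m" and J: "J \<subseteq> {..<n}" and h: "h \<in> F" and \<phi>: "\<And>b. b < s \<Longrightarrow> \<phi> b \<le> n"
      and own: "\<And>i j. i \<in> J \<Longrightarrow> j \<in> A i \<Longrightarrow> \<phi> (h j) = i" for A J h \<phi>
  proof -
    let ?B = "owner_allocation n m (\<lambda>j. \<phi> (h j))"
    have "(\<Sum>i\<in>J. v i (A i)) \<le> (\<Sum>i\<in>J. v i (?B i))"
    proof (intro sum_mono mono)
      fix i assume i: "i \<in> J"
      then show "i < n" using J by auto
      then show "A i \<subseteq> ?B i" using own[OF i] allocation_subset[OF A] by (auto simp: owner_allocation_def)
      show "?B i \<subseteq> {..<m}" using \<open>i < n\<close> by (auto simp: owner_allocation_def)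
    qed
    also have "\<dots> \<le> welfare n v ?B"
      unfolding welfare_def
    proof (intro sum_mono2 J nonneg)
      show "?B i \<subseteq> {..<m}" if "i \<in> {..<n} - J" for i using allocation_subset[OF owner_allocation_in] that by blast
    qed auto
    also have "\<dots> \<le> ?M"
      using h \<phi> by (intro welfare_le_MIR[OF hash_bank_is_bank[OF F]]) (auto simp: hash_bank_def)
    finally show ?thesis .
  qed
  have M0: "0 \<le> ?M"
  proof -
    obtain h where "h \<in> F" using perfect_hash_family_nonempty[OF F] by blast
    then show ?thesis using part[of "\<lambda>i\<in>{..<n}. {}" "{}" h "\<lambda>_. n"] by (auto simp: allocations_def disjoint_family_on_def)
  qed
  have "welfare n v A \<le> \<alpha> * ?M" if A: "A \<in> allocations n m" for A
  proof -
    define a where "a i = card (A i)" for i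
    have finA: "finite (A i)" if "i < n" for i using allocation_subset[OF A that] finite_subset by blast
    have card_UN: "card (\<Union>i\<in>J. A i) = sum a J" if "J \<subseteq> {..<n}" for J
      unfolding a_def using that finA allocations_disjoint[OF A] finite_subset
      by (intro card_UN_disjoint) (auto, blast+)
    have "(\<Sum>i<n. v i (A i)) \<le> (2 * real (sum a {..<n}) / real s + 1) * ?M"
    proof (rule grouping_bound)
      show "finite {..<n}" "0 < s" "0 \<le> ?M" using s M0 by auto
    next
      fix J assume J: "J \<subseteq> {..<n}" "sum a J \<le> s"
      then have "card (\<Union>i\<in>J. A i) \<le> s" "(\<Union>i\<in>J. A i) \<subseteq> {..<m}" using card_UN allocation_subset[OF A] by auto
      then obtain h where h: "h \<in> F" "inj_on h (\<Union>i\<in>J. A i)" using F by (auto simp: perfect_hash_family_def)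
      \<comment> \<open>Injectivity of \<open>h\<close> on the items of the group leaves only one
        candidate for the owner of a bundle. Bundles without such an item stay unallocated.\<close>
      define \<phi> where "\<phi> b = (if \<exists>i\<in>J. \<exists>j\<in>A i. h j = b then SOME i. i \<in> J \<and> (\<exists>j\<in>A i. h j = b) else n)" for b
      have \<phi>_in: "\<phi> b \<in> J \<and> (\<exists>j\<in>A (\<phi> b). h j = b)" if "\<exists>i\<in>J. \<exists>j\<in>A i. h j = b" for b
      proof -
        have "\<exists>i. i \<in> J \<and> (\<exists>j\<in>A i. h j = b)" using that by blast
        from someI_ex[OF this] show ?thesis using that by (simp add: \<phi>_def)
      qed
      show "(\<Sum>i\<in>J. v i (A i)) \<le> ?M"
      proof (rule part[OF A J(1) h(1), where \<phi> = \<phi>])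
        show "\<phi> b \<le> n" for b using \<phi>_in[of b] J(1) by (cases "\<exists>i\<in>J. \<exists>j\<in>A i. h j = b") (force, auto simp: \<phi>_def)
        fix i j assume ij: "i \<in> J" "j \<in> A i"
        then have "\<phi> (h j) \<in> J" and "\<exists>j'\<in>A (\<phi> (h j)). h j' = h j" using \<phi>_in[of "h j"] by blast+
        then obtain j' where j': "j' \<in> A (\<phi> (h j))" "h j' = h j" by blast
        have "j' = j" using h(2) j' ij \<open>\<phi> (h j) \<in> J\<close> by (auto dest: inj_onD)
        then have "A (\<phi> (h j)) \<inter> A i \<noteq> {}" using j' ij by auto
        then show "\<phi> (h j) = i" using allocations_disjoint[OF A] J(1) ij(1) \<open>\<phi> (h j) \<in> J\<close> by blast
      qed
    next
      fix i assume "i \<in> {..<n}"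
      moreover obtain h where "h \<in> F" using perfect_hash_family_nonempty[OF F] by blast
      ultimately show "v i (A i) \<le> ?M" using part[OF A, of "{i}" h "\<lambda>_. i"] by simp
    qed
    moreover have "sum a {..<n} \<le> m"
    proof -
      have "(\<Union>i<n. A i) \<subseteq> {..<m}" using allocation_subset[OF A] by auto
      then have "card (\<Union>i<n. A i) \<le> m" using card_mono[of "{..<m}"] by fastforce
      then show ?thesis using card_UN[of "{..<n}"] by simp
    qed
    then have "(2 * real (sum a {..<n}) / real s + 1) * ?M \<le> \<alpha> * ?M"
    proof (intro mult_right_mono M0)
      assume "sum a {..<n} \<le> m"
      then have "2 * real (sum a {..<n}) / real s \<le> 2 * real m / real s"
        by (intro divide_right_mono mult_left_mono of_nat_mono) auto
      moreover have "1 \<le> real m / real s" using s by simp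
      moreover have "3 * real m / real s = 2 * real m / real s + real m / real s" by (simp add: field_simps)
      ultimately show "2 * real (sum a {..<n}) / real s + 1 \<le> \<alpha>" using \<alpha> by linarith
    qed
    ultimately show ?thesis unfolding welfare_def by linarith
  qed
  moreover have "allocations n m \<noteq> {}" using owner_allocation_in by blast
  ultimately have "OPT n m v \<le> \<alpha> * ?M" unfolding OPT_def by (subst Max_le_iff) auto
  then show "OPT n m v / \<alpha> \<le> ?M" using \<alpha>0 by (simp add: pos_divide_le_eq mult.commute)
qed

section \<open>Implementation by fixed queries and by announcement of values\<close>

primrec ask :: "(nat \<times> (valuation \<Rightarrow> bool)) list \<Rightarrow> (bool list \<Rightarrow> 'o) \<Rightarrow> 'o protocol" where
  "ask [] g = Done (g [])"
| "ask (q # qs) g = Speak (fst q) (snd q) (ask qs (\<lambda>bs. g (False # bs))) (ask qs (\<lambda>bs. g (True # bs)))"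

lemma ask_outcome: "protocol_outcome (ask qs g) v = g (map (\<lambda>q. snd q (v (fst q))) qs)"
  by (induction qs arbitrary: g) auto

lemma ask_cost: "protocol_cost (ask qs g) v = length qs"
  by (induction qs arbitrary: g) auto

lemma ask_speakers: "speakers (ask qs g) = fst ` set qs"
  by (induction qs arbitrary: g) auto

text \<open>Both the welfare maximization and the VCG payments inspect valuations only at shares
  occurring in the bank. Hence the values of these shares determine the correct outcomes, which is
  what the query and the communication bound rest on.\<close>

lemma mir_outcome_cong:
  assumes "\<And>A i. A \<in> \<A> \<Longrightarrow> i < n \<Longrightarrow> v i (A i) = w i (A i)"
  shows "mir_outcome n \<A> v x \<longleftrightarrow> mir_outcome n \<A> w x"
proof -
  have W: "welfare n v A = welfare n w A" if "A \<in> \<A>" for A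
    using assms[OF that] by (simp add: welfare_def)
  have W': "welfare_others n v i A = welfare_others n w i A" if "A \<in> \<A>" for i A
    using assms[OF that] by (simp add: welfare_others_def)
  have "MIR n \<A> v = MIR n \<A> w" using W by (simp add: MIR_def cong: image_cong)
  moreover have "vcg_payment n \<A> v A i = vcg_payment n \<A> w A i" if "A \<in> \<A>" for i A
    using W' that by (simp add: vcg_payment_def cong: image_cong)
  ultimately show ?thesis using W by (auto simp: mir_outcome_def)
qed

lemma mir_outcome_exists:
  assumes "allocation_bank n m \<A>"
  shows "\<exists>x. mir_outcome n \<A> v x"
proof -
  obtain A where "A \<in> \<A>" "welfare n v A = MIR n \<A> v" using MIR_attained[OF assms] by blast
  then show ?thesis by (intro exI[of _ "(A, vcg_payment n \<A> v A)"]) (simp add: mir_outcome_def)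
qed

lemma mir_value_queries_hash_bank:
  assumes bank: "allocation_bank n m \<A>" and QS: "QS \<subseteq> Pow {..<m}"
    and query: "\<And>A i. A \<in> \<A> \<Longrightarrow> i < n \<Longrightarrow> A i \<in> QS" and q: "real n * real (card QS) \<le> q"
  shows "mir_value_queries n m V \<A> q"
  unfolding mir_value_queries_def
proof (intro exI conjI allI impI)
  show "QS \<subseteq> Pow {..<m}" by (rule QS)
  show "real (\<Sum>i<n. card QS) \<le> q" using q by simp
  fix v :: "nat \<Rightarrow> valuation"
  let ?a = "\<lambda>i\<in>{..<n}. restrict (v i) QS"
  \<comment> \<open>The table of answers is itself treated as a profile; it agrees with the true one
    on all shares of the bank.\<close>
  have "mir_outcome n \<A> ?a (SOME x. mir_outcome n \<A> ?a x)" using mir_outcome_exists[OF bank] by (rule someI_ex)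
  then show "mir_outcome n \<A> v ((\<lambda>a. SOME x. mir_outcome n \<A> a x) ?a)"
    using mir_outcome_cong[of \<A> n ?a v] query by simp
qed

text \<open>Each value is announced by its \<open>L\<close> binary digits. The transcript need not
  determine the profile, but any valid profile with the same transcript agrees with it on
  \<open>QS\<close> and therefore has the same correct outcomes.\<close>

lemma mir_communication_by_announcement:
  assumes bank: "allocation_bank n m \<A>" and QS: "finite QS" "QS \<subseteq> Pow {..<m}"
    and query: "\<And>A i. A \<in> \<A> \<Longrightarrow> i < n \<Longrightarrow> A i \<in> QS"
    and B: "B \<le> 2 ^ L" and b: "real n * real (card QS) * real L \<le> b"
  shows "mir_communication n (bounded_valuations m B) \<A> b"
proof -
  obtain Sl where Sl: "set Sl = QS" "distinct Sl" using finite_distinct_list[OF QS(1)] by blast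
  define qs where "qs = map (\<lambda>(i, S, l). (i, \<lambda>v :: valuation. bit (nat \<lfloor>v S\<rfloor>) l)) (List.product [0..<n] (List.product Sl [0..<L]))"
  define ans where "ans v = map (\<lambda>q. snd q (v (fst q))) qs" for v :: "nat \<Rightarrow> valuation"
  define valid where "valid v \<longleftrightarrow> (\<forall>i<n. v i \<in> bounded_valuations m B)" for v
  define g where "g bs = (SOME x. mir_outcome n \<A> (SOME v. valid v \<and> ans v = bs) x)" for bs
  have len: "length qs = n * (card QS * L)" using Sl distinct_card by (fastforce simp: qs_def)
  have agree: "v i S = w i S" if vw: "valid v" "valid w" "ans v = ans w" and i: "i < n" and S: "S \<in> QS" for v w i S
  proof -
    have bits: "bit (nat \<lfloor>v i S\<rfloor>) l = bit (nat \<lfloor>w i S\<rfloor>) l" if l: "l < L" for l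
    proof -
      have "(i, S, l) \<in> set (List.product [0..<n] (List.product Sl [0..<L]))" using i S l Sl by simp
      moreover have "map (\<lambda>(i, S, l). bit (nat \<lfloor>v i S\<rfloor>) l) (List.product [0..<n] (List.product Sl [0..<L])) =
          map (\<lambda>(i, S, l). bit (nat \<lfloor>w i S\<rfloor>) l) (List.product [0..<n] (List.product Sl [0..<L]))"
        using vw(3) by (simp add: ans_def qs_def comp_def case_prod_beta)
      ultimately show ?thesis by (metis (no_types, lifting) map_eq_conv case_prod_conv)
    qed
    have nat: "u i S = real (nat \<lfloor>u i S\<rfloor>)" "nat \<lfloor>u i S\<rfloor> < 2 ^ L" if u: "valid u" for u
    proof -
      have "u i S \<in> \<nat>" "u i S < B" using u i S QS(2) by (auto simp: valid_def bounded_valuations_def)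
      then obtain x where x: "u i S = real x" "real x < B" by (auto elim: Nats_cases)
      then have "real x < 2 ^ L" using B by linarith
      then have "x < 2 ^ L" using of_nat_less_iff[of x "2 ^ L", where 'a = real] by simp
      then show "u i S = real (nat \<lfloor>u i S\<rfloor>)" "nat \<lfloor>u i S\<rfloor> < 2 ^ L" using x by simp_all
    qed
    have "nat \<lfloor>v i S\<rfloor> = nat \<lfloor>w i S\<rfloor>"
    proof (rule bit_eqI)
      fix l
      have "bit x l \<longleftrightarrow> l < L \<and> bit x l" if "x < 2 ^ L" for x :: nat
        using that by (metis bit_take_bit_iff take_bit_nat_eq_self)
      then show "bit (nat \<lfloor>v i S\<rfloor>) l \<longleftrightarrow> bit (nat \<lfloor>w i S\<rfloor>) l" using bits nat(2) vw(1,2) by metis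
    qed
    then show ?thesis using nat(1) vw(1,2) by metis
  qed
  have "mir_outcome n \<A> v (g (ans v))" if v: "valid v" for v
  proof -
    define w where "w = (SOME w. valid w \<and> ans w = ans v)"
    have w: "valid w \<and> ans w = ans v" unfolding w_def by (rule someI[of _ v]) (simp add: v)
    have "mir_outcome n \<A> w (g (ans v))" unfolding g_def w_def[symmetric] using mir_outcome_exists[OF bank] by (rule someI_ex)
    then show ?thesis using mir_outcome_cong[of \<A> n w v] agree[of w v] w v query by blast
  qed
  moreover have "real (length qs) \<le> b" using b by (simp add: len mult.assoc)
  moreover have "fst ` set qs \<subseteq> {..<n}" by (auto simp: qs_def)
  ultimately show ?thesis unfolding mir_communication_def
    by (intro exI[of _ "ask qs g"]) (simp add: ask_outcome ask_cost ask_speakers ans_def valid_def)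
qed

section \<open>Choosing the number of bundles within the budget\<close>

definition hash_family_bound :: "nat \<Rightarrow> nat \<Rightarrow> real" where
  "hash_family_bound m s = exp (real s) * (real s * ln (real m)) + 1"

lemma hash_family_bound_le:
  fixes \<kappa> \<delta> :: real
  assumes "0 < \<kappa>" "0 < \<delta>"
  obtains \<epsilon> k0 where "0 < \<epsilon>" "\<epsilon> \<le> 1"
    "\<And>m s k. k0 \<le> k \<Longrightarrow> 1 \<le> m \<Longrightarrow> log 2 (real m) \<le> \<kappa> * k \<Longrightarrow> real s \<le> \<epsilon> * k \<Longrightarrow>
       hash_family_bound m s * 2 ^ s \<le> 2 powr (\<delta> * k)"
proof -
  \<comment> \<open>By e < 4, the exponential factors are at most 4^s 2^s = 2^(3s). As s \<le>
    \<epsilon> k, this takes at most half of the exponent \<delta> k; the other half absorbs the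
    polynomial factor \<kappa> k^2 + 1.\<close>
  define \<epsilon> where "\<epsilon> = min 1 (\<delta> / 6)"
  have \<epsilon>: "0 < \<epsilon>" "\<epsilon> \<le> 1" "6 * \<epsilon> \<le> \<delta>" using assms by (auto simp: \<epsilon>_def min_def)
  have "eventually (\<lambda>k::real. \<kappa> * k ^ 2 + 1 \<le> 2 powr (\<delta> / 2 * k)) at_top" using assms by real_asymp
  then obtain k0 where k0: "\<And>k. k0 \<le> k \<Longrightarrow> \<kappa> * k ^ 2 + 1 \<le> 2 powr (\<delta> / 2 * k)"
    by (auto simp: eventually_at_top_linorder)
  show ?thesis
  proof (rule that[of \<epsilon> "max 1 k0"])
    fix m s k assume k: "max 1 k0 \<le> k" and m: "1 \<le> m" "log 2 (real m) \<le> \<kappa> * k" and s: "real s \<le> \<epsilon> * k"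
    have k1: "1 \<le> k" using k by simp
    have sk: "real s \<le> k" using s \<epsilon>(2) k1 by (smt (verit) mult_left_le_one_le \<epsilon>(1))
    have "ln (real m) = log 2 (real m) * ln 2" by (simp add: log_def)
    also have "\<dots> \<le> log 2 (real m) * 1" using m ln_le_minus_one[of "2::real"] by (intro mult_left_mono) auto
    finally have ln: "ln (real m) \<le> \<kappa> * k" using m by simp
    have "real s * ln (real m) \<le> k * (\<kappa> * k)" using sk ln m by (intro mult_mono) auto
    then have a: "real s * ln (real m) \<le> \<kappa> * k ^ 2" by (simp add: power2_eq_square mult_ac)
    have l0: "0 \<le> real s * ln (real m)" using m by simp
    have "exp (real s) = exp 1 ^ s" by (simp add: exp_of_nat_mult[symmetric])
    also have "\<dots> \<le> 4 ^ s" using exp_le by (intro power_mono) auto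
    finally have e: "exp (real s) \<le> 4 ^ s" .
    have "hash_family_bound m s \<le> 4 ^ s * (\<kappa> * k ^ 2) + 1"
      unfolding hash_family_bound_def using mult_mono[OF e a _ l0] by simp
    also have "\<dots> \<le> 4 ^ s * (\<kappa> * k ^ 2 + 1)" by (simp add: distrib_left)
    finally have "hash_family_bound m s * 2 ^ s \<le> 4 ^ s * (\<kappa> * k ^ 2 + 1) * 2 ^ s" by simp
    also have "\<dots> = 2 powr (3 * real s) * (\<kappa> * k ^ 2 + 1)"
    proof -
      have "(4::real) ^ s * 2 ^ s = (2 ^ 3) ^ s" by (simp add: power_mult_distrib[symmetric])
      also have "\<dots> = 2 ^ (3 * s)" by (simp only: power_mult)
      also have "\<dots> = 2 powr real (3 * s)" by (rule powr_realpow[symmetric]) simp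
      finally show ?thesis by (simp add: mult_ac)
    qed
    also have "\<dots> \<le> 2 powr (\<delta> / 2 * k) * 2 powr (\<delta> / 2 * k)"
    proof (intro mult_mono)
      have "6 * (\<epsilon> * k) \<le> \<delta> * k" using \<epsilon>(3) k1 by (simp add: mult_right_mono mult.assoc[symmetric])
      then show "2 powr (3 * real s) \<le> 2 powr (\<delta> / 2 * k)" using s by simp
      show "\<kappa> * k\<^sup>2 + 1 \<le> 2 powr (\<delta> / 2 * k)" using k0 k by simp
      show "0 \<le> \<kappa> * k\<^sup>2 + 1" using assms by simp
    qed simp
    also have "\<dots> = 2 powr (\<delta> * k)" by (simp add: powr_add[symmetric])
    finally show "hash_family_bound m s * 2 ^ s \<le> 2 powr (\<delta> * k)" .
  qed (use \<epsilon> in auto)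
qed

definition hash_family :: "nat \<Rightarrow> nat \<Rightarrow> (nat \<Rightarrow> nat) set" where
  "hash_family m s = (SOME F. perfect_hash_family m s F \<and> real (card F) \<le> hash_family_bound m s)"

lemma hash_family:
  assumes "1 \<le> s" "s \<le> m"
  shows "perfect_hash_family m s (hash_family m s)" "real (card (hash_family m s)) \<le> hash_family_bound m s"
  using someI_ex[OF perfect_hash_family_exists[OF assms, folded hash_family_bound_def]] unfolding hash_family_def by auto

definition bundle_bank :: "nat \<Rightarrow> nat \<Rightarrow> real \<Rightarrow> allocation set" where
  "bundle_bank n m t = hash_bank n m (nat \<lfloor>t\<rfloor>) (hash_family m (nat \<lfloor>t\<rfloor>))"

definition suitable_bundles :: "real \<Rightarrow> real \<Rightarrow> real \<Rightarrow> nat \<Rightarrow> nat \<Rightarrow> real \<Rightarrow> bool" where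
  "suitable_bundles b d \<epsilon> n m k \<longleftrightarrow> (let s = nat \<lfloor>\<epsilon> * k\<rfloor>; \<A> = bundle_bank n m (\<epsilon> * k) in
     1 \<le> s \<and> s \<le> m \<and> real (card (hash_family m s)) * 2 ^ s \<le> 2 powr (d * k) \<and>
     allocation_bank n m \<A> \<and> mir_approx n m (monotone_valuations m) \<A> (6 / \<epsilon> * (real m / k)) \<and>
     mir_communication n (bounded_valuations m (2 powr (2 powr (b * k)))) \<A> (2 powr (d * k)) \<and>
     mir_value_queries n m (monotone_valuations m) \<A> (2 powr (d * k)))"

text \<open>The budget exponent \<open>d\<close> stays general to serve two regimes: d = 1 for
  \<open>MIR_Gen\<close>, and k = log 2 m for polynomial budgets, where \<open>d\<close> becomes the
  exponent of the polynomial.\<close>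

lemma hash_mechanism:
  fixes \<kappa> a b d :: real
  assumes "0 < \<kappa>" "0 \<le> b" "a + b < d"
  obtains \<epsilon> k0 where "0 < \<epsilon>" "1 \<le> k0"
    "\<And>m k n. k0 \<le> k \<Longrightarrow> k \<le> real m \<Longrightarrow> log 2 (real m) \<le> \<kappa> * k \<Longrightarrow> 1 \<le> n \<Longrightarrow> real n \<le> 2 powr (a * k) \<Longrightarrow>
       suitable_bundles b d \<epsilon> n m k"
proof -
  \<comment> \<open>The exponent \<open>d\<close> pays for the number of bidders with
    \<open>a\<close>, for the length of the values with \<open>b\<close> and for the queries with
    one \<delta>. The second \<delta> covers the factor 2 lost by rounding the number
    \<open>L\<close> of digits up.\<close>
  define \<delta> where "\<delta> = (d - a - b) / 2"
  have \<delta>: "0 < \<delta>" "d = a + b + \<delta> + \<delta>" using assms(3) by (simp_all add: \<delta>_def field_simps)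
  obtain \<epsilon> k1 where \<epsilon>: "0 < \<epsilon>" "\<epsilon> \<le> 1"
    and k1: "\<And>m s k. k1 \<le> k \<Longrightarrow> 1 \<le> m \<Longrightarrow> log 2 (real m) \<le> \<kappa> * k \<Longrightarrow> real s \<le> \<epsilon> * k \<Longrightarrow>
       hash_family_bound m s * 2 ^ s \<le> 2 powr (\<delta> * k)"
    using hash_family_bound_le[OF assms(1) \<delta>(1)] by metis
  \<comment> \<open>From 1 / \<epsilon> on there is at least one bundle, and from 1 / \<delta> on
    2^(\<delta> k) is at least 2.\<close>
  define k0 where "k0 = Max {1, k1, 1 / \<delta>, 1 / \<epsilon>}"
  have k0: "1 \<le> k0" "k1 \<le> k0" "1 / \<delta> \<le> k0" "1 / \<epsilon> \<le> k0" by (auto simp: k0_def)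
  show ?thesis
  proof (rule that[OF \<epsilon>(1) k0(1)])
    fix m n and k :: real
    assume k: "k0 \<le> k" "k \<le> real m" and mk: "log 2 (real m) \<le> \<kappa> * k" and n: "1 \<le> n" "real n \<le> 2 powr (a * k)"
    define s where s: "s = nat \<lfloor>\<epsilon> * k\<rfloor>"
    define \<A> where \<A>: "\<A> = hash_bank n m s (hash_family m s)"
    have k': "1 \<le> k" "k1 \<le> k" "1 / \<delta> \<le> k" "1 / \<epsilon> \<le> k" using k k0 by auto
    have m1: "1 \<le> m" using k(2) k'(1) by linarith
    have \<epsilon>k: "1 \<le> \<epsilon> * k" using k'(4) \<epsilon> by (simp add: divide_le_eq mult.commute)
    have \<delta>k: "1 \<le> \<delta> * k" using k'(3) \<delta> by (simp add: divide_le_eq mult.commute)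
    have s0: "1 \<le> s" "real s \<le> \<epsilon> * k" "\<epsilon> * k < real s + 1" using \<epsilon>k unfolding s by linarith+
    then have s1: "1 \<le> s" "real s \<le> \<epsilon> * k" "\<epsilon> * k \<le> 2 * real s" by linarith+
    have "\<epsilon> * k \<le> k" using \<epsilon> k' by (simp add: mult_left_le_one_le)
    then have sm: "s \<le> m" using s1 k(2) by linarith
    let ?F = "hash_family m s"
    have F: "perfect_hash_family m s ?F" "real (card ?F) \<le> hash_family_bound m s" using hash_family s1 sm by auto
    have bank: "allocation_bank n m \<A>" unfolding \<A> by (rule hash_bank_is_bank[OF F(1)])
    have FB: "real (card ?F) * 2 ^ s \<le> 2 powr (\<delta> * k)"
      using k1[OF k'(2) m1 mk s1(2)] F(2) by (smt (verit) mult_right_mono zero_le_power)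
    let ?QS = "hash_queries m s ?F"
    have "real (card ?QS) \<le> real (card ?F * 2 ^ s)" using hash_queries_card(1)[OF F(1)] of_nat_le_iff by blast
    then have QS: "real (card ?QS) \<le> 2 powr (\<delta> * k)" using FB by simp
    have nQS: "real n * real (card ?QS) \<le> 2 powr (a * k) * 2 powr (\<delta> * k)" using n QS by (intro mult_mono) auto
    define L where "L = nat \<lceil>2 powr (b * k)\<rceil>"
    have one: "1 \<le> 2 powr (b * k)" using assms(2) k' by (simp add: ge_one_powr_ge_zero)
    have L: "2 powr (b * k) \<le> real L" "real L \<le> 2 * 2 powr (b * k)" using one unfolding L_def by linarith+
    have "2 * 2 powr (b * k) \<le> 2 powr (\<delta> * k) * 2 powr (b * k)"
      using \<delta>k powr_mono[of 1 "\<delta> * k" "2::real"] by (intro mult_right_mono) auto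
    then have L': "real L \<le> 2 powr (\<delta> * k) * 2 powr (b * k)" using L by linarith
    have dk: "2 powr (a * k) * 2 powr (\<delta> * k) * (2 powr (\<delta> * k) * 2 powr (b * k)) = 2 powr (d * k)"
      unfolding \<delta>(2) by (simp add: powr_add[symmetric] algebra_simps)
    have one': "1 \<le> 2 powr (\<delta> * k) * 2 powr (b * k)" using one \<delta>k
      by (smt (verit) ge_one_powr_ge_zero mult_le_cancel_left1 powr_ge_zero)
    have q: "real n * real (card ?QS) \<le> 2 powr (d * k)"
      using nQS one' unfolding dk[symmetric] by (smt (verit) mult_le_cancel_left1 mult_nonneg_nonneg powr_ge_zero)
    have c: "real n * real (card ?QS) * real L \<le> 2 powr (d * k)"
      unfolding dk[symmetric] using mult_mono[OF nQS L'] by simp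
    have "2 powr (2 powr (b * k)) \<le> 2 powr real L" using L(1) by simp
    then have B: "2 powr (2 powr (b * k)) \<le> (2::real) ^ L" by (simp add: powr_realpow)
    have query: "\<And>A i. A \<in> \<A> \<Longrightarrow> i < n \<Longrightarrow> A i \<in> ?QS" unfolding \<A> using hash_bank_query[OF F(1)] by blast
    \<comment> \<open>Rounding \<epsilon> k \<ge> 1 down to \<open>s\<close> at most halves it,
      which turns the factor 3 into 6.\<close>
    have "3 * real m / real s \<le> 6 / \<epsilon> * (real m / k)"
    proof -
      have "3 * real m / real s \<le> 3 * real m / (\<epsilon> * k / 2)" using s1 \<epsilon>k by (intro divide_left_mono) auto
      then show ?thesis by (simp add: field_simps)
    qed
    then have "mir_approx n m (monotone_valuations m) \<A> (6 / \<epsilon> * (real m / k))"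
      unfolding \<A> using hash_bank_approx[OF F(1) s1(1) sm n(1)] by blast
    moreover have "real (card ?F) * 2 ^ s \<le> 2 powr (d * k)"
    proof -
      have "1 \<le> 2 powr (a * k)" using n by linarith
      then have "2 powr (\<delta> * k) \<le> 2 powr (a * k) * 2 powr (\<delta> * k) * (2 powr (\<delta> * k) * 2 powr (b * k))"
        using one' by (smt (verit) mult_le_cancel_left1 mult_le_cancel_right1 mult_nonneg_nonneg powr_ge_zero)
      then show ?thesis using FB dk by linarith
    qed
    moreover have "mir_communication n (bounded_valuations m (2 powr (2 powr (b * k)))) \<A> (2 powr (d * k))"
      using bank hash_queries_card(2,3)[OF F(1)] query B c by (rule mir_communication_by_announcement)
    moreover have "mir_value_queries n m (monotone_valuations m) \<A> (2 powr (d * k))"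
      using bank hash_queries_card(3)[OF F(1)] query q by (rule mir_value_queries_hash_bank)
    ultimately show "suitable_bundles b d \<epsilon> n m k"
      unfolding suitable_bundles_def bundle_bank_def Let_def s[symmetric] \<A>[symmetric] using s1(1) sm bank by blast
  qed
qed

lemma mir_approx_mono:
  "mir_approx n m V' \<A> \<alpha> \<Longrightarrow> V \<subseteq> V' \<Longrightarrow> mir_approx n m V \<A> \<alpha>"
  unfolding mir_approx_def by blast

lemma mir_guarantee_le:
  assumes "0 < \<alpha>"
    and "\<And>n. 1 \<le> n \<Longrightarrow> real n \<le> N \<Longrightarrow> allocation_bank n m (\<A> n) \<and>
       mir_approx n m (monotone_valuations m) (\<A> n) \<alpha> \<and> mir_communication n (bounded_valuations m B) (\<A> n) b"
  shows "mir_guarantee N B b m \<le> ereal \<alpha>"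
  unfolding mir_guarantee_def
proof (rule Inf_lower, clarsimp, intro exI[of _ \<alpha>] conjI refl assms(1) allI impI)
  fix n :: nat assume "Suc 0 \<le> n \<and> real n \<le> N"
  then show "\<exists>\<A>. allocation_bank n m \<A> \<and> mir_approx n m (bounded_valuations m B) \<A> \<alpha> \<and>
      mir_communication n (bounded_valuations m B) \<A> b"
    using assms(2)[of n] mir_approx_mono[of n m "monotone_valuations m" "\<A> n" \<alpha> "bounded_valuations m B"]
    by (intro exI[of _ "\<A> n"]) (auto simp: bounded_valuations_def)
qed

section \<open>Straight-line computations\<close>

text \<open>Operands are fixed positions of earlier results, and only the input can be read at a
  computed address. Without jumps, the sequence of instructions is the same for all inputs.\<close>

datatype instr = IConst nat | IAdd nat nat | ISub nat nat | IRead nat | IIte nat nat nat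

primrec instr_value :: "(nat \<Rightarrow> nat) \<Rightarrow> nat list \<Rightarrow> instr \<Rightarrow> nat" where
  "instr_value x vs (IConst c) = c"
| "instr_value x vs (IAdd a b) = vs ! a + vs ! b"
| "instr_value x vs (ISub a b) = vs ! a - vs ! b"
| "instr_value x vs (IRead a) = x (vs ! a)"
| "instr_value x vs (IIte a b c) = (if vs ! a \<noteq> 0 then vs ! b else vs ! c)"

definition run_code :: "(nat \<Rightarrow> nat) \<Rightarrow> instr list \<Rightarrow> nat list" where
  "run_code x code = foldl (\<lambda>vs i. vs @ [instr_value x vs i]) [] code"

lemma run_code_Nil [simp]: "run_code x [] = []"
  and run_code_snoc [simp]: "run_code x (code @ [i]) = run_code x code @ [instr_value x (run_code x code) i]"
  by (simp_all add: run_code_def)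

lemma length_run_code [simp]: "length (run_code x code) = length code"
  by (induction code rule: rev_induct) auto

lemma run_code_append_nth: "p < length code \<Longrightarrow> run_code x (code @ ext) ! p = run_code x code ! p"
proof (induction ext rule: rev_induct)
  case (snoc i ext)
  then show ?case using run_code_snoc[of x "code @ ext" i] by (simp add: nth_append)
qed simp

primrec instr_wf :: "nat \<Rightarrow> nat \<Rightarrow> instr \<Rightarrow> bool" where
  "instr_wf D p (IConst c) \<longleftrightarrow> c \<le> D"
| "instr_wf D p (IAdd a b) \<longleftrightarrow> a < p \<and> b < p"
| "instr_wf D p (ISub a b) \<longleftrightarrow> a < p \<and> b < p"
| "instr_wf D p (IRead a) \<longleftrightarrow> a < p"
| "instr_wf D p (IIte a b c) \<longleftrightarrow> a < p \<and> b < p \<and> c < p"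

text \<open>Addresses that are read have to be bounded, as the results are stored behind the input.\<close>
definition code_wf :: "nat \<Rightarrow> nat \<Rightarrow> (nat \<Rightarrow> nat) set \<Rightarrow> instr list \<Rightarrow> bool" where
  "code_wf D R xs code \<longleftrightarrow> (\<forall>p<length code. instr_wf D p (code ! p) \<and>
     (\<forall>a. code ! p = IRead a \<longrightarrow> (\<forall>x\<in>xs. run_code x code ! a < R)))"

lemma code_wf_Nil: "code_wf D R xs []"
  by (simp add: code_wf_def)

lemma code_wf_snoc:
  assumes "code_wf D R xs code" "instr_wf D (length code) i"
    and "\<And>a x. i = IRead a \<Longrightarrow> x \<in> xs \<Longrightarrow> run_code x code ! a < R"
  shows "code_wf D R xs (code @ [i])"
  unfolding code_wf_def
proof (intro allI impI conjI ballI)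
  fix p assume p: "p < length (code @ [i])"
  show "instr_wf D p ((code @ [i]) ! p)"
    using assms(1,2) p by (cases "p = length code") (auto simp: code_wf_def nth_append)
  fix a x assume a: "(code @ [i]) ! p = IRead a" and x: "x \<in> xs"
  show "run_code x (code @ [i]) ! a < R"
  proof (cases "p = length code")
    case True
    then have "i = IRead a" using a by simp
    then show ?thesis using assms(2,3) x by (simp add: nth_append)
  next
    case False
    then have "code ! p = IRead a" "p < length code" using a p by (auto simp: nth_append)
    then have "run_code x code ! a < R" "a < p" using assms(1) x by (auto simp: code_wf_def dest!: spec[of _ p])
    then show ?thesis using \<open>p < length code\<close> by (simp add: nth_append)
  qed
qed

text \<open>\<open>X\<close> dominates all parameters of the computation; numbers of steps are bounded by polynomials in \<open>X\<close>.\<close>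
locale slp =
  fixes inp :: "'w \<Rightarrow> nat \<Rightarrow> nat" and \<Omega> :: "'w set" and X :: nat
  assumes X: "1 \<le> X"
begin

section \<open>A calculus of computable families of functions\<close>

text \<open>The position must be the same for all admissible inputs, since later instructions refer
  to it by a constant.\<close>

definition avail :: "instr list \<Rightarrow> ('w \<Rightarrow> nat) \<Rightarrow> bool" where
  "avail code f \<longleftrightarrow> (\<exists>p<length code. \<forall>w\<in>\<Omega>. run_code (inp w) code ! p = f w)"

text \<open>Small constants keep the entries of the advice polynomial in \<open>X\<close>. The
  second bound admits all addresses to be read: the circuits before a given one occupy at most 5 *
  X^2 cells, and offsets up to 10 * X are used within it.\<close>

abbreviation wf :: "instr list \<Rightarrow> bool" where
  "wf \<equiv> code_wf (10 * X) (20 * X ^ 2) (inp ` \<Omega>)"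

text \<open>Quantifying over all codes that provide \<open>F\<close> makes the notion compositional:
  computations are chained without ever naming the positions of their results or exhibiting a
  code.\<close>

definition gets :: "('w \<Rightarrow> nat) set \<Rightarrow> nat \<Rightarrow> ('w \<Rightarrow> nat) set \<Rightarrow> bool" where
  "gets F t G \<longleftrightarrow> (\<forall>code. wf code \<and> (\<forall>f\<in>F. avail code f) \<longrightarrow>
     (\<exists>ext. length ext \<le> t \<and> wf (code @ ext) \<and> (\<forall>g\<in>G. avail (code @ ext) g)))"

lemma avail_append: "avail code f \<Longrightarrow> avail (code @ ext) f"
  unfolding avail_def using run_code_append_nth by (metis length_append trans_less_add1)

lemma gets_mono:
  assumes "gets F t G" "F \<subseteq> F'" "t \<le> t'" "G' \<subseteq> G"
  shows "gets F' t' G'"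
  using assms unfolding gets_def by (meson order_trans subset_iff)

lemma gets_self: "G \<subseteq> F \<Longrightarrow> gets F 0 G"
  unfolding gets_def by (metis append_Nil2 le_zero_eq list.size(3) subsetD)

lemma gets_trans:
  assumes "gets F t G" "gets (F \<union> G) t' H"
  shows "gets F (t + t') (G \<union> H)"
  unfolding gets_def
proof (intro allI impI)
  fix code assume c: "wf code \<and> (\<forall>f\<in>F. avail code f)"
  then obtain ext where e: "length ext \<le> t" "wf (code @ ext)" "\<forall>g\<in>G. avail (code @ ext) g"
    using assms(1) unfolding gets_def by blast
  then obtain ext' where e': "length ext' \<le> t'" "wf ((code @ ext) @ ext')" "\<forall>g\<in>H. avail ((code @ ext) @ ext') g"
    using assms(2) c avail_append unfolding gets_def by (metis Un_iff)
  show "\<exists>ext. length ext \<le> t + t' \<and> wf (code @ ext) \<and> (\<forall>g\<in>G \<union> H. avail (code @ ext) g)"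
    using e e' avail_append[of "code @ ext" _ ext'] by (intro exI[of _ "ext @ ext'"]) auto
qed

lemma gets_cong:
  assumes "gets F t {f}" "\<And>w. w \<in> \<Omega> \<Longrightarrow> f w = g w"
  shows "gets F t {g}"
  using assms unfolding gets_def avail_def by simp

lemma gets_union:
  assumes "gets F t G" "gets F t' H"
  shows "gets F (t + t') (G \<union> H)"
  using gets_trans[OF assms(1)] gets_mono[OF assms(2)] by blast

lemma gets_step:
  assumes "\<And>code. wf code \<Longrightarrow> \<forall>f\<in>F. avail code f \<Longrightarrow> \<exists>i. instr_wf (10 * X) (length code) i \<and>
      (\<forall>w\<in>\<Omega>. instr_value (inp w) (run_code (inp w) code) i = g w) \<and>
      (\<forall>a. i = IRead a \<longrightarrow> (\<forall>w\<in>\<Omega>. run_code (inp w) code ! a < 20 * X ^ 2))"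
  shows "gets F 1 {g}"
  unfolding gets_def
proof (intro allI impI)
  fix code assume c: "wf code \<and> (\<forall>f\<in>F. avail code f)"
  then obtain i where i: "instr_wf (10 * X) (length code) i"
      "\<forall>w\<in>\<Omega>. instr_value (inp w) (run_code (inp w) code) i = g w"
      "\<forall>a. i = IRead a \<longrightarrow> (\<forall>w\<in>\<Omega>. run_code (inp w) code ! a < 20 * X ^ 2)" using assms by blast
  have "wf (code @ [i])" using c i by (intro code_wf_snoc) auto
  moreover have "avail (code @ [i]) g" unfolding avail_def using i(2) by (intro exI[of _ "length code"]) (simp add: nth_append)
  ultimately show "\<exists>ext. length ext \<le> 1 \<and> wf (code @ ext) \<and> (\<forall>g'\<in>{g}. avail (code @ ext) g')"
    by (intro exI[of _ "[i]"]) auto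
qed

lemma gets_const: "c \<le> 10 * X \<Longrightarrow> gets F 1 {\<lambda>_. c}"
  by (rule gets_step) (intro exI[of _ "IConst c"], simp)

lemma gets_add_step: "f \<in> F \<Longrightarrow> g \<in> F \<Longrightarrow> gets F 1 {\<lambda>w. f w + g w}"
proof (rule gets_step)
  fix code assume "f \<in> F" "g \<in> F" "\<forall>f\<in>F. avail code f"
  then obtain a b where "a < length code" "\<forall>w\<in>\<Omega>. run_code (inp w) code ! a = f w"
    "b < length code" "\<forall>w\<in>\<Omega>. run_code (inp w) code ! b = g w" unfolding avail_def by meson
  then show "\<exists>i. instr_wf (10 * X) (length code) i \<and>
      (\<forall>w\<in>\<Omega>. instr_value (inp w) (run_code (inp w) code) i = f w + g w) \<and>
      (\<forall>a. i = IRead a \<longrightarrow> (\<forall>w\<in>\<Omega>. run_code (inp w) code ! a < 20 * X ^ 2))"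
    by (intro exI[of _ "IAdd a b"]) simp
qed

lemma gets_sub_step: "f \<in> F \<Longrightarrow> g \<in> F \<Longrightarrow> gets F 1 {\<lambda>w. f w - g w}"
proof (rule gets_step)
  fix code assume "f \<in> F" "g \<in> F" "\<forall>f\<in>F. avail code f"
  then obtain a b where "a < length code" "\<forall>w\<in>\<Omega>. run_code (inp w) code ! a = f w"
    "b < length code" "\<forall>w\<in>\<Omega>. run_code (inp w) code ! b = g w" unfolding avail_def by meson
  then show "\<exists>i. instr_wf (10 * X) (length code) i \<and>
      (\<forall>w\<in>\<Omega>. instr_value (inp w) (run_code (inp w) code) i = f w - g w) \<and>
      (\<forall>a. i = IRead a \<longrightarrow> (\<forall>w\<in>\<Omega>. run_code (inp w) code ! a < 20 * X ^ 2))"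
    by (intro exI[of _ "ISub a b"]) simp
qed

lemma gets_read_step:
  assumes "f \<in> F" and R: "\<And>w. w \<in> \<Omega> \<Longrightarrow> f w < 20 * X ^ 2"
  shows "gets F 1 {\<lambda>w. inp w (f w)}"
proof (rule gets_step)
  fix code assume "\<forall>f\<in>F. avail code f"
  then obtain a where "a < length code" "\<forall>w\<in>\<Omega>. run_code (inp w) code ! a = f w"
    using assms(1) unfolding avail_def by meson
  then show "\<exists>i. instr_wf (10 * X) (length code) i \<and>
      (\<forall>w\<in>\<Omega>. instr_value (inp w) (run_code (inp w) code) i = inp w (f w)) \<and>
      (\<forall>a. i = IRead a \<longrightarrow> (\<forall>w\<in>\<Omega>. run_code (inp w) code ! a < 20 * X ^ 2))"
    using R by (intro exI[of _ "IRead a"]) simp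
qed

lemma gets_ite_step: "f \<in> F \<Longrightarrow> g \<in> F \<Longrightarrow> h \<in> F \<Longrightarrow> gets F 1 {\<lambda>w. if f w \<noteq> 0 then g w else h w}"
proof (rule gets_step)
  fix code assume "f \<in> F" "g \<in> F" "h \<in> F" "\<forall>f\<in>F. avail code f"
  then obtain a b c where "a < length code" "\<forall>w\<in>\<Omega>. run_code (inp w) code ! a = f w"
    "b < length code" "\<forall>w\<in>\<Omega>. run_code (inp w) code ! b = g w"
    "c < length code" "\<forall>w\<in>\<Omega>. run_code (inp w) code ! c = h w" unfolding avail_def by meson
  then show "\<exists>i. instr_wf (10 * X) (length code) i \<and>
      (\<forall>w\<in>\<Omega>. instr_value (inp w) (run_code (inp w) code) i = (if f w \<noteq> 0 then g w else h w)) \<and>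
      (\<forall>a. i = IRead a \<longrightarrow> (\<forall>w\<in>\<Omega>. run_code (inp w) code ! a < 20 * X ^ 2))"
    by (intro exI[of _ "IIte a b c"]) simp
qed

lemma gets_op:
  assumes "gets F t {f}" "gets F t' {g}" "\<And>F. f \<in> F \<Longrightarrow> g \<in> F \<Longrightarrow> gets F 1 {h}"
  shows "gets F (t + t' + 1) {h}"
proof -
  have "gets F (t + t') ({f} \<union> {g})" using assms(1,2) by (rule gets_union)
  from gets_trans[OF this assms(3)] show ?thesis by (rule gets_mono) auto
qed

lemma gets_add: "gets F t {f} \<Longrightarrow> gets F t' {g} \<Longrightarrow> gets F (t + t' + 1) {\<lambda>w. f w + g w}"
  by (erule (1) gets_op) (rule gets_add_step)

lemma gets_sub: "gets F t {f} \<Longrightarrow> gets F t' {g} \<Longrightarrow> gets F (t + t' + 1) {\<lambda>w. f w - g w}"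
  by (erule (1) gets_op) (rule gets_sub_step)

lemma gets_read:
  assumes "gets F t {f}" "\<And>w. w \<in> \<Omega> \<Longrightarrow> f w < 20 * X ^ 2"
  shows "gets F (t + 1) {\<lambda>w. inp w (f w)}"
proof -
  have "gets (F \<union> {f}) 1 {\<lambda>w. inp w (f w)}" using assms(2) by (intro gets_read_step) auto
  from gets_trans[OF assms(1) this] show ?thesis by (rule gets_mono) auto
qed

lemma gets_ite:
  assumes "gets F t {f}" "gets F t' {g}" "gets F t'' {h}"
  shows "gets F (t + t' + t'' + 1) {\<lambda>w. if f w \<noteq> 0 then g w else h w}"
proof -
  have "gets F (t + t' + t'') ({f} \<union> {g} \<union> {h})" by (intro gets_union assms)
  moreover have "gets (F \<union> ({f} \<union> {g} \<union> {h})) 1 {\<lambda>w. if f w \<noteq> 0 then g w else h w}"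
    by (intro gets_ite_step) auto
  ultimately show ?thesis by (meson gets_trans gets_mono order_refl Un_upper2)
qed

lemma gets_UN:
  assumes "finite I" "\<And>i. i \<in> I \<Longrightarrow> gets F t (G i)"
  shows "gets F (card I * t) (\<Union>i\<in>I. G i)"
  using assms
proof (induction rule: finite_induct)
  case (insert i I)
  have "gets F (t + card I * t) (G i \<union> (\<Union>i\<in>I. G i))" using insert by (intro gets_union) auto
  then show ?case using insert.hyps by simp
qed (simp add: gets_self)

text \<open>In contrast to \<open>gets_UN\<close>, each member may build on the earlier ones, as
  needed for gates, powers of two, and the positions of consecutive circuits.\<close>

lemma gets_chain:
  assumes "\<And>i. i < N \<Longrightarrow> gets (F \<union> (\<Union>j<i. G j)) t (G i)"
  shows "gets F (N * t) (\<Union>i<N. G i)"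
  using assms
proof (induction N)
  case (Suc N)
  have "gets F (N * t) (\<Union>i<N. G i)" using Suc by simp
  from gets_trans[OF this Suc.prems[of N]] show ?case by (rule gets_mono) (auto simp: lessThan_Suc)
qed (simp add: gets_self)

lemma gets_sum:
  assumes "finite I" "\<And>i. i \<in> I \<Longrightarrow> gets F t {f i}"
  shows "gets F (card I * (t + 1) + 1) {\<lambda>w. \<Sum>i\<in>I. f i w}"
  using assms
proof (induction rule: finite_induct)
  case empty
  then show ?case using gets_const[of 0 F] by simp
next
  case (insert i I)
  have "gets F (t + (card I * (t + 1) + 1) + 1) {\<lambda>w. f i w + (\<Sum>i\<in>I. f i w)}" using insert by (intro gets_add) auto
  then show ?case using insert.hyps by (simp add: add.commute add.left_commute)
qed

lemma gets_mem: "f \<in> F \<Longrightarrow> gets F 0 {f}"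
  by (rule gets_self) simp

section \<open>Step counts as polynomials in \<open>X\<close>\<close>

text \<open>Coefficient and degree are separate parameters. Single operations add to the
  coefficient, while families, chains and sums indexed by at most \<open>X\<close> elements raise
  the degree by one.\<close>

definition polys :: "('w \<Rightarrow> nat) set \<Rightarrow> nat \<Rightarrow> nat \<Rightarrow> ('w \<Rightarrow> nat) set \<Rightarrow> bool" where
  "polys F c j G \<longleftrightarrow> gets F (c * X ^ j) G"

lemma polys_mono:
  assumes "polys F c j G" "F \<subseteq> F'" "c \<le> c'" "j \<le> j'" "G' \<subseteq> G"
  shows "polys F' c' j' G'"
  using assms X unfolding polys_def by (elim gets_mono) (auto intro!: mult_mono power_increasing)

lemma polys_of_gets: "gets F c G \<Longrightarrow> polys F c j G"
  unfolding polys_def using X by (elim gets_mono) auto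

lemma polys_trans: "polys F c j G \<Longrightarrow> polys (F \<union> G) c' j H \<Longrightarrow> polys F (c + c') j (G \<union> H)"
  unfolding polys_def by (simp add: distrib_right gets_trans)

lemma polys_cong: "polys F c j {f} \<Longrightarrow> (\<And>w. w \<in> \<Omega> \<Longrightarrow> f w = g w) \<Longrightarrow> polys F c j {g}"
  unfolding polys_def by (rule gets_cong)

lemma polys_mem: "f \<in> F \<Longrightarrow> polys F 0 j {f}"
  unfolding polys_def by (simp add: gets_mem)

lemma polys_const: "c \<le> 10 * X \<Longrightarrow> polys F 1 j {\<lambda>_. c}"
  by (intro polys_of_gets gets_const)

lemma polys_bound: "gets F t G \<Longrightarrow> t \<le> c * X ^ j \<Longrightarrow> polys F c j G"
  unfolding polys_def by (erule gets_mono) auto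

lemma power_X: "1 \<le> X ^ j"
  using X by simp

lemma polys_add:
  assumes "polys F c j {f}" "polys F c' j {g}"
  shows "polys F (c + c' + 1) j {\<lambda>w. f w + g w}"
proof (rule polys_bound)
  show "gets F (c * X ^ j + c' * X ^ j + 1) {\<lambda>w. f w + g w}" using assms unfolding polys_def by (rule gets_add)
  show "c * X ^ j + c' * X ^ j + 1 \<le> (c + c' + 1) * X ^ j" using power_X[of j] by (simp add: algebra_simps)
qed

lemma polys_sub:
  assumes "polys F c j {f}" "polys F c' j {g}"
  shows "polys F (c + c' + 1) j {\<lambda>w. f w - g w}"
proof (rule polys_bound)
  show "gets F (c * X ^ j + c' * X ^ j + 1) {\<lambda>w. f w - g w}" using assms unfolding polys_def by (rule gets_sub)
  show "c * X ^ j + c' * X ^ j + 1 \<le> (c + c' + 1) * X ^ j" using power_X[of j] by (simp add: algebra_simps)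
qed

lemma polys_read:
  assumes "polys F c j {f}" "\<And>w. w \<in> \<Omega> \<Longrightarrow> f w < 20 * X ^ 2"
  shows "polys F (c + 1) j {\<lambda>w. inp w (f w)}"
proof (rule polys_bound)
  show "gets F (c * X ^ j + 1) {\<lambda>w. inp w (f w)}" using assms unfolding polys_def by (rule gets_read)
  show "c * X ^ j + 1 \<le> (c + 1) * X ^ j" using power_X[of j] by (simp add: algebra_simps)
qed

lemma polys_ite:
  assumes "polys F c j {f}" "polys F c' j {g}" "polys F c'' j {h}"
  shows "polys F (c + c' + c'' + 1) j {\<lambda>w. if f w \<noteq> 0 then g w else h w}"
proof (rule polys_bound)
  show "gets F (c * X ^ j + c' * X ^ j + c'' * X ^ j + 1) {\<lambda>w. if f w \<noteq> 0 then g w else h w}"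
    using assms unfolding polys_def by (rule gets_ite)
  show "c * X ^ j + c' * X ^ j + c'' * X ^ j + 1 \<le> (c + c' + c'' + 1) * X ^ j"
    using power_X[of j] by (simp add: algebra_simps)
qed

lemma polys_UN:
  assumes "finite I" "card I \<le> X" "\<And>i. i \<in> I \<Longrightarrow> polys F c j (G i)"
  shows "polys F c (Suc j) (\<Union>i\<in>I. G i)"
proof (rule polys_bound)
  show "gets F (card I * (c * X ^ j)) (\<Union>i\<in>I. G i)"
    using gets_UN[OF assms(1)] assms(3) unfolding polys_def by blast
  show "card I * (c * X ^ j) \<le> c * X ^ Suc j" using assms(2) by (simp add: mult.commute mult.left_commute mult_le_mono1)
qed

lemma polys_chain:
  assumes "N \<le> X" "\<And>i. i < N \<Longrightarrow> polys (F \<union> (\<Union>j<i. G j)) c j (G i)"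
  shows "polys F c (Suc j) (\<Union>i<N. G i)"
proof (rule polys_bound)
  show "gets F (N * (c * X ^ j)) (\<Union>i<N. G i)"
    using gets_chain assms(2) unfolding polys_def by blast
  show "N * (c * X ^ j) \<le> c * X ^ Suc j" using assms(1) by (simp add: mult.commute mult.left_commute mult_le_mono1)
qed

lemma polys_sum:
  assumes "finite I" "card I \<le> X" "\<And>i. i \<in> I \<Longrightarrow> polys F c j {f i}"
  shows "polys F (c + 2) (Suc j) {\<lambda>w. \<Sum>i\<in>I. f i w}"
proof (rule polys_bound)
  show "gets F (card I * (c * X ^ j + 1) + 1) {\<lambda>w. \<Sum>i\<in>I. f i w}"
    using gets_sum[OF assms(1)] assms(3) unfolding polys_def by blast
  have "card I * (c * X ^ j + 1) + 1 \<le> X * (c * X ^ j + X ^ j) + X * X ^ j"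
    using assms(2) X power_X[of j] mult_le_mono[OF X power_X[of j]] by (intro add_mono mult_le_mono) auto
  then show "card I * (c * X ^ j + 1) + 1 \<le> (c + 2) * X ^ Suc j" by (simp add: algebra_simps)
qed

text \<open>With truncated subtraction, (f - a) + (a - f) vanishes exactly if f = a.\<close>

lemma polys_eq_const:
  assumes "polys F c j {f}" "a \<le> 10 * X"
  shows "polys F (2 * c + 8) j {\<lambda>w. of_bool (f w = a)}"
proof -
  have "polys F ((c + 1 + 1) + (1 + c + 1) + 1 + 1 + 1 + 1) j
      {\<lambda>w. if (f w - a) + (a - f w) \<noteq> 0 then 0 else 1}"
    using assms X by (intro polys_ite polys_add polys_sub polys_const) auto
  then have "polys F (2 * c + 8) j {\<lambda>w. if (f w - a) + (a - f w) \<noteq> 0 then 0 else 1}"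
    by (rule polys_mono) auto
  then show ?thesis by (rule polys_cong) auto
qed

text \<open>Replaces indirect addressing of earlier results: all candidates are summed up, each
  masked by the test whether it is selected, so at most one summand is nonzero.\<close>

lemma polys_select:
  assumes N: "N \<le> X" and a: "polys F c 0 {a}" and f: "\<And>q. q < N \<Longrightarrow> f q \<in> F"
  shows "polys F (2 * c + 12) 1 {\<lambda>w. if a w < N then f (a w) w else 0}"
proof -
  have "polys F ((2 * c + 8 + 0 + 1 + 1) + 2) (Suc 0) {\<lambda>w. \<Sum>q<N. if of_bool (a w = q) \<noteq> (0::nat) then f q w else 0}"
    using N f a by (intro polys_sum polys_ite polys_eq_const polys_mem polys_const) auto
  then have "polys F (2 * c + 12) 1 {\<lambda>w. \<Sum>q<N. if of_bool (a w = q) \<noteq> (0::nat) then f q w else 0}"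
    by (rule polys_mono) auto
  then show ?thesis by (rule polys_cong) (simp add: sum.delta')
qed

end

section \<open>Evaluation of circuits\<close>

lemma length_encode_gate [simp]: "length (encode_gate g) = 3"
  by (cases g) auto

lemma length_concat_encode_gate [simp]: "length (concat (map encode_gate gs)) = 3 * length gs"
  by (induction gs) auto

lemma length_encode_circuit: "length (encode_circuit c) = 2 + 3 * length (fst c) + length (snd c)"
  by (simp add: encode_circuit_def)

lemma nth_concat_encode_gate:
  "p < length gs \<Longrightarrow> r < 3 \<Longrightarrow> concat (map encode_gate gs) ! (3 * p + r) = encode_gate (gs ! p) ! r"
proof (induction gs arbitrary: p)
  case (Cons g gs)
  then show ?case by (cases p) (auto simp: nth_append)
qed simp

lemma encode_circuit_nth:
  "encode_circuit c ! 0 = length (fst c)"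
  "encode_circuit c ! 1 = length (snd c)"
  "p < length (fst c) \<Longrightarrow> r < 3 \<Longrightarrow> encode_circuit c ! (2 + 3 * p + r) = encode_gate (fst c ! p) ! r"
  "l < length (snd c) \<Longrightarrow> encode_circuit c ! (2 + 3 * length (fst c) + l) = snd c ! l"
  using nth_concat_encode_gate[of p "fst c" r] by (auto simp: encode_circuit_def nth_append)

lemma circuit_bits_Nil [simp]: "circuit_bits S [] = []"
  and circuit_bits_snoc: "circuit_bits S (gs @ [g]) = circuit_bits S gs @ [gate_bit S (circuit_bits S gs) g]"
  by (simp_all add: circuit_bits_def)

lemma length_circuit_bits [simp]: "length (circuit_bits S gs) = length gs"
  by (induction gs rule: rev_induct) (auto simp: circuit_bits_snoc)

lemma circuit_bits_append_nth: "p < length gs \<Longrightarrow> circuit_bits S (gs @ gs') ! p = circuit_bits S gs ! p"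
proof (induction gs' rule: rev_induct)
  case (snoc g gs')
  then show ?case using circuit_bits_snoc[of S "gs @ gs'" g] by (simp add: nth_append)
qed simp

lemma circuit_bits_nth:
  assumes "p < length gs" "gate_wf m p (gs ! p)"
  shows "circuit_bits S gs ! p = gate_bit S (circuit_bits S gs) (gs ! p)"
proof -
  let ?pre = "take p gs"
  have gs: "gs = (?pre @ [gs ! p]) @ drop (Suc p) gs" using assms(1) by (simp add: id_take_nth_drop)
  have "circuit_bits S gs ! p = circuit_bits S (?pre @ [gs ! p]) ! p"
    using circuit_bits_append_nth[of p "?pre @ [gs ! p]" S "drop (Suc p) gs"] gs assms(1) by simp
  also have "\<dots> = gate_bit S (circuit_bits S ?pre) (gs ! p)" using assms(1) by (simp add: circuit_bits_snoc nth_append)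
  also have "\<dots> = gate_bit S (circuit_bits S gs) (gs ! p)"
  proof -
    have "circuit_bits S ?pre ! q = circuit_bits S gs ! q" if "q < p" for q
      using circuit_bits_append_nth[of q ?pre S "drop p gs"] that assms(1) by simp
    then show ?thesis using assms(2) by (cases "gs ! p") auto
  qed
  finally show ?thesis .
qed

text \<open>The part of the input behind the advice. The default 0 agrees with the initial memory
  behind the last circuit, so reads beyond it are meaningful as well.\<close>

definition stream :: "circuit list \<Rightarrow> nat \<Rightarrow> nat" where
  "stream cs a = (let xs = concat (map encode_circuit cs) in if a < length xs then xs ! a else 0)"

definition circuit_inputs :: "nat \<Rightarrow> nat \<Rightarrow> nat \<Rightarrow> circuit list set" where
  "circuit_inputs n m Z = {cs. length cs = n \<and>
     (\<forall>c\<in>set cs. circuit_wf m c \<and> circuit_size c \<le> Z \<and> circuit_valuation c \<in> monotone_valuations m)}"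

definition start :: "nat \<Rightarrow> circuit list \<Rightarrow> nat" where
  "start i cs = length (concat (map encode_circuit (take i cs)))"

definition circuit_value :: "nat \<Rightarrow> nat set \<Rightarrow> circuit list \<Rightarrow> nat" where
  "circuit_value i S cs = (\<Sum>l<length (snd (cs ! i)). if circuit_bits S (fst (cs ! i)) ! (snd (cs ! i) ! l) then 2 ^ l else 0)"

lemma real_circuit_value: "real (circuit_value i S cs) = circuit_valuation (cs ! i) S"
  unfolding circuit_value_def circuit_valuation_def of_nat_sum by (intro sum.cong) auto

lemma stream_start:
  assumes "i < length cs" "a < length (encode_circuit (cs ! i))"
  shows "stream cs (start i cs + a) = encode_circuit (cs ! i) ! a"
proof -
  have "concat (map encode_circuit cs) = concat (map encode_circuit (take i cs)) @ encode_circuit (cs ! i)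
      @ concat (map encode_circuit (drop (Suc i) cs))"
    using assms(1) by (metis id_take_nth_drop map_append concat_append list.simps(9) concat.simps(2))
  then show ?thesis using assms(2) by (simp add: stream_def start_def nth_append)
qed

lemma start_Suc: "i < length cs \<Longrightarrow> start (Suc i) cs = start i cs + length (encode_circuit (cs ! i))"
  by (simp add: start_def take_Suc_conv_app_nth)

section \<open>Oblivious evaluation of circuits of varying size\<close>

locale circuit_slp =
  fixes n m Z X :: nat
  assumes X1: "1 \<le> X" and nX: "n \<le> X" and mX: "m \<le> X" and ZX: "Z \<le> X"
begin

sublocale slp stream "circuit_inputs n m Z" X
  by unfold_locales (rule X1)

lemma inputs_size:
  assumes "cs \<in> circuit_inputs n m Z" "i < n"
  shows "length (fst (cs ! i)) + length (snd (cs ! i)) \<le> Z" "circuit_wf m (cs ! i)" "i < length cs"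
  using assms by (auto simp: circuit_inputs_def circuit_size_def)

lemma start_le:
  assumes "cs \<in> circuit_inputs n m Z" "i \<le> n"
  shows "start i cs \<le> i * (2 + 3 * Z)"
  using assms(2)
proof (induction i)
  case (Suc i)
  then show ?case using inputs_size[OF assms(1), of i] by (simp add: start_Suc length_encode_circuit)
qed (simp add: start_def)

text \<open>The offset is not tied to the actual size of the circuit: oblivious code also reads
  behind its end, and masks the result only afterwards.\<close>

lemma address_bound:
  assumes "cs \<in> circuit_inputs n m Z" "i < n" "a \<le> 10 * X"
  shows "start i cs + a < 20 * X ^ 2"
proof -
  have "start i cs \<le> i * (2 + 3 * Z)" using start_le assms by simp
  also have "\<dots> \<le> X * (5 * X)" using assms(2) nX ZX X1 by (intro mult_le_mono) auto
  finally have "start i cs \<le> 5 * X ^ 2" by (simp add: power2_eq_square)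
  moreover have "X \<le> X ^ 2" by (simp add: power2_eq_square)
  then have "a \<le> 10 * X ^ 2" using assms(3) by linarith
  moreover have "1 \<le> X ^ 2" using X1 by simp
  ultimately show ?thesis by linarith
qed

definition field :: "nat \<Rightarrow> nat \<Rightarrow> circuit list \<Rightarrow> nat" where
  "field i a cs = stream cs (start i cs + a)"

lemma field_eq:
  assumes "cs \<in> circuit_inputs n m Z" "i < n" "a < 2 + 3 * length (fst (cs ! i)) + length (snd (cs ! i))"
  shows "field i a cs = encode_circuit (cs ! i) ! a"
  unfolding field_def using assms inputs_size[OF assms(1,2)] by (intro stream_start) (auto simp: length_encode_circuit)

lemma field_0: "cs \<in> circuit_inputs n m Z \<Longrightarrow> i < n \<Longrightarrow> field i 0 cs = length (fst (cs ! i))"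
  and field_1: "cs \<in> circuit_inputs n m Z \<Longrightarrow> i < n \<Longrightarrow> field i 1 cs = length (snd (cs ! i))"
  by (simp_all add: field_eq encode_circuit_nth[unfolded One_nat_def])

lemma field_gate:
  assumes "cs \<in> circuit_inputs n m Z" "i < n" "p < length (fst (cs ! i))" "r < 3"
  shows "field i (2 + 3 * p + r) cs = encode_gate (fst (cs ! i) ! p) ! r"
  using assms encode_circuit_nth(3)[of p "cs ! i" r] by (subst field_eq) auto

lemma polys_field:
  assumes "i < n" "a \<le> 10 * X" "start i \<in> F"
  shows "polys F 3 j {field i a}"
proof -
  have "polys F (0 + 1 + 1 + 1) j {\<lambda>cs. stream cs (start i cs + a)}"
    using address_bound assms by (intro polys_read polys_add polys_const polys_mem) auto
  then show ?thesis by (simp add: field_def[abs_def] numeral_3_eq_3)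
qed

text \<open>The position of a circuit depends on the sizes of all earlier ones, so it is computed
  from the two length fields of its predecessor: a circuit takes two header cells, three cells per
  gate and one per output digit.\<close>

lemma polys_start: "polys F 30 1 (\<Union>i<n. {start i})"
proof -
  have "polys F 30 (Suc 0) (\<Union>i<n. {start i})"
  proof (rule polys_chain[OF nX])
    fix i assume i: "i < n"
    let ?F = "F \<union> (\<Union>j<i. {start j})"
    show "polys ?F 30 0 {start i}"
    proof (cases i)
      case 0
      have "polys ?F 30 0 {\<lambda>_. 0}" by (rule polys_mono[OF polys_const[of 0 _ 0]]) auto
      then show ?thesis by (rule polys_cong) (simp add: 0 start_def)
    next
      case (Suc i')
      have S: "start i' \<in> ?F" using Suc by auto
      have f: "polys ?F 3 0 {field i' 0}" "polys ?F 3 0 {field i' 1}"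
        using i Suc S X1 by (auto intro!: polys_field)
      have "polys ?F (0 + (1 + (3 + 3 + 1 + 3 + 1) + 1 + 3 + 1) + 1) 0
          {\<lambda>cs. start i' cs + (2 + (field i' 0 cs + field i' 0 cs + field i' 0 cs) + field i' 1 cs)}"
        using S X1 by (intro polys_add polys_const polys_mem f) auto
      then have "polys ?F 30 0 {\<lambda>cs. start i' cs + (2 + (field i' 0 cs + field i' 0 cs + field i' 0 cs) + field i' 1 cs)}"
        by (rule polys_mono) auto
      then show ?thesis
      proof (rule polys_cong)
        fix cs assume cs: "cs \<in> circuit_inputs n m Z"
        have i': "i' < n" using i Suc by simp
        then show "start i' cs + (2 + (field i' 0 cs + field i' 0 cs + field i' 0 cs) + field i' 1 cs) = start i cs"
          using field_0[OF cs i'] field_1[OF cs i'] inputs_size(3)[OF cs i'] by (simp add: Suc start_Suc length_encode_circuit)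
      qed
    qed
  qed
  then show ?thesis by simp
qed

text \<open>The value 0 at positions that the circuit does not have allows the code to run through
  all \<open>Z\<close> positions for every input.\<close>

definition gate_val :: "nat \<Rightarrow> nat set \<Rightarrow> nat \<Rightarrow> circuit list \<Rightarrow> nat" where
  "gate_val i S p cs = (if p < length (fst (cs ! i)) then of_bool (circuit_bits S (fst (cs ! i)) ! p) else 0)"

text \<open>All four kinds of gates are evaluated, and the opcode selects one of the results.
  Arguments are looked up among the earlier gates only, where well-formed gates have them; an input
  gate compares its index with every item of \<open>S\<close>. The difference of the length field
  and \<open>p\<close> masks positions behind the last gate.\<close>

lemma polys_gate_step:
  assumes i: "i < n" and p: "p < Z" and S: "S \<subseteq> {..<m}" and F: "start i \<in> F" "\<And>q. q < p \<Longrightarrow> gate_val i S q \<in> F"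
  shows "polys F 200 1 {gate_val i S p}"
proof -
  let ?len = "field i 0" and ?t = "field i (2 + 3 * p + 0)" and ?a = "field i (2 + 3 * p + 1)" and ?b = "field i (2 + 3 * p + 2)"
  let ?A = "\<lambda>cs. if ?a cs < p then gate_val i S (?a cs) cs else 0"
  let ?B = "\<lambda>cs. if ?b cs < p then gate_val i S (?b cs) cs else 0"
  let ?I = "\<lambda>cs. \<Sum>j\<in>S. of_bool (?a cs = j) :: nat"
  let ?E = "\<lambda>cs. if ?len cs - p \<noteq> 0 then (if ?t cs \<noteq> 0 then (if ?t cs - 1 \<noteq> 0 then
        (if ?t cs - 2 \<noteq> 0 then (if ?A cs \<noteq> 0 then 1 else ?B cs) else (if ?A cs \<noteq> 0 then ?B cs else 0))
        else 1 - ?A cs) else ?I cs) else 0"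
  have pX: "2 + 3 * p + 2 \<le> 10 * X" "p \<le> 10 * X" "p \<le> X" "2 \<le> 10 * X" "1 \<le> 10 * X" using p ZX X1 by auto
  have fld: "polys F 3 j {field i a}" if "a \<le> 2 + 3 * p + 2" for a j
    using polys_field[OF i _ F(1)] that pX(1) by simp
  have Sfin: "finite S" "card S \<le> X" using S mX card_mono[OF _ S] finite_subset[OF S] by auto
  have sel: "polys F 18 1 {\<lambda>cs. if field i a cs < p then gate_val i S (field i a cs) cs else 0}"
    if "a \<le> 2 + 3 * p + 2" for a
    by (rule polys_mono[OF polys_select[OF pX(3) fld[OF that] F(2)]]) auto
  have AB: "polys F 18 1 {?A}" "polys F 18 1 {?B}" by (intro sel; simp)+
  have "polys F ((2 * 3 + 8) + 2) (Suc 0) {?I}"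
    using Sfin S mX by (intro polys_sum polys_eq_const fld) auto
  then have I: "polys F 16 1 {?I}" by (rule polys_mono) auto
  have "polys F ((3 + 1 + 1) + (3 + ((3 + 1 + 1) + ((3 + 1 + 1) + (18 + 1 + 18 + 1) + (18 + 18 + 1 + 1) + 1) + (1 + 18 + 1) + 1) + 16 + 1) + 1 + 1) 1 {?E}"
    using pX by (intro polys_ite polys_sub polys_const AB I fld) auto
  then have "polys F 200 1 {?E}" by (rule polys_mono) auto
  then show ?thesis
  proof (rule polys_cong)
    fix cs assume cs: "cs \<in> circuit_inputs n m Z"
    let ?gs = "fst (cs ! i)"
    show "?E cs = gate_val i S p cs"
    proof (cases "p < length ?gs")
      case True
      have wf: "gate_wf m p (?gs ! p)" using inputs_size(2)[OF cs i] True by (simp add: circuit_wf_def)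
      have g: "?t cs = encode_gate (?gs ! p) ! 0" "?a cs = encode_gate (?gs ! p) ! 1" "?b cs = encode_gate (?gs ! p) ! 2"
        by (intro field_gate[OF cs i True]; simp)+
      have bit: "gate_val i S p cs = of_bool (gate_bit S (circuit_bits S ?gs) (?gs ! p))"
        using True circuit_bits_nth[OF True wf] by (simp add: gate_val_def)
      have ev: "gate_val i S q cs = of_bool (circuit_bits S ?gs ! q)" if "q < p" for q
        using that True by (simp add: gate_val_def)
      have len: "?len cs - p \<noteq> 0" using True by (simp add: field_0[OF cs i])
      show ?thesis unfolding bit g using len wf Sfin
        by (cases "?gs ! p") (auto simp: ev of_bool_def sum.delta')
    next
      case False
      then show ?thesis by (simp add: field_0[OF cs i] gate_val_def)
    qed
  qed
qed

text \<open>The powers are obtained by doubling, because \<open>2 ^ l\<close> may exceed the bound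
  on constants.\<close>

lemma polys_powers: "polys F 3 1 (\<Union>l<Z. {\<lambda>_. 2 ^ l})"
proof -
  have "polys F 3 (Suc 0) (\<Union>l<Z. {\<lambda>_. 2 ^ l})"
  proof (rule polys_chain[OF ZX])
    fix l :: nat
    let ?F = "F \<union> (\<Union>l'<l. {\<lambda>_. 2 ^ l'})"
    show "polys ?F 3 0 {\<lambda>_. 2 ^ l}"
    proof (cases l)
      case 0
      then show ?thesis using polys_mono[OF polys_const[of 1 ?F 0], of ?F 3 0] X1 by simp
    next
      case (Suc l')
      have "polys ?F (0 + 0 + 1) 0 {\<lambda>_. 2 ^ l' + 2 ^ l'}" using Suc by (intro polys_add polys_mem) auto
      then have "polys ?F 3 0 {\<lambda>_. 2 ^ l' + 2 ^ l'}" by (rule polys_mono) auto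
      then show ?thesis by (rule polys_cong) (simp add: Suc)
    qed
  qed
  then show ?thesis by simp
qed

text \<open>The sum runs over \<open>Z\<close> potential output digits. Those beyond the actual
  number of outputs are masked; the position of a digit depends on the number of gates and is
  computed from the header.\<close>

lemma polys_circuit_value:
  assumes i: "i < n" and S: "S \<subseteq> {..<m}" and F: "start i \<in> F" "\<And>l. l < Z \<Longrightarrow> (\<lambda>_. 2 ^ l) \<in> F"
  shows "polys F 300 2 {circuit_value i S}"
proof -
  let ?G = "\<Union>p<Z. {gate_val i S p}"
  have gates: "polys F 200 (Suc 1) ?G"
    using i S F by (intro polys_chain[OF ZX] polys_gate_step) auto
  define ad where "ad l cs = start i cs + ((2 + (field i 0 cs + field i 0 cs + field i 0 cs)) + l)" for l cs
  define out where "out l = (\<lambda>cs. stream cs (ad l cs))" for l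
  let ?F = "F \<union> ?G"
  have st: "start i \<in> ?F" using F by simp
  have out0: "polys ?F (0 + (1 + (3 + 3 + 1 + 3 + 1) + 1 + 1 + 1) + 1 + 1) 0 {out l}" if l: "l < Z" for l
    unfolding out_def
  proof (rule polys_read)
    show "polys ?F (0 + (1 + (3 + 3 + 1 + 3 + 1) + 1 + 1 + 1) + 1) 0 {ad l}"
      unfolding ad_def[abs_def] using st X1 l ZX i by (intro polys_add polys_const polys_mem polys_field) auto
    fix cs assume cs: "cs \<in> circuit_inputs n m Z"
    have "length (fst (cs ! i)) \<le> X" using inputs_size(1)[OF cs i] ZX by simp
    then show "ad l cs < 20 * X ^ 2"
      unfolding ad_def using l ZX X1 field_0[OF cs i] by (intro address_bound[OF cs i]) simp
  qed
  have out: "polys ?F 20 0 {out l}" if "l < Z" for l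
    by (rule polys_mono[OF out0[OF that]]) auto
  have gv: "gate_val i S q \<in> ?F" if "q < Z" for q using that by auto
  have sel: "polys ?F 52 1 {\<lambda>cs. if out l cs < Z then gate_val i S (out l cs) cs else 0}" if "l < Z" for l
    by (rule polys_mono[OF polys_select[OF ZX out[OF that] gv]]) auto
  let ?E = "\<lambda>cs. \<Sum>l<Z. if field i 1 cs - l \<noteq> 0 then (if (if out l cs < Z then gate_val i S (out l cs) cs else 0) \<noteq> 0
        then 2 ^ l else 0) else 0"
  have "polys ?F (((3 + 1 + 1) + (52 + 0 + 1 + 1) + 1 + 1) + 2) (Suc 1) {?E}"
    using ZX X1 st i F(2)
    by (intro polys_sum polys_ite polys_sub polys_const sel polys_field polys_mem) auto
  then have "polys ?F 100 2 {?E}" by (rule polys_mono) auto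
  then have "polys ?F 100 2 {circuit_value i S}"
  proof (rule polys_cong)
    fix cs assume cs: "cs \<in> circuit_inputs n m Z"
    let ?L = "length (snd (cs ! i))"
    have L: "?L \<le> Z" using inputs_size(1)[OF cs i] by simp
    have "?E cs = (\<Sum>l<?L. if (if out l cs < Z then gate_val i S (out l cs) cs else 0) \<noteq> 0
        then 2 ^ l else (0::nat))"
      using L field_1[OF cs i] by (intro sum.mono_neutral_cong_right) auto
    also have "\<dots> = circuit_value i S cs"
      unfolding circuit_value_def
    proof (intro sum.cong refl)
      fix l assume l: "l \<in> {..<?L}"
      have "ad l cs = start i cs + (2 + 3 * length (fst (cs ! i)) + l)"
        unfolding ad_def field_0[OF cs i] by simp
      then have "out l cs = field i (2 + 3 * length (fst (cs ! i)) + l) cs" by (simp only: out_def field_def)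
      also have "\<dots> = snd (cs ! i) ! l" using l encode_circuit_nth(4)[of l "cs ! i"] by (subst field_eq[OF cs i]) auto
      finally have o': "out l cs = snd (cs ! i) ! l" .
      have "snd (cs ! i) ! l < length (fst (cs ! i))" using inputs_size(2)[OF cs i] l by (auto simp: circuit_wf_def)
      then show "(if (if out l cs < Z then gate_val i S (out l cs) cs else 0) \<noteq> 0 then 2 ^ l else (0::nat)) =
          (if circuit_bits S (fst (cs ! i)) ! (snd (cs ! i) ! l) then 2 ^ l else 0)"
        using inputs_size(1)[OF cs i] by (simp add: o' gate_val_def)
    qed
    finally show "?E cs = circuit_value i S cs" .
  qed
  then have "polys F (200 + 100) 2 (?G \<union> {circuit_value i S})"
    using gates by (intro polys_trans) (simp_all add: numeral_2_eq_2)
  then show ?thesis by (rule polys_mono) auto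
qed

end

section \<open>Optimal assignment of bundles\<close>

text \<open>An input-dependent object such as an allocation is not a number. Code handles it through
  the numeric functions of the input that result from applying the queries in \<open>Q\<close> to
  it.\<close>

definition obs :: "('d \<Rightarrow> 'w \<Rightarrow> nat) set \<Rightarrow> ('w \<Rightarrow> 'd) \<Rightarrow> ('w \<Rightarrow> nat) set" where
  "obs Q \<phi> = (\<lambda>q w. q (\<phi> w) w) ` Q"

definition owned :: "nat \<Rightarrow> (nat \<Rightarrow> nat) \<Rightarrow> nat \<Rightarrow> nat set" where
  "owned m ow i = {j. j < m \<and> ow j = i}"

definition value_sum :: "nat \<Rightarrow> (nat \<Rightarrow> nat set \<Rightarrow> 'w \<Rightarrow> nat) \<Rightarrow> nat \<Rightarrow> (nat \<Rightarrow> nat) \<Rightarrow> 'w \<Rightarrow> nat" where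
  "value_sum m val k ow w = (\<Sum>i<k. val i (owned m ow i) w)"

text \<open>The owners form the output, the sum is the score to be maximized, and the shares enter
  the payments. As the allocation depends on the input, the values of its shares have to be carried
  along with it.\<close>

definition observables :: "nat \<Rightarrow> (nat \<Rightarrow> nat set \<Rightarrow> 'w \<Rightarrow> nat) \<Rightarrow> nat \<Rightarrow> ((nat \<Rightarrow> nat) \<Rightarrow> 'w \<Rightarrow> nat) set" where
  "observables m val k = (\<lambda>j ow w. ow j) ` {..<m} \<union> (\<lambda>i ow w. val i (owned m ow i) w) ` {..<k} \<union> {value_sum m val k}"

lemma observables_card: "finite (observables m val k)" "card (observables m val k) \<le> m + k + 1"
proof -
  show "finite (observables m val k)" by (simp add: observables_def)
  have "card (observables m val k) \<le> card ((\<lambda>j (ow :: nat \<Rightarrow> nat) (w :: 'a). ow j) ` {..<m}) + card ((\<lambda>i ow w. val i (owned m ow i) w) ` {..<k}) + 1"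
    unfolding observables_def by (rule card_Un_le[THEN order_trans], rule add_mono[OF card_Un_le]) simp
  also have "\<dots> \<le> m + k + 1" by (intro add_mono order_refl card_image_le[THEN order_trans]) auto
  finally show "card (observables m val k) \<le> m + k + 1" .
qed

lemma obs_owner: "j < m \<Longrightarrow> (\<lambda>w. \<phi> w j) \<in> obs (observables m val k) \<phi>"
  unfolding obs_def by (rule image_eqI[where x = "\<lambda>ow w. ow j"]) (auto simp: observables_def)

lemma obs_share: "i < k \<Longrightarrow> (\<lambda>w. val i (owned m (\<phi> w) i) w) \<in> obs (observables m val k) \<phi>"
  unfolding obs_def by (rule image_eqI[where x = "\<lambda>ow w. val i (owned m ow i) w"]) (auto simp: observables_def)

lemma obs_sum: "(\<lambda>w. value_sum m val k (\<phi> w) w) \<in> obs (observables m val k) \<phi>"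
  unfolding obs_def by (rule image_eqI[where x = "value_sum m val k"]) (auto simp: observables_def)

section \<open>Selecting the best of several candidate allocations\<close>

context slp
begin

text \<open>The truncated difference of the scores is nonzero exactly if \<open>c2\<close> is
  strictly better. Applying this one test to every observable keeps them consistent with a single
  choice.\<close>

lemma merge_two:
  assumes "finite Q" "score \<in> Q" "obs Q c1 \<subseteq> F" "obs Q c2 \<subseteq> F"
  shows "\<exists>c. gets F (1 + card Q) (obs Q c) \<and> (\<forall>w. (c w = c1 w \<or> c w = c2 w) \<and>
     score (c1 w) w \<le> score (c w) w \<and> score (c2 w) w \<le> score (c w) w)"
proof -
  let ?d = "\<lambda>w. score (c2 w) w - score (c1 w) w"
  define c where "c = (\<lambda>w. if ?d w \<noteq> 0 then c2 w else c1 w)"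
  have d: "gets F 1 {?d}" using assms(2-4) by (intro gets_sub_step) (auto simp: obs_def)
  have "gets (F \<union> {?d}) (card Q * 1) (\<Union>q\<in>Q. {\<lambda>w. if ?d w \<noteq> 0 then q (c2 w) w else q (c1 w) w})"
    using assms(1,3,4) by (intro gets_UN gets_ite_step) (auto simp: obs_def)
  moreover have "(\<Union>q\<in>Q. {\<lambda>w. if ?d w \<noteq> 0 then q (c2 w) w else q (c1 w) w}) = obs Q c"
    by (auto simp: obs_def c_def if_distrib if_distribR cong: if_cong)
  ultimately have "gets (F \<union> {?d}) (card Q) (obs Q c)" by simp
  from gets_trans[OF d this] have "gets F (1 + card Q) (obs Q c)" by (rule gets_mono) auto
  then show ?thesis by (intro exI[of _ c]) (auto simp: c_def)
qed

lemma merge_candidates: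
  assumes "finite I" "I \<noteq> {}" "finite Q" "score \<in> Q" "\<And>i. i \<in> I \<Longrightarrow> obs Q (c i) \<subseteq> F"
  shows "\<exists>\<chi>. gets F (card I * (1 + card Q)) (obs Q \<chi>) \<and>
     (\<forall>w. (\<exists>i\<in>I. \<chi> w = c i w) \<and> (\<forall>i\<in>I. score (c i w) w \<le> score (\<chi> w) w))"
  using assms(1,2,5)
proof (induction rule: finite_ne_induct)
  case (singleton i)
  then show ?case by (intro exI[of _ "c i"]) (auto intro!: gets_mono[OF gets_self])
next
  case (insert i I)
  obtain \<chi> where \<chi>: "gets F (card I * (1 + card Q)) (obs Q \<chi>)"
     "\<And>w. (\<exists>i\<in>I. \<chi> w = c i w) \<and> (\<forall>i\<in>I. score (c i w) w \<le> score (\<chi> w) w)"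
    using insert.IH insert.prems by blast
  obtain \<chi>' where \<chi>': "gets (F \<union> obs Q \<chi>) (1 + card Q) (obs Q \<chi>')"
    "\<And>w. (\<chi>' w = \<chi> w \<or> \<chi>' w = c i w) \<and> score (\<chi> w) w \<le> score (\<chi>' w) w \<and> score (c i w) w \<le> score (\<chi>' w) w"
    using merge_two[OF assms(3,4), of \<chi> "F \<union> obs Q \<chi>" "c i"] insert.prems by blast
  have "gets F (card I * (1 + card Q) + (1 + card Q)) (obs Q \<chi> \<union> obs Q \<chi>')" by (rule gets_trans[OF \<chi>(1) \<chi>'(1)])
  then have "gets F (card (insert i I) * (1 + card Q)) (obs Q \<chi>')"
    using insert.hyps by (elim gets_mono) auto
  moreover have "(\<exists>i'\<in>insert i I. \<chi>' w = c i' w) \<and> (\<forall>i'\<in>insert i I. score (c i' w) w \<le> score (\<chi>' w) w)" for w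
    using \<chi>(2)[of w] \<chi>'(2)[of w] by (metis insert_iff order_trans)
  ultimately show ?case by blast
qed

end

text \<open>Bidders below \<open>k\<close> may receive bundles in \<open>U\<close>; all other bundles stay unallocated, which is
  encoded by the owner \<open>n\<close>.\<close>
definition feasible :: "nat \<Rightarrow> nat \<Rightarrow> nat set \<Rightarrow> (nat \<Rightarrow> nat) \<Rightarrow> bool" where
  "feasible n k U \<psi> \<longleftrightarrow> (\<forall>b. \<psi> b = n \<or> b \<in> U \<and> \<psi> b < k)"

definition block :: "nat \<Rightarrow> (nat \<Rightarrow> nat) \<Rightarrow> nat set \<Rightarrow> nat set" where
  "block m h T = {j. j < m \<and> h j \<in> T}"

text \<open>\<open>val\<close> is general because the VCG payments maximize over the same
  assignments with the valuation of one bidder replaced by 0.\<close>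

definition optimal_owner :: "nat \<Rightarrow> nat \<Rightarrow> nat \<Rightarrow> (nat \<Rightarrow> nat) set \<Rightarrow>
    (nat \<Rightarrow> nat set \<Rightarrow> 'w \<Rightarrow> nat) \<Rightarrow> 'w \<Rightarrow> (nat \<Rightarrow> nat) \<Rightarrow> bool" where
  "optimal_owner n m s H val w ow \<longleftrightarrow> (\<exists>h\<in>H. \<exists>\<psi>. (\<forall>b<s. \<psi> b \<le> n) \<and> ow = (\<lambda>j. \<psi> (h j))) \<and>
     (\<forall>h\<in>H. \<forall>\<psi>. (\<forall>b<s. \<psi> b \<le> n) \<longrightarrow> value_sum m val n (\<lambda>j. \<psi> (h j)) w \<le> value_sum m val n ow w)"

section \<open>Dynamic programming over bidders and sets of bundles\<close>

locale subset_dp = slp inp \<Omega> X for inp :: "'w \<Rightarrow> nat \<Rightarrow> nat" and \<Omega> X +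
  fixes n m s :: nat and h :: "nat \<Rightarrow> nat" and val :: "nat \<Rightarrow> nat set \<Rightarrow> 'w \<Rightarrow> nat" and F :: "('w \<Rightarrow> nat) set"
  assumes nX: "n \<le> X" and mX: "m \<le> X" and sX: "2 ^ s \<le> X"
    and F_const: "\<And>i. i \<le> n \<Longrightarrow> (\<lambda>_. i) \<in> F"
    and F_val: "\<And>i T. i < n \<Longrightarrow> T \<subseteq> {..<s} \<Longrightarrow> val i (block m h T) \<in> F"
begin

definition optimal_partial :: "nat \<Rightarrow> nat set \<Rightarrow> 'w \<Rightarrow> (nat \<Rightarrow> nat) \<Rightarrow> bool" where
  "optimal_partial k U w ow \<longleftrightarrow> (\<exists>\<psi>. feasible n k U \<psi> \<and> ow = (\<lambda>j. \<psi> (h j))) \<and>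
     (\<forall>\<psi>. feasible n k U \<psi> \<longrightarrow> value_sum m val k (\<lambda>j. \<psi> (h j)) w \<le> value_sum m val k ow w)"

text \<open>The optimum for the bidders below \<open>k + 1\<close> and the bundles in \<open>U\<close> arises by giving some \<open>T \<subseteq> U\<close> to
  bidder \<open>k\<close> and the optimum for \<open>U - T\<close> to the other ones.\<close>
lemma extend_assignment:
  assumes k: "k < n" and \<psi>: "feasible n k (U - T) \<psi>" and T: "T \<subseteq> U"
  defines "ow \<equiv> \<lambda>j. \<psi> (h j)" and "ow' \<equiv> \<lambda>j. if h j \<in> T then k else \<psi> (h j)"
  shows "feasible n (Suc k) U (\<lambda>b. if b \<in> T then k else \<psi> b)"
    and "\<And>i. i < k \<Longrightarrow> owned m ow' i = owned m ow i" and "owned m ow' k = block m h T"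
    and "value_sum m val (Suc k) ow' w = value_sum m val k ow w + val k (block m h T) w"
proof -
  have f: "\<psi> b = n \<or> b \<in> U \<and> b \<notin> T \<and> \<psi> b < k" for b using \<psi> by (auto simp: feasible_def)
  show "feasible n (Suc k) U (\<lambda>b. if b \<in> T then k else \<psi> b)"
    unfolding feasible_def
  proof
    fix b show "(if b \<in> T then k else \<psi> b) = n \<or> b \<in> U \<and> (if b \<in> T then k else \<psi> b) < Suc k"
      using f[of b] T by auto
  qed
  have T_n: "\<psi> b = n" if "b \<in> T" for b using f[of b] that by auto
  show own: "owned m ow' i = owned m ow i" if "i < k" for i
  proof -
    have "ow' j = i \<longleftrightarrow> ow j = i" for j using T_n[of "h j"] k that by (auto simp: ow_def ow'_def)
    then show ?thesis by (simp add: owned_def)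
  qed
  have not_k: "\<psi> b \<noteq> k" for b using f[of b] k by auto
  show ownk: "owned m ow' k = block m h T"
  proof -
    have "ow' j = k \<longleftrightarrow> h j \<in> T" for j using not_k by (simp add: ow'_def)
    then show ?thesis by (simp add: owned_def block_def)
  qed
  show "value_sum m val (Suc k) ow' w = value_sum m val k ow w + val k (block m h T) w"
    unfolding value_sum_def by (simp add: own ownk)
qed

text \<open>Almost all observables of a candidate \<open>c T\<close> are present already: the owner
  of an item is the constant \<open>k\<close> or an old owner, the shares of earlier bidders are
  unchanged, and the share of \<open>k\<close> is a tabulated value. Only the totals take one
  addition each, before the candidates for all \<open>T \<subseteq> U\<close> are merged.\<close>

lemma stage_step:
  assumes k: "k < n" and \<phi>: "\<And>U w. U \<subseteq> {..<s} \<Longrightarrow> optimal_partial k U w (\<phi> U w)" and U: "U \<subseteq> {..<s}"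
    and G: "F \<subseteq> G" "\<And>U. U \<subseteq> {..<s} \<Longrightarrow> obs (observables m val k) (\<phi> U) \<subseteq> G"
  shows "\<exists>\<chi>. gets G (5 * X ^ 2) (obs (observables m val (Suc k)) \<chi>) \<and> (\<forall>w. optimal_partial (Suc k) U w (\<chi> w))"
proof -
  define c where "c T w = (\<lambda>j. if h j \<in> T then k else \<phi> (U - T) w j)" for T w
  let ?Q = "observables m val (Suc k)"
  let ?sum = "\<lambda>T w. value_sum m val k (\<phi> (U - T) w) w + val k (block m h T) w"
  have old: "\<exists>\<psi>. feasible n k (U - T) \<psi> \<and> \<phi> (U - T) w = (\<lambda>j. \<psi> (h j))" for T w
    using \<phi>[of "U - T" w] U unfolding optimal_partial_def by blast
  have c_owned: "owned m (c T w) i = owned m (\<phi> (U - T) w) i" if "i < k" "T \<subseteq> U" for T w i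
  proof -
    obtain \<psi> where \<psi>: "feasible n k (U - T) \<psi>" "\<phi> (U - T) w = (\<lambda>j. \<psi> (h j))" using old by blast
    show ?thesis unfolding c_def \<psi>(2) by (rule extend_assignment(2)[OF k \<psi>(1) that(2,1)])
  qed
  have c_owned_k: "owned m (c T w) k = block m h T" if "T \<subseteq> U" for T w
  proof -
    obtain \<psi> where \<psi>: "feasible n k (U - T) \<psi>" "\<phi> (U - T) w = (\<lambda>j. \<psi> (h j))" using old by blast
    show ?thesis unfolding c_def \<psi>(2) by (rule extend_assignment(3)[OF k \<psi>(1) that])
  qed
  have c_sum: "value_sum m val (Suc k) (c T w) w = ?sum T w" if "T \<subseteq> U" for T w
  proof -
    obtain \<psi> where \<psi>: "feasible n k (U - T) \<psi>" "\<phi> (U - T) w = (\<lambda>j. \<psi> (h j))" using old by blast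
    show ?thesis unfolding c_def \<psi>(2) by (rule extend_assignment(4)[OF k \<psi>(1) that])
  qed
  have U_fin: "finite U" using U finite_subset by blast
  have cardU: "card (Pow U) \<le> X"
    using sX card_mono[OF _ U] by (auto simp: card_Pow U_fin intro: order_trans[OF power_increasing])
  let ?S = "\<Union>T\<in>Pow U. {?sum T}"
  have S: "gets G (card (Pow U) * 1) ?S"
  proof (intro gets_UN gets_add_step)
    fix T assume T: "T \<in> Pow U"
    show "(\<lambda>w. value_sum m val k (\<phi> (U - T) w) w) \<in> G" using G(2)[of "U - T"] U obs_sum by blast
    show "val k (block m h T) \<in> G" using F_val[OF k] T U G(1) by blast
  qed (use U_fin in auto)
  have obs_c: "obs ?Q (c T) \<subseteq> G \<union> ?S" if T: "T \<in> Pow U" for T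
  proof
    fix f assume "f \<in> obs ?Q (c T)"
    then consider j where "j < m" "f = (\<lambda>w. c T w j)" | i where "i < Suc k" "f = (\<lambda>w. val i (owned m (c T w) i) w)"
      | "f = (\<lambda>w. value_sum m val (Suc k) (c T w) w)" unfolding obs_def observables_def by blast
    then show "f \<in> G \<union> ?S"
    proof cases
      case 1
      have "(\<lambda>w. \<phi> (U - T) w j) \<in> obs (observables m val k) (\<phi> (U - T))"
        using 1 by (intro obs_owner)
      then have "(\<lambda>w. \<phi> (U - T) w j) \<in> G" using G(2)[of "U - T"] U by auto
      moreover have "(\<lambda>_. k) \<in> G" using F_const[of k] k G(1) by auto
      ultimately show ?thesis using 1 by (cases "h j \<in> T") (simp_all add: c_def)
    next
      case 2
      show ?thesis
      proof (cases "i = k")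
        case True
        then have "f = val k (block m h T)" using 2 c_owned_k T by auto
        then show ?thesis using F_val[OF k] T U G(1) by blast
      next
        case False
        then have f: "f = (\<lambda>w. val i (owned m (\<phi> (U - T) w) i) w)" and ik: "i < k" using 2 c_owned T by auto
        have "f \<in> obs (observables m val k) (\<phi> (U - T))"
          unfolding f using ik by (rule obs_share)
        then show ?thesis using G(2)[of "U - T"] U by auto
      qed
    next
      case 3
      then have "f = ?sum T" using c_sum T by auto
      then show ?thesis using T by blast
    qed
  qed
  have Qs: "value_sum m val (Suc k) \<in> ?Q" by (simp add: observables_def)
  obtain \<chi> where \<chi>: "gets (G \<union> ?S) (card (Pow U) * (1 + card ?Q)) (obs ?Q \<chi>)"
    "\<And>w. (\<exists>T\<in>Pow U. \<chi> w = c T w) \<and> (\<forall>T\<in>Pow U. value_sum m val (Suc k) (c T w) w \<le> value_sum m val (Suc k) (\<chi> w) w)"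
    using merge_candidates[of "Pow U" ?Q "value_sum m val (Suc k)" c "G \<union> ?S"] U_fin observables_card(1) Qs obs_c
    by (metis (no_types, lifting) Pow_not_empty finite_Pow_iff)
  have "gets G (5 * X ^ 2) (obs ?Q \<chi>)"
  proof (rule gets_mono[OF gets_trans[OF S \<chi>(1)]])
    have "1 + card ?Q \<le> 4 * X" using observables_card(2)[of m val "Suc k"] k nX mX X by linarith
    then have "card (Pow U) * 1 + card (Pow U) * (1 + card ?Q) \<le> X * X + X * (4 * X)"
      using cardU X by (intro add_mono mult_le_mono) auto
    then show "card (Pow U) * 1 + card (Pow U) * (1 + card ?Q) \<le> 5 * X ^ 2" by (simp add: power2_eq_square)
  qed auto
  moreover have "\<exists>\<psi>. feasible n (Suc k) U \<psi> \<and> \<chi> w = (\<lambda>j. \<psi> (h j))" for w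
  proof -
    obtain T where T: "T \<subseteq> U" "\<chi> w = c T w" using \<chi>(2)[of w] by auto
    obtain \<psi> where \<psi>: "feasible n k (U - T) \<psi>" "\<phi> (U - T) w = (\<lambda>j. \<psi> (h j))" using old by blast
    have "feasible n (Suc k) U (\<lambda>b. if b \<in> T then k else \<psi> b)" by (rule extend_assignment(1)[OF k \<psi>(1) T(1)])
    moreover have "\<chi> w = (\<lambda>j. (\<lambda>b. if b \<in> T then k else \<psi> b) (h j))" unfolding T(2) c_def \<psi>(2) ..
    ultimately show ?thesis by blast
  qed
  moreover have "value_sum m val (Suc k) (\<lambda>j. \<psi> (h j)) w \<le> value_sum m val (Suc k) (\<chi> w) w"
    if \<psi>: "feasible n (Suc k) U \<psi>" for \<psi> w
  proof -
    \<comment> \<open>Conversely, any competing assignment splits into the bundles of bidder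
      \<open>k\<close> and an assignment of the others in which these bundles are
      unallocated.\<close>
    define T where "T = {b\<in>U. \<psi> b = k}"
    define \<psi>' where "\<psi>' b = (if b \<in> T then n else \<psi> b)" for b
    have TU: "T \<subseteq> U" by (auto simp: T_def)
    have f': "feasible n k (U - T) \<psi>'"
      unfolding feasible_def
    proof
      fix b show "\<psi>' b = n \<or> b \<in> U - T \<and> \<psi>' b < k"
        using \<psi> unfolding feasible_def by (cases "\<psi> b = n") (auto simp: \<psi>'_def T_def less_Suc_eq dest!: spec[of _ b])
    qed
    have eq: "(\<lambda>j. \<psi> (h j)) = (\<lambda>j. if h j \<in> T then k else \<psi>' (h j))" by (auto simp: \<psi>'_def T_def)
    have "value_sum m val (Suc k) (\<lambda>j. \<psi> (h j)) w = value_sum m val k (\<lambda>j. \<psi>' (h j)) w + val k (block m h T) w"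
      unfolding eq by (rule extend_assignment(4)[OF k f' TU])
    also have "\<dots> \<le> ?sum T w"
      using \<phi>[of "U - T" w] f' U unfolding optimal_partial_def by (intro add_le_mono1) blast
    also have "\<dots> = value_sum m val (Suc k) (c T w) w" using c_sum[OF TU] by simp
    also have "\<dots> \<le> value_sum m val (Suc k) (\<chi> w) w" using \<chi>(2)[of w] TU by auto
    finally show ?thesis .
  qed
  ultimately show ?thesis unfolding optimal_partial_def by blast
qed

lemma stages:
  assumes "k \<le> n"
  shows "\<exists>\<phi>. gets F (k * (5 * X ^ 3)) (\<Union>U\<in>Pow {..<s}. obs (observables m val k) (\<phi> U)) \<and>
    (\<forall>U\<subseteq>{..<s}. \<forall>w. optimal_partial k U w (\<phi> U w))"
  using assms
proof (induction k)
  case 0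
  \<comment> \<open>Without bidders, every item has the owner \<open>n\<close> and the total is 0,
    so all observables are constants in \<open>F\<close>.\<close>
  have "value_sum m val 0 = (\<lambda>_ _. 0)" by (simp add: value_sum_def fun_eq_iff)
  then have "obs (observables m val 0) (\<lambda>w j. n) \<subseteq> F"
    using F_const by (auto simp: obs_def observables_def)
  moreover have "optimal_partial 0 U w (\<lambda>j. n)" for U w
    by (auto simp: optimal_partial_def feasible_def value_sum_def intro: exI[of _ "\<lambda>_. n"])
  ultimately show ?case by (intro exI[of _ "\<lambda>U w j. n"]) (auto intro: gets_self)
next
  case (Suc k)
  then obtain \<phi> where \<phi>: "gets F (k * (5 * X ^ 3)) (\<Union>U\<in>Pow {..<s}. obs (observables m val k) (\<phi> U))"
      "\<And>U w. U \<subseteq> {..<s} \<Longrightarrow> optimal_partial k U w (\<phi> U w)"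
    by auto
  let ?G = "F \<union> (\<Union>U\<in>Pow {..<s}. obs (observables m val k) (\<phi> U))"
  have "\<exists>\<chi>. gets ?G (5 * X ^ 2) (obs (observables m val (Suc k)) \<chi>) \<and> (\<forall>w. optimal_partial (Suc k) U w (\<chi> w))"
    if "U \<subseteq> {..<s}" for U
    using Suc.prems \<phi>(2) that by (intro stage_step) auto
  then obtain \<phi>' where \<phi>': "\<And>U. U \<subseteq> {..<s} \<Longrightarrow> gets ?G (5 * X ^ 2) (obs (observables m val (Suc k)) (\<phi>' U)) \<and>
      (\<forall>w. optimal_partial (Suc k) U w (\<phi>' U w))" by metis
  have "gets ?G (card (Pow {..<s}) * (5 * X ^ 2)) (\<Union>U\<in>Pow {..<s}. obs (observables m val (Suc k)) (\<phi>' U))"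
    using \<phi>' by (intro gets_UN) auto
  from gets_trans[OF \<phi>(1) this]
  have "gets F (Suc k * (5 * X ^ 3)) (\<Union>U\<in>Pow {..<s}. obs (observables m val (Suc k)) (\<phi>' U))"
  proof (rule gets_mono)
    have "card (Pow {..<s}) * (5 * X ^ 2) \<le> X * (5 * X ^ 2)" using sX by (intro mult_le_mono1) (simp add: card_Pow)
    then show "k * (5 * X ^ 3) + card (Pow {..<s}) * (5 * X ^ 2) \<le> Suc k * (5 * X ^ 3)"
      by (simp add: power3_eq_cube power2_eq_square)
  qed auto
  then show ?case using \<phi>' by blast
qed

lemma optimal_for_partition:
  assumes h: "\<And>j. j < m \<Longrightarrow> h j < s"
  shows "\<exists>\<chi>. gets F (5 * X ^ 4) (obs (observables m val n) \<chi>) \<and> (\<forall>w. optimal_owner n m s {h} val w (\<chi> w))"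
proof -
  obtain \<phi> where \<phi>: "gets F (n * (5 * X ^ 3)) (\<Union>U\<in>Pow {..<s}. obs (observables m val n) (\<phi> U))"
      "\<And>w. optimal_partial n {..<s} w (\<phi> {..<s} w)"
    using stages[of n] by blast
  have le: "n * (5 * X ^ 3) \<le> 5 * X ^ 4" using nX by (simp add: power_numeral_reduce mult_le_mono1)
  have "\<exists>\<psi>. (\<forall>b<s. \<psi> b \<le> n) \<and> \<phi> {..<s} w = (\<lambda>j. \<psi> (h j))" for w
    using \<phi>(2)[of w] unfolding optimal_partial_def feasible_def by (metis less_imp_le_nat order_refl)
  moreover have "value_sum m val n (\<lambda>j. \<psi> (h j)) w \<le> value_sum m val n (\<phi> {..<s} w) w" if \<psi>: "\<forall>b<s. \<psi> b \<le> n" for \<psi> w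
  proof -
    \<comment> \<open>Feasibility restricts the assignment on all natural numbers, so it is reset to
      unallocated from \<open>s\<close> on, where \<open>h\<close> has no values.\<close>
    define \<psi>' where "\<psi>' b = (if b < s then \<psi> b else n)" for b
    have "feasible n n {..<s} \<psi>'" using \<psi> by (auto simp: feasible_def \<psi>'_def le_less)
    then have "value_sum m val n (\<lambda>j. \<psi>' (h j)) w \<le> value_sum m val n (\<phi> {..<s} w) w"
      using \<phi>(2)[of w] by (simp add: optimal_partial_def)
    moreover have "owned m (\<lambda>j. \<psi>' (h j)) i = owned m (\<lambda>j. \<psi> (h j)) i" for i using h by (auto simp: owned_def \<psi>'_def)
    ultimately show ?thesis by (simp add: value_sum_def)
  qed
  moreover have "gets F (5 * X ^ 4) (obs (observables m val n) (\<phi> {..<s}))"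
    using le by (intro gets_mono[OF \<phi>(1)]) auto
  ultimately show ?thesis unfolding optimal_owner_def by (intro exI[of _ "\<phi> {..<s}"]) simp
qed

end

lemma (in slp) optimal_for_family:
  assumes nX: "n \<le> X" and mX: "m \<le> X" and sX: "2 ^ s \<le> X" and H: "finite H" "H \<noteq> {}" "card H \<le> X"
    and h: "\<And>h j. h \<in> H \<Longrightarrow> j < m \<Longrightarrow> h j < s"
    and F: "\<And>i. i \<le> n \<Longrightarrow> (\<lambda>_. i) \<in> F" "\<And>h i T. h \<in> H \<Longrightarrow> i < n \<Longrightarrow> T \<subseteq> {..<s} \<Longrightarrow> val i (block m h T) \<in> F"
  shows "\<exists>\<chi>. polys F 10 5 (obs (observables m val n) \<chi>) \<and> (\<forall>w. optimal_owner n m s H val w (\<chi> w))"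
proof -
  let ?Q = "observables m val n"
  have "\<exists>\<chi>. gets F (5 * X ^ 4) (obs ?Q \<chi>) \<and> (\<forall>w. optimal_owner n m s {h} val w (\<chi> w))" if hH: "h \<in> H" for h
  proof -
    interpret subset_dp inp \<Omega> X n m s h val F
      using nX mX sX F hH by unfold_locales auto
    show ?thesis using optimal_for_partition h[OF hH] by blast
  qed
  then obtain c where c: "\<And>h. h \<in> H \<Longrightarrow> gets F (5 * X ^ 4) (obs ?Q (c h)) \<and> (\<forall>w. optimal_owner n m s {h} val w (c h w))"
    by metis
  have step1: "gets F (card H * (5 * X ^ 4)) (\<Union>h\<in>H. obs ?Q (c h))" using H c by (intro gets_UN) auto
  have Qs: "value_sum m val n \<in> ?Q" by (simp add: observables_def)
  obtain \<chi> where \<chi>: "gets (F \<union> (\<Union>h\<in>H. obs ?Q (c h))) (card H * (1 + card ?Q)) (obs ?Q \<chi>)"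
    "\<And>w. (\<exists>h\<in>H. \<chi> w = c h w) \<and> (\<forall>h\<in>H. value_sum m val n (c h w) w \<le> value_sum m val n (\<chi> w) w)"
    using merge_candidates[OF H(1,2) observables_card(1) Qs, of c "F \<union> (\<Union>h\<in>H. obs ?Q (c h))"] by blast
  have "polys F 10 5 (obs ?Q \<chi>)"
  proof (rule polys_bound[OF gets_mono[OF gets_trans[OF step1 \<chi>(1)]]])
    have "1 + card ?Q \<le> 4 * X" using observables_card(2)[of m val n] nX mX X by linarith
    then have "card H * (5 * X ^ 4) + card H * (1 + card ?Q) \<le> X * (5 * X ^ 4) + X * (4 * X)"
      using H(3) by (intro add_mono mult_le_mono) auto
    also have "\<dots> = 5 * X ^ 5 + 4 * X ^ 2" by (simp add: power_numeral_reduce)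
    also have "\<dots> \<le> 10 * X ^ 5" using power_increasing[of 2 5 X] X by simp
    finally show "card H * (5 * X ^ 4) + card H * (1 + card ?Q) \<le> 10 * X ^ 5" .
  qed auto
  moreover have "optimal_owner n m s H val w (\<chi> w)" for w
  proof -
    obtain h where h: "h \<in> H" "\<chi> w = c h w" using \<chi>(2)[of w] by blast
    have "optimal_owner n m s {h} val w (c h w)" using c[OF h(1)] by blast
    then have "\<exists>h'\<in>{h}. \<exists>\<psi>. (\<forall>b<s. \<psi> b \<le> n) \<and> c h w = (\<lambda>j. \<psi> (h' j))"
      unfolding optimal_owner_def by (rule conjunct1)
    then have "\<exists>\<psi>. (\<forall>b<s. \<psi> b \<le> n) \<and> \<chi> w = (\<lambda>j. \<psi> (h j))" unfolding h(2) by (simp only: bex_simps simp_thms)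
    then have "\<exists>h\<in>H. \<exists>\<psi>. (\<forall>b<s. \<psi> b \<le> n) \<and> \<chi> w = (\<lambda>j. \<psi> (h j))" using h(1) by (rule bexI)
    moreover have "value_sum m val n (\<lambda>j. \<psi> (h j)) w \<le> value_sum m val n (\<chi> w) w"
      if "h \<in> H" "\<forall>b<s. \<psi> b \<le> n" for h \<psi>
    proof -
      have "value_sum m val n (\<lambda>j. \<psi> (h j)) w \<le> value_sum m val n (c h w) w"
        using c[OF that(1)] that(2) unfolding optimal_owner_def by simp
      also have "\<dots> \<le> value_sum m val n (\<chi> w) w" using \<chi>(2)[of w] that(1) by blast
      finally show ?thesis .
    qed
    ultimately show ?thesis unfolding optimal_owner_def by blast
  qed
  ultimately show ?thesis by blast
qed

section \<open>The interpreter\<close>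

fun seqs :: "program list \<Rightarrow> program" where
  "seqs [] = Const 16 0"
| "seqs [P] = P"
| "seqs (P # Q # Ps) = Seq P (seqs (Q # Ps))"

primrec loop_free :: "program \<Rightarrow> bool" where
  "loop_free (Const x a) = True"
| "loop_free (Add x y z) = True"
| "loop_free (Sub x y z) = True"
| "loop_free (Load x y) = True"
| "loop_free (Store x y) = True"
| "loop_free (Seq P Q) = (loop_free P \<and> loop_free Q)"
| "loop_free (If_Nonzero x P Q) = (loop_free P \<and> loop_free Q)"
| "loop_free (While_Nonzero x P) = False"

text \<open>A functional semantics for programs without loops, which turns their execution into
  simplification. Only the two loops of the interpreter then need an invariant.\<close>

primrec result :: "program \<Rightarrow> state \<Rightarrow> state" where
  "result (Const x a) s = ((fst s)(x := a), snd s)"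
| "result (Add x y z) s = ((fst s)(x := fst s y + fst s z), snd s)"
| "result (Sub x y z) s = ((fst s)(x := fst s y - fst s z), snd s)"
| "result (Load x y) s = ((fst s)(x := snd s (fst s y)), snd s)"
| "result (Store x y) s = (fst s, (snd s)(fst s x := fst s y))"
| "result (Seq P Q) s = result Q (result P s)"
| "result (If_Nonzero x P Q) s = (if fst s x \<noteq> 0 then result P s else result Q s)"
| "result (While_Nonzero x P) s = s"

primrec steps :: "program \<Rightarrow> nat" where
  "steps (Const x a) = 1"
| "steps (Add x y z) = 1"
| "steps (Sub x y z) = 1"
| "steps (Load x y) = 1"
| "steps (Store x y) = 1"
| "steps (Seq P Q) = steps P + steps Q"
| "steps (If_Nonzero x P Q) = 1 + steps P + steps Q"
| "steps (While_Nonzero x P) = 0"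

lemma exec_loop_free: "loop_free P \<Longrightarrow> \<exists>t\<le>steps P. exec P s t (result P s)"
proof (induction P arbitrary: s)
  case (Seq P Q)
  obtain t where t: "t \<le> steps P" "exec P s t (result P s)" using Seq by fastforce
  obtain t' where "t' \<le> steps Q" "exec Q (result P s) t' (result Q (result P s))" using Seq by fastforce
  then show ?case using exec.Seq[OF t(2)] t(1) by (intro exI[of _ "t + t'"]) auto
next
  case (If_Nonzero x P Q)
  obtain t where t: "t \<le> steps P" "exec P s t (result P s)" using If_Nonzero by fastforce
  obtain t' where t': "t' \<le> steps Q" "exec Q s t' (result Q s)" using If_Nonzero by fastforce
  show ?case
  proof (cases "fst s x = 0")
    case True
    then show ?thesis using exec.If_False[OF True t'(2)] t' by (intro exI[of _ "Suc t'"]) auto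
  next
    case False
    then show ?thesis using exec.If_True[OF False t(2)] t by (intro exI[of _ "Suc t"]) auto
  qed
next
  case (Const x a)
  then show ?case by (cases s) (use exec.Const in \<open>auto intro!: exI[of _ 1]\<close>)
next
  case (Add x y z)
  then show ?case by (cases s) (use exec.Add in \<open>auto intro!: exI[of _ 1]\<close>)
next
  case (Sub x y z)
  then show ?case by (cases s) (use exec.Sub in \<open>auto intro!: exI[of _ 1]\<close>)
next
  case (Load x y)
  then show ?case by (cases s) (use exec.Load in \<open>auto intro!: exI[of _ 1]\<close>)
next
  case (Store x y)
  then show ?case by (cases s) (use exec.Store in \<open>auto intro!: exI[of _ 1]\<close>)
qed simp

text \<open>The loop register counts the remaining rounds, so the invariant alone decides when the
  loop ends. Each round costs one extra step for the test, as does the final exit.\<close>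

lemma exec_while_invariant:
  assumes "\<And>q s. q < N \<Longrightarrow> I q s \<Longrightarrow> \<exists>t s'. exec P s t s' \<and> t \<le> b \<and> I (Suc q) s'"
    and "\<And>q s. I q s \<Longrightarrow> q \<le> N \<Longrightarrow> fst s x = N - q" and "I q s" "q \<le> N"
  shows "\<exists>t s'. exec (While_Nonzero x P) s t s' \<and> t \<le> (N - q) * (b + 1) + 1 \<and> I N s'"
  using assms(3,4)
proof (induction "N - q" arbitrary: q s)
  case 0
  then have "q = N" "fst s x = 0" using assms(2)[of q s] by auto
  then show ?case using 0 exec.While_False[of s x P] by (intro exI[of _ 1] exI[of _ s]) auto
next
  case (Suc d)
  then have q: "q < N" and x: "fst s x \<noteq> 0" using assms(2)[of q s] by auto
  obtain t s' where t: "exec P s t s'" "t \<le> b" "I (Suc q) s'" using assms(1)[OF q] Suc.prems by blast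
  have "d = N - Suc q" "Suc q \<le> N" using Suc.hyps(2) q by auto
  from Suc.hyps(1)[OF this(1) t(3) this(2)]
  obtain t' s'' where t': "exec (While_Nonzero x P) s' t' s''" "t' \<le> (N - Suc q) * (b + 1) + 1" "I N s''" by blast
  have "exec (While_Nonzero x P) s (Suc (t + t')) s''" by (rule exec.While_True[OF x t(1) t'(1)])
  moreover have "Suc (t + t') \<le> (N - q) * (b + 1) + 1"
  proof -
    have "N - q = Suc (N - Suc q)" using q by simp
    then show ?thesis using t(2) t'(2) by simp
  qed
  ultimately show ?case using t'(3) by blast
qed

section \<open>The interpreter and its memory layout\<close>

text \<open>Padding to four cells lets the instruction pointer advance by a constant without regard
  to the opcode.\<close>

primrec encode_instr :: "instr \<Rightarrow> nat list" where
  "encode_instr (IConst c) = [0, c, 0, 0]"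
| "encode_instr (IAdd a b) = [1, a, b, 0]"
| "encode_instr (ISub a b) = [2, a, b, 0]"
| "encode_instr (IRead a) = [3, a, 0, 0]"
| "encode_instr (IIte a b c) = [4, a, b, c]"

text \<open>Register 0 holds the constant 1, register 1 the address of the next instruction, register 2 the base address
  \<open>W\<close> of the results, register 3 the address of the next result, register 4 the start of the circuits, register 5 the
  number of remaining instructions, register 14 the number of remaining outputs and register 15
  the address of the next output.\<close>
definition interpreter_init :: program where
  "interpreter_init = seqs [Const 0 1, Const 6 2, Load 4 6, Const 6 3, Add 4 4 6, Load 2 6, Const 6 4, Load 5 6,
     Const 1 5, Const 3 0, Add 3 3 2, Const 6 0, Load 14 6, Load 7 0, Add 14 14 7, Const 15 0]"

text \<open>All three operands are dereferenced relative to the base of the results before the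
  opcode is examined; this is harmless, as every memory cell can be read.\<close>

definition interpreter_fetch :: program where
  "interpreter_fetch = seqs [Load 6 1, Add 1 1 0, Load 7 1, Add 1 1 0, Load 8 1, Add 1 1 0, Load 9 1, Add 1 1 0,
     Add 10 7 2, Load 10 10, Add 11 8 2, Load 11 11, Add 12 9 2, Load 12 12]"

text \<open>The opcode is decoded by testing and decrementing register 6. As there is no move
  instruction, copying means adding to 0.\<close>

definition interpreter_compute :: program where
  "interpreter_compute =
     If_Nonzero 6 (Seq (Sub 6 6 0)
       (If_Nonzero 6 (Seq (Sub 6 6 0)
         (If_Nonzero 6 (Seq (Sub 6 6 0)
           (If_Nonzero 6
             (If_Nonzero 10 (Seq (Const 13 0) (Add 13 13 11)) (Seq (Const 13 0) (Add 13 13 12)))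
             (Seq (Add 13 10 4) (Load 13 13))))
           (Sub 13 10 11)))
         (Add 13 10 11)))
       (Seq (Const 13 0) (Add 13 13 7))"

definition interpreter_store :: program where
  "interpreter_store = seqs [Store 3 13, Add 3 3 0, Sub 5 5 0]"

definition interpreter_body :: program where
  "interpreter_body = Seq interpreter_fetch (Seq interpreter_compute interpreter_store)"

text \<open>The outputs overwrite the advice from the front, but the pointer to output \<open>j\<close> is stored beyond cell \<open>j\<close> and thus
  read in time.\<close>
definition interpreter_output :: program where
  "interpreter_output = seqs [Load 7 1, Add 1 1 0, Add 7 7 2, Load 7 7, Store 15 7, Add 15 15 0, Sub 14 14 0]"

definition interpreter :: program where
  "interpreter = Seq interpreter_init (Seq (While_Nonzero 5 interpreter_body) (While_Nonzero 14 interpreter_output))"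

definition code_advice :: "nat \<Rightarrow> instr list \<Rightarrow> nat list \<Rightarrow> nat list" where
  "code_advice W code outs = [W, length code] @ concat (map encode_instr code) @ outs"

lemma length_encode_instr [simp]: "length (encode_instr i) = 4"
  by (cases i) auto

lemma length_concat_encode_instr [simp]: "length (concat (map encode_instr code)) = 4 * length code"
  by (induction code) auto

lemma nth_concat_encode_instr:
  "p < length code \<Longrightarrow> r < 4 \<Longrightarrow> concat (map encode_instr code) ! (4 * p + r) = encode_instr (code ! p) ! r"
proof (induction code arbitrary: p)
  case (Cons i code)
  then show ?case by (cases p) (auto simp: nth_append)
qed simp

definition instr_effect :: "(nat \<Rightarrow> nat) \<Rightarrow> (nat \<Rightarrow> nat) \<Rightarrow> nat" where
  "instr_effect r mem = (let a = mem (r 1 + 1); b = mem (r 1 + 2); c = mem (r 1 + 3) in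
     if mem (r 1) = 0 then a else if mem (r 1) = 1 then mem (a + r 2) + mem (b + r 2)
     else if mem (r 1) = 2 then mem (a + r 2) - mem (b + r 2)
     else if mem (r 1) = 3 then mem (mem (a + r 2) + r 4)
     else if mem (a + r 2) \<noteq> 0 then mem (b + r 2) else mem (c + r 2))"

lemma opcode_cases:
  fixes x :: nat
  obtains "x = 0" | "x = 1" | "x = 2" | "x = 3" | d where "x = d + 4"
proof (cases "x < 4")
  case True
  then have "x = 0 \<or> x = 1 \<or> x = 2 \<or> x = 3" by linarith
  then show thesis by (elim disjE) (erule that(1), erule that(2), erule that(3), erule that(4))
next
  case False
  then show thesis by (intro that(5)[of "x - 4"]) simp
qed

lemma interpreter_body_exec:
  fixes r mem :: "nat \<Rightarrow> nat"
  assumes "r 0 = 1"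
  shows "\<exists>t r'. exec interpreter_body (r, mem) t (r', mem(r 3 := instr_effect r mem)) \<and> t \<le> 40 \<and>
    r' 0 = 1 \<and> r' 1 = r 1 + 4 \<and> r' 2 = r 2 \<and> r' 3 = r 3 + 1 \<and> r' 4 = r 4 \<and> r' 5 = r 5 - 1 \<and> r' 14 = r 14 \<and> r' 15 = r 15"
proof -
  define a b c where "a = mem (r 1 + 1)" and "b = mem (r 1 + 2)" and "c = mem (r 1 + 3)"
  have lf: "loop_free interpreter_body"
    by (simp add: interpreter_body_def interpreter_fetch_def interpreter_compute_def interpreter_store_def)
  have st: "steps interpreter_body \<le> 40"
    by (simp add: interpreter_body_def interpreter_fetch_def interpreter_compute_def interpreter_store_def)
  obtain t where t: "t \<le> steps interpreter_body" "exec interpreter_body (r, mem) t (result interpreter_body (r, mem))"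
    using exec_loop_free[OF lf] by blast
  obtain r1 where fetch: "result interpreter_fetch (r, mem) = (r1, mem)" and
    r1: "r1 0 = 1" "r1 1 = r 1 + 4" "r1 2 = r 2" "r1 3 = r 3" "r1 4 = r 4" "r1 5 = r 5" "r1 6 = mem (r 1)" "r1 7 = a"
      "r1 10 = mem (a + r 2)" "r1 11 = mem (b + r 2)" "r1 12 = mem (c + r 2)" "r1 14 = r 14" "r1 15 = r 15"
    using assms(1) by (simp add: interpreter_fetch_def a_def b_def c_def numeral_2_eq_2 numeral_3_eq_3 numeral_eq_Suc)
  define v where "v = (if mem (r 1) = 0 then a else if mem (r 1) = 1 then mem (a + r 2) + mem (b + r 2)
       else if mem (r 1) = 2 then mem (a + r 2) - mem (b + r 2)
       else if mem (r 1) = 3 then mem (mem (a + r 2) + r 4)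
       else if mem (a + r 2) \<noteq> 0 then mem (b + r 2) else mem (c + r 2))"
  have "\<exists>d v'. result interpreter_compute (r1, mem) = (r1(6 := d, 13 := v'), mem) \<and> v' = v"
  proof -
    show ?thesis
    proof (cases "mem (r 1)" rule: opcode_cases)
      case 1
      then have "r1(6 := 0) = r1" using r1 by (simp add: fun_upd_idem)
      moreover have "result interpreter_compute (r1, mem) = (r1(13 := v), mem)"
        using 1 r1 by (simp add: interpreter_compute_def v_def)
      ultimately show ?thesis by (intro exI[of _ 0] exI[of _ v]) simp
    next
      case 2
      then show ?thesis using r1 by (intro exI[of _ 0] exI[of _ v]) (simp add: interpreter_compute_def v_def)
    next
      case 3
      then show ?thesis using r1 by (intro exI[of _ 0] exI[of _ v]) (simp add: interpreter_compute_def v_def)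
    next
      case 4
      then show ?thesis using r1 by (intro exI[of _ 0] exI[of _ v]) (simp add: interpreter_compute_def v_def)
    next
      case (5 e)
      then show ?thesis using r1 by (intro exI[of _ "e + 1"] exI[of _ v]) (simp add: interpreter_compute_def v_def)
    qed
  qed
  then obtain d where comp: "result interpreter_compute (r1, mem) = (r1(6 := d, 13 := v), mem)" by blast
  define r2 where "r2 = r1(6 := d, 13 := v)"
  have compute: "result interpreter_compute (r1, mem) = (r2, mem)" using comp by (simp add: r2_def)
  have r2: "r2 0 = 1" "r2 1 = r 1 + 4" "r2 2 = r 2" "r2 3 = r 3" "r2 4 = r 4" "r2 5 = r 5" "r2 14 = r 14" "r2 15 = r 15" "r2 13 = v"
    using r1 by (simp_all add: r2_def)
  have "result interpreter_body (r, mem) = result interpreter_store (r2, mem)"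
    by (simp add: interpreter_body_def fetch compute)
  also have "\<dots> = (r2(3 := r2 3 + 1, 5 := r2 5 - 1), mem(r 3 := r2 13))"
    by (simp add: interpreter_store_def r2)
  finally have res: "result interpreter_body (r, mem) = (r2(3 := r2 3 + 1, 5 := r2 5 - 1), mem(r 3 := r2 13))" .
  have "instr_effect r mem = v" unfolding instr_effect_def v_def a_def b_def c_def Let_def ..
  then show ?thesis using t st r2 res
    by (intro exI[of _ t] exI[of _ "r2(3 := r2 3 + 1, 5 := r2 5 - 1)"]) simp
qed

text \<open>Input reads are confined to the \<open>R\<close> cells from the start of the circuits
  on, and the results begin right behind them at \<open>W\<close>. Storing results therefore never
  destroys code, pointers or input.\<close>

lemma interpreter_correct:
  assumes wf: "code_wf D R {stream cs} code"
    and outs: "length outs = m + n" "\<And>p. p \<in> set outs \<Longrightarrow> p < length code" and n: "length cs = n"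
    and W: "W = 3 + length (code_advice W code outs) + R"
  shows "\<exists>t s. exec interpreter (initial_state (encode_input m (code_advice W code outs) cs)) t s \<and>
    t \<le> 41 * length code + 8 * (m + n) + 18 \<and> (\<forall>j<m + n. snd s j = run_code (stream cs) code ! (outs ! j))"
proof -
  let ?T = "length code" and ?adv = "code_advice W code outs"
  let ?x = "stream cs"
  let ?run = "run_code ?x code"
  define xs where "xs = encode_input m ?adv cs"
  define mem0 where "mem0 = snd (initial_state xs)"
  define off where "off = 3 + length ?adv"
  have adv_len: "length ?adv = 2 + 4 * ?T + (m + n)" by (simp add: code_advice_def outs)
  have xs: "xs = [m, n, length ?adv, W, ?T] @ concat (map encode_instr code) @ outs @ concat (map encode_circuit cs)"
    by (simp add: xs_def encode_input_def code_advice_def n)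
  have mem0_nth: "mem0 a = xs ! a" if "a < length xs" for a using that by (simp add: mem0_def initial_state_def)
  have xs_len: "length xs = off + length (concat (map encode_circuit cs))" by (simp add: xs off_def adv_len outs)
  have mem0_header: "mem0 0 = m" "mem0 1 = n" "mem0 2 = length ?adv" "mem0 3 = W" "mem0 4 = ?T"
    by (subst mem0_nth; simp add: xs)+
  have mem0_code: "mem0 (5 + 4 * q + r) = encode_instr (code ! q) ! r" if "q < ?T" "r < 4" for q r
  proof -
    have "4 * q + r < 4 * ?T" using that by linarith
    then have "5 + 4 * q + r < length xs" by (simp add: xs)
    then have "mem0 (5 + 4 * q + r) = xs ! (5 + (4 * q + r))" by (simp add: mem0_nth add.assoc)
    also have "\<dots> = (concat (map encode_instr code) @ outs @ concat (map encode_circuit cs)) ! (4 * q + r)"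
      unfolding xs by (subst nth_append_right) auto
    also have "\<dots> = encode_instr (code ! q) ! r"
      using \<open>4 * q + r < 4 * ?T\<close> nth_concat_encode_instr[OF that] by (simp add: nth_append)
    finally show ?thesis .
  qed
  have mem0_outs: "mem0 (5 + 4 * ?T + j) = outs ! j" if "j < m + n" for j
  proof -
    have "5 + 4 * ?T + j < length xs" using that by (simp add: xs outs)
    then have "mem0 (5 + 4 * ?T + j) = xs ! (5 + (4 * ?T + j))" by (simp add: mem0_nth add.assoc)
    also have "\<dots> = (concat (map encode_instr code) @ outs @ concat (map encode_circuit cs)) ! (4 * ?T + j)"
      unfolding xs by (subst nth_append_right) auto
    also have "\<dots> = outs ! j" using that outs(1) by (simp add: nth_append)
    finally show ?thesis .
  qed
  have mem0_stream: "mem0 (off + a) = ?x a" for a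
  proof -
    have "xs = ([m, n, length ?adv] @ ?adv) @ concat (map encode_circuit cs)" by (simp add: xs code_advice_def)
    moreover have "length ([m, n, length ?adv] @ ?adv) = off" by (simp add: off_def)
    ultimately have "xs ! (off + a) = concat (map encode_circuit cs) ! a" by (metis nth_append_length_plus)
    then show ?thesis by (simp add: mem0_def initial_state_def stream_def xs_len Let_def)
  qed
  have W_off: "W = off + R" using W by (simp add: off_def)
  have off: "off = 5 + 4 * ?T + (m + n)" by (simp add: off_def adv_len)
  define I where "I q s \<longleftrightarrow> (let (r, mem) = s in r 0 = 1 \<and> r 1 = 5 + 4 * q \<and> r 2 = W \<and> r 3 = W + q \<and> r 4 = off \<and>
      r 5 = ?T - q \<and> r 14 = m + n \<and> r 15 = 0 \<and> (\<forall>a<W. mem a = mem0 a) \<and> (\<forall>p<q. mem (W + p) = ?run ! p))" for q and s :: state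
  define J where "J j s \<longleftrightarrow> (let (r, mem) = s in r 0 = 1 \<and> r 1 = 5 + 4 * ?T + j \<and> r 2 = W \<and> r 14 = (m + n) - j \<and> r 15 = j \<and>
      (\<forall>a<W. j \<le> a \<longrightarrow> mem a = mem0 a) \<and> (\<forall>p<?T. mem (W + p) = ?run ! p) \<and> (\<forall>j'<j. mem j' = ?run ! (outs ! j')))" for j and s :: state
  \<comment> \<open>Well-formed instructions refer to earlier positions only, so evaluating one over
    the complete list of results does not change its value. The loop invariant can thus be stated
    with the final list.\<close>
  have run_nth: "?run ! q = instr_value ?x ?run (code ! q)" if q: "q < ?T" for q
  proof -
    let ?pre = "take q code"
    have code: "code = (?pre @ [code ! q]) @ drop (Suc q) code" using q by (simp add: id_take_nth_drop)
    have "?run ! q = run_code ?x (?pre @ [code ! q]) ! q"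
      using run_code_append_nth[of q "?pre @ [code ! q]" ?x "drop (Suc q) code"] code q by simp
    also have "\<dots> = instr_value ?x (run_code ?x ?pre) (code ! q)" using q by (simp add: nth_append)
    also have "\<dots> = instr_value ?x ?run (code ! q)"
    proof -
      have "run_code ?x ?pre ! p = ?run ! p" if "p < q" for p
        using run_code_append_nth[of p ?pre ?x "drop q code"] that q by simp
      then show ?thesis using wf q by (cases "code ! q") (auto simp: code_wf_def dest!: spec[of _ q])
    qed
    finally show ?thesis .
  qed
  have init: "\<exists>t s. exec interpreter_init (initial_state xs) t s \<and> t \<le> 16 \<and> I 0 s"
  proof -
    have lf: "loop_free interpreter_init" and st: "steps interpreter_init \<le> 16" by (simp_all add: interpreter_init_def)
    have "initial_state xs = (\<lambda>_. 0, mem0)" by (simp add: mem0_def initial_state_def)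
    then have "I 0 (result interpreter_init (initial_state xs))"
      using mem0_header by (simp add: interpreter_init_def I_def off_def)
    then show ?thesis using exec_loop_free[OF lf, of "initial_state xs"] st by (meson order_trans)
  qed
  have body: "\<exists>t s'. exec interpreter_body s t s' \<and> t \<le> 40 \<and> I (Suc q) s'" if q: "q < ?T" and I: "I q s" for q s
  proof -
    obtain r mem where s: "s = (r, mem)" by (cases s)
    have r: "r 0 = 1" "r 1 = 5 + 4 * q" "r 2 = W" "r 3 = W + q" "r 4 = off" "r 5 = ?T - q" "r 14 = m + n" "r 15 = 0"
      and mem: "\<And>a. a < W \<Longrightarrow> mem a = mem0 a" "\<And>p. p < q \<Longrightarrow> mem (W + p) = ?run ! p"
      using I by (auto simp: I_def s)
    have "4 * q + 3 < 4 * ?T" using q by linarith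
    then have fetch: "mem (r 1 + k) = encode_instr (code ! q) ! k" if "k < 4" for k
      using mem(1)[of "5 + 4 * q + k"] mem0_code[OF q that] that W_off off r(2) by simp
    have wfq: "instr_wf D q (code ! q)" "\<And>a. code ! q = IRead a \<Longrightarrow> ?run ! a < R"
      using wf q by (auto simp: code_wf_def)
    have val: "instr_effect r mem = ?run ! q"
    proof -
      have f: "mem (r 1) = encode_instr (code ! q) ! 0" "mem (r 1 + 1) = encode_instr (code ! q) ! 1"
        "mem (r 1 + 2) = encode_instr (code ! q) ! 2" "mem (r 1 + 3) = encode_instr (code ! q) ! 3"
        using fetch[of 0] fetch[of 1] fetch[of 2] fetch[of 3] by simp_all
      have arg: "mem (p + W) = ?run ! p" if "p < q" for p using mem(2)[OF that] by (simp add: add.commute)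
      have read: "mem (k + off) = ?x k" if "k < R" for k
        using mem(1)[of "k + off"] mem0_stream[of k] that W_off by (simp add: add.commute)
      show ?thesis unfolding instr_effect_def Let_def f run_nth[OF q] r(3,5) using wfq by (cases "code ! q") (auto simp: arg read)
    qed
    obtain t r' where t: "exec interpreter_body (r, mem) t (r', mem(r 3 := ?run ! q))" "t \<le> 40"
      "r' 0 = 1" "r' 1 = r 1 + 4" "r' 2 = r 2" "r' 3 = r 3 + 1" "r' 4 = r 4" "r' 5 = r 5 - 1" "r' 14 = r 14" "r' 15 = r 15"
      using interpreter_body_exec[of r mem, OF r(1)] unfolding val by blast
    have "I (Suc q) (r', mem(r 3 := ?run ! q))"
      using t r mem by (auto simp: I_def less_Suc_eq)
    then show ?thesis using t(1,2) s by blast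
  qed
  have emit: "\<exists>t s'. exec interpreter_output s t s' \<and> t \<le> 7 \<and> J (Suc j) s'" if j: "j < m + n" and J: "J j s" for j s
  proof -
    obtain r mem where s: "s = (r, mem)" by (cases s)
    have r: "r 0 = 1" "r 1 = 5 + 4 * ?T + j" "r 2 = W" "r 14 = (m + n) - j" "r 15 = j"
      and mem: "\<And>a. a < W \<Longrightarrow> j \<le> a \<Longrightarrow> mem a = mem0 a" "\<And>p. p < ?T \<Longrightarrow> mem (W + p) = ?run ! p"
        "\<And>j'. j' < j \<Longrightarrow> mem j' = ?run ! (outs ! j')"
      using J by (auto simp: J_def s)
    have lf: "loop_free interpreter_output" and st: "steps interpreter_output \<le> 7" by (simp_all add: interpreter_output_def)
    have ptr: "mem (r 1) = outs ! j" using mem(1)[of "r 1"] mem0_outs[OF j] r(2) j W_off off by simp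
    have "outs ! j < ?T" using outs j by simp
    then have v: "mem (mem (r 1) + r 2) = ?run ! (outs ! j)" using mem(2)[of "outs ! j"] unfolding ptr r(3) by (simp add: add.commute)
    have jW: "j < W" using j W_off off by simp
    have res: "result interpreter_output s = (r(7 := ?run ! (outs ! j), 1 := r 1 + 1, 15 := j + 1, 14 := r 14 - 1), mem(j := ?run ! (outs ! j)))"
      using v r by (simp add: interpreter_output_def s fun_upd_twist)
    have "J (Suc j) (result interpreter_output s)"
      unfolding res using r mem jW j by (auto simp: J_def less_Suc_eq)
    then show ?thesis using exec_loop_free[OF lf, of s] st by (meson order_trans)
  qed
  obtain t0 s0 where s0: "exec interpreter_init (initial_state xs) t0 s0" "t0 \<le> 16" "I 0 s0" using init by blast
  obtain t1 s1 where s1: "exec (While_Nonzero 5 interpreter_body) s0 t1 s1" "t1 \<le> ?T * 41 + 1" "I ?T s1"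
    using exec_while_invariant[of ?T I interpreter_body 40 5 0 s0] body s0(3) by (auto simp: I_def)
  have "J 0 s1" using s1(3) by (auto simp: I_def J_def)
  then obtain t2 s2 where s2: "exec (While_Nonzero 14 interpreter_output) s1 t2 s2" "t2 \<le> (m + n) * 8 + 1" "J (m + n) s2"
    using exec_while_invariant[of "m + n" J interpreter_output 7 14 0 s1] emit by (auto simp: J_def)
  have "exec interpreter (initial_state xs) (t0 + (t1 + t2)) s2"
    unfolding interpreter_def using s0(1) s1(1) s2(1) by (intro exec.Seq)
  moreover have "t0 + (t1 + t2) \<le> 41 * ?T + 8 * (m + n) + 18" using s0(2) s1(2) s2(2) by simp
  moreover have "\<forall>j<m + n. snd s2 j = ?run ! (outs ! j)" using s2(3) by (auto simp: J_def)
  ultimately show ?thesis unfolding xs_def by blast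
qed

section \<open>The mechanism and its asymptotics\<close>

definition without_bidder :: "nat \<Rightarrow> nat \<Rightarrow> nat set \<Rightarrow> circuit list \<Rightarrow> nat" where
  "without_bidder i j S = (if j = i then (\<lambda>_. 0) else circuit_value j S)"

lemma (in circuit_slp) polys_outcome:
  assumes sX: "2 ^ s \<le> X" and H: "finite H" "H \<noteq> {}" "card H \<le> X" and h: "\<forall>h\<in>H. \<forall>j<m. h j < s"
  obtains \<chi> \<chi>' where "\<And>cs. optimal_owner n m s H circuit_value cs (\<chi> cs)"
    and "\<And>i cs. i < n \<Longrightarrow> optimal_owner n m s H (without_bidder i) cs (\<chi>' i cs)"
    and "polys {} 400 6 ((\<Union>j<m. {\<lambda>cs. \<chi> cs j}) \<union> (\<Union>i<n. {\<lambda>cs. value_sum m (without_bidder i) n (\<chi>' i cs) cs -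
      (value_sum m circuit_value n (\<chi> cs) cs - circuit_value i (owned m (\<chi> cs) i) cs)}))"
proof -
  let ?K = "\<Union>i\<in>{..n}. {\<lambda>_. i}"
  let ?St = "\<Union>i<n. {start i}" and ?Po = "\<Union>l<Z. {\<lambda>_. 2 ^ l}"
  let ?V = "\<Union>i<n. \<Union>h\<in>H. \<Union>T\<in>Pow {..<s}. {circuit_value i (block m h T)}"
  have "gets {} (card {..n} * 1) ?K" using nX by (intro gets_UN gets_const) auto
  then have K: "polys {} 2 1 ?K" using nX X1 by (elim polys_bound) auto
  have SP: "polys {} (2 + 30 + 3) 1 (?K \<union> ?St \<union> ?Po)"
    by (intro polys_trans K polys_mono[OF polys_start] polys_mono[OF polys_powers]) auto
  have V: "polys (?K \<union> ?St \<union> ?Po) 300 (Suc (Suc (Suc 2))) ?V"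
  proof (intro polys_UN polys_circuit_value)
    show "finite (Pow {..<s})" "card (Pow {..<s}) \<le> X" using sX by (auto simp: card_Pow)
  qed (use nX H in \<open>auto simp: block_def\<close>)
  define F where "F = ?K \<union> ?St \<union> ?Po \<union> ?V"
  have F: "polys {} (2 + 30 + 3 + 300) 5 F"
    unfolding F_def
  proof (rule polys_trans)
    show "polys {} (2 + 30 + 3) 5 (?K \<union> ?St \<union> ?Po)" by (rule polys_mono[OF SP]) simp_all
    show "polys ({} \<union> (?K \<union> ?St \<union> ?Po)) 300 5 ?V" using V by (simp only: Un_empty_left numeral_eq_Suc pred_numeral_simps BitM.simps)
  qed
  have F_const: "(\<lambda>_. i) \<in> F" if "i \<le> n" for i unfolding F_def using that by blast
  have F_val: "circuit_value i (block m h T) \<in> F" if "h \<in> H" "i < n" "T \<subseteq> {..<s}" for h i T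
    unfolding F_def using that by blast
  have ex: "\<exists>\<chi>. polys F 10 5 (obs (observables m val n) \<chi>) \<and> (\<forall>cs. optimal_owner n m s H val cs (\<chi> cs))"
    if val: "\<And>h i T. h \<in> H \<Longrightarrow> i < n \<Longrightarrow> T \<subseteq> {..<s} \<Longrightarrow> val i (block m h T) \<in> F" for val
  proof (rule optimal_for_family[OF nX mX sX H])
    show "h j < s" if "h \<in> H" "j < m" for h j using that h by blast
  qed (use F_const val in blast)+
  obtain \<chi> where \<chi>: "polys F 10 5 (obs (observables m circuit_value n) \<chi>)" "\<And>cs. optimal_owner n m s H circuit_value cs (\<chi> cs)"
    using ex[of circuit_value] F_val by blast
  have "\<exists>\<chi>. polys F 10 5 (obs (observables m (without_bidder i) n) \<chi>) \<and> (\<forall>cs. optimal_owner n m s H (without_bidder i) cs (\<chi> cs))" for i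
  proof (rule ex)
    fix h i' T assume *: "h \<in> H" "i' < n" "T \<subseteq> {..<s}"
    show "without_bidder i i' (block m h T) \<in> F"
      using F_const[OF le0] F_val[OF *] by (cases "i' = i") (simp_all add: without_bidder_def)
  qed
  then obtain \<chi>' where \<chi>': "\<And>i. polys F 10 5 (obs (observables m (without_bidder i) n) (\<chi>' i))"
      "\<And>i cs. optimal_owner n m s H (without_bidder i) cs (\<chi>' i cs)"
    by metis
  define Q where "Q = obs (observables m circuit_value n) \<chi>"
  define Q' where "Q' = (\<Union>i<n. obs (observables m (without_bidder i) n) (\<chi>' i))"
  have Q: "(\<lambda>cs. \<chi> cs j) \<in> Q" if "j < m" for j unfolding Q_def using that by (rule obs_owner)
  have Q_share: "(\<lambda>cs. circuit_value i (owned m (\<chi> cs) i) cs) \<in> Q" if "i < n" for i unfolding Q_def using that by (rule obs_share)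
  have Q_sum: "(\<lambda>cs. value_sum m circuit_value n (\<chi> cs) cs) \<in> Q" unfolding Q_def by (rule obs_sum)
  have Q'_sum: "(\<lambda>cs. value_sum m (without_bidder i) n (\<chi>' i cs) cs) \<in> Q'" if "i < n" for i
    unfolding Q'_def using that by (intro UN_I[of i] obs_sum) simp
  let ?pay = "\<lambda>i cs. value_sum m (without_bidder i) n (\<chi>' i cs) cs -
      (value_sum m circuit_value n (\<chi> cs) cs - circuit_value i (owned m (\<chi> cs) i) cs)"
  have Q': "polys F 10 (Suc 5) Q'" unfolding Q'_def using nX \<chi>'(1) by (intro polys_UN) simp_all
  have FQ: "polys {} (2 + 30 + 3 + 300 + (10 + 10)) 6 (F \<union> (Q \<union> Q'))"
  proof (intro polys_trans)
    show "polys {} (2 + 30 + 3 + 300) 6 F" by (rule polys_mono[OF F]) simp_all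
    show "polys ({} \<union> F) 10 6 Q" unfolding Q_def by (rule polys_mono[OF \<chi>(1)]) simp_all
    show "polys ({} \<union> F \<union> Q) 10 6 Q'" by (rule polys_mono[OF Q']) simp_all
  qed
  have "polys (F \<union> (Q \<union> Q')) (0 + (0 + 0 + 1) + 1) (Suc 0) (\<Union>i<n. {?pay i})"
  proof (intro polys_UN polys_sub polys_mem)
    fix i assume "i \<in> {..<n}"
    then have i: "i < n" by simp
    show "(\<lambda>cs. value_sum m (without_bidder i) n (\<chi>' i cs) cs) \<in> F \<union> (Q \<union> Q')" using Q'_sum[OF i] by simp
    show "(\<lambda>cs. value_sum m circuit_value n (\<chi> cs) cs) \<in> F \<union> (Q \<union> Q')" using Q_sum by simp
    show "(\<lambda>cs. circuit_value i (owned m (\<chi> cs) i) cs) \<in> F \<union> (Q \<union> Q')" using Q_share[OF i] by simp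
  qed (simp_all add: nX)
  then have "polys ({} \<union> (F \<union> (Q \<union> Q'))) 2 6 (\<Union>i<n. {?pay i})" by (rule polys_mono) simp_all
  from polys_trans[OF FQ this]
  have "polys {} 400 6 ((\<Union>j<m. {\<lambda>cs. \<chi> cs j}) \<union> (\<Union>i<n. {?pay i}))"
  proof (rule polys_mono)
    have "(\<Union>j<m. {\<lambda>cs. \<chi> cs j}) \<subseteq> F \<union> (Q \<union> Q')" using Q by (intro UN_least) simp
    then show "(\<Union>j<m. {\<lambda>cs. \<chi> cs j}) \<union> (\<Union>i<n. {?pay i}) \<subseteq> F \<union> (Q \<union> Q') \<union> (\<Union>i<n. {?pay i})"
      by (rule Un_mono) (rule order_refl)
  qed simp_all
  then show thesis by (rule that[OF \<chi>(2) \<chi>'(2)])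
qed

text \<open>What the others receive is computed as the total minus the own share. The outer natural
  subtraction is exact since the optimum for the others is at least their welfare in the chosen
  allocation, which belongs to the same bank.\<close>

lemma mir_outcome_of_optimal_owner:
  assumes F: "perfect_hash_family m s H"
    and \<chi>: "optimal_owner n m s H circuit_value cs ow"
    and \<chi>': "\<And>i. i < n \<Longrightarrow> optimal_owner n m s H (without_bidder i) cs (ow' i)"
    and A: "A = owner_allocation n m ow"
    and pay: "\<And>i. i < n \<Longrightarrow> pay i = real (value_sum m (without_bidder i) n (ow' i) cs -
      (value_sum m circuit_value n ow cs - circuit_value i (owned m ow i) cs))"
  shows "mir_outcome n (hash_bank n m s H) (\<lambda>i. circuit_valuation (cs ! i)) (A, pay)"
proof -
  let ?v = "\<lambda>i. circuit_valuation (cs ! i)" and ?B = "hash_bank n m s H"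
  have bank: "allocation_bank n m ?B" by (rule hash_bank_is_bank[OF F])
  then have fin: "finite ?B" using finite_subset[OF _ finite_allocations] by (auto simp: allocation_bank_def)
  have welf: "welfare n ?v (owner_allocation n m o') = real (value_sum m circuit_value n o' cs)" for o'
    unfolding welfare_def value_sum_def of_nat_sum
    by (intro sum.cong) (auto simp: owner_allocation_def owned_def real_circuit_value)
  have others: "welfare_others n ?v i (owner_allocation n m o') = real (value_sum m (without_bidder i) n o' cs)" if i: "i < n" for i o'
  proof -
    have "real (value_sum m (without_bidder i) n o' cs) = (\<Sum>j<n. if j = i then 0 else circuit_valuation (cs ! j) (owned m o' j))"
      unfolding value_sum_def of_nat_sum by (intro sum.cong) (auto simp: without_bidder_def real_circuit_value)
    also have "\<dots> = (\<Sum>j\<in>{..<n} - {i}. circuit_valuation (cs ! j) (owned m o' j))"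
      by (intro sum.mono_neutral_cong_right) auto
    also have "\<dots> = welfare_others n ?v i (owner_allocation n m o')"
      unfolding welfare_others_def by (intro sum.cong) (auto simp: owner_allocation_def owned_def)
    finally show ?thesis by simp
  qed
  have in_bank: "owner_allocation n m o' \<in> ?B" if "optimal_owner n m s H val cs o'" for val o'
    using that unfolding optimal_owner_def hash_bank_def by blast
  have best: "value_sum m val n o'' cs \<le> value_sum m val n o' cs"
    if "optimal_owner n m s H val cs o'" "h \<in> H" "\<forall>b<s. \<psi> b \<le> n" "o'' = (\<lambda>j. \<psi> (h j))" for val o' o'' h \<psi>
    using that unfolding optimal_owner_def by blast
  have MIR: "MIR n ?B ?v = welfare n ?v A"
    unfolding MIR_def
  proof (rule Max_eqI)
    show "finite (welfare n ?v ` ?B)" using fin by simp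
    show "welfare n ?v A \<in> welfare n ?v ` ?B" using in_bank[OF \<chi>] A by simp
    fix y assume "y \<in> welfare n ?v ` ?B"
    then obtain h \<psi> where "h \<in> H" "\<forall>b<s. \<psi> b \<le> n" "y = welfare n ?v (owner_allocation n m (\<lambda>j. \<psi> (h j)))"
      by (auto simp: hash_bank_def)
    then show "y \<le> welfare n ?v A" unfolding A welf using best[OF \<chi>] by simp
  qed
  have "pay i = vcg_payment n ?B ?v A i" if i: "i < n" for i
  proof -
    have "Max (welfare_others n ?v i ` ?B) = welfare_others n ?v i (owner_allocation n m (ow' i))"
    proof (rule Max_eqI)
      show "finite (welfare_others n ?v i ` ?B)" using fin by simp
      show "welfare_others n ?v i (owner_allocation n m (ow' i)) \<in> welfare_others n ?v i ` ?B" using in_bank[OF \<chi>'[OF i]] by simp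
      fix y assume "y \<in> welfare_others n ?v i ` ?B"
      then obtain h \<psi> where "h \<in> H" "\<forall>b<s. \<psi> b \<le> n" "y = welfare_others n ?v i (owner_allocation n m (\<lambda>j. \<psi> (h j)))"
        by (auto simp: hash_bank_def)
      then show "y \<le> welfare_others n ?v i (owner_allocation n m (ow' i))"
        unfolding others[OF i] using best[OF \<chi>'[OF i]] by simp
    qed
    moreover have "value_sum m circuit_value n ow cs = value_sum m (without_bidder i) n ow cs + circuit_value i (owned m ow i) cs"
    proof -
      have "value_sum m circuit_value n ow cs = circuit_value i (owned m ow i) cs + (\<Sum>j\<in>{..<n} - {i}. circuit_value j (owned m ow j) cs)"
        unfolding value_sum_def using i by (subst sum.remove[of _ i]) auto
      moreover have "value_sum m (without_bidder i) n ow cs = (\<Sum>j\<in>{..<n} - {i}. circuit_value j (owned m ow j) cs)"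
        unfolding value_sum_def by (intro sum.mono_neutral_cong_right) (auto simp: without_bidder_def split: if_splits)
      ultimately show ?thesis by simp
    qed
    moreover have "value_sum m (without_bidder i) n ow cs \<le> value_sum m (without_bidder i) n (ow' i) cs"
      using \<chi> best[OF \<chi>'[OF i]] unfolding optimal_owner_def by blast
    ultimately show ?thesis unfolding vcg_payment_def pay[OF i] A others[OF i] by (simp add: of_nat_diff)
  qed
  then show ?thesis unfolding mir_outcome_def using MIR in_bank[OF \<chi>] A by simp
qed

section \<open>Running time and advice in the succinct model\<close>

lemma mir_succinct_time_hash_bank:
  assumes F: "perfect_hash_family m s H" and le: "1 \<le> X" "n \<le> X" "m \<le> X" "nat \<lfloor>z\<rfloor> \<le> X" "2 ^ s \<le> X" "card H \<le> X"
  shows "\<exists>adv. length adv \<le> 20000 * X ^ 6 \<and> (\<forall>x\<in>set adv. x \<le> 20000 * X ^ 6) \<and>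
    mir_succinct_time n m z (hash_bank n m s H) interpreter adv (real (20000 * X ^ 6))"
proof -
  let ?Z = "nat \<lfloor>z\<rfloor>"
  interpret circuit_slp n m ?Z X using le by unfold_locales
  let ?\<Omega> = "circuit_inputs n m ?Z"
  have hs: "\<forall>h\<in>H. \<forall>j<m. h j < s" using F by (auto simp: perfect_hash_family_def PiE_iff)
  obtain \<chi> \<chi>' where \<chi>: "\<And>cs. optimal_owner n m s H circuit_value cs (\<chi> cs)"
    and \<chi>': "\<And>i cs. i < n \<Longrightarrow> optimal_owner n m s H (without_bidder i) cs (\<chi>' i cs)"
    and P: "polys {} 400 6 ((\<Union>j<m. {\<lambda>cs. \<chi> cs j}) \<union> (\<Union>i<n. {\<lambda>cs. value_sum m (without_bidder i) n (\<chi>' i cs) cs -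
      (value_sum m circuit_value n (\<chi> cs) cs - circuit_value i (owned m (\<chi> cs) i) cs)}))"
    using polys_outcome[OF le(5) perfect_hash_family_finite[OF F] perfect_hash_family_nonempty[OF F] le(6) hs] by blast
  define pay where "pay i cs = value_sum m (without_bidder i) n (\<chi>' i cs) cs -
      (value_sum m circuit_value n (\<chi> cs) cs - circuit_value i (owned m (\<chi> cs) i) cs)" for i cs
  have P': "gets {} (400 * X ^ 6) ((\<Union>j<m. {\<lambda>cs. \<chi> cs j}) \<union> (\<Union>i<n. {pay i}))"
    using P unfolding polys_def pay_def[abs_def] .
  \<comment> \<open>The one place where a concrete code is extracted, as an extension of the empty
    one.\<close>
  obtain code where code: "length code \<le> 400 * X ^ 6" "wf code"
    "\<And>g. g \<in> (\<Union>j<m. {\<lambda>cs. \<chi> cs j}) \<union> (\<Union>i<n. {pay i}) \<Longrightarrow> avail code g"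
    using P'[unfolded gets_def, rule_format, of "[]"] by (auto simp: code_wf_Nil)
  define g where "g j = (if j < m then (\<lambda>cs. \<chi> cs j) else pay (j - m))" for j
  have "\<exists>p<length code. \<forall>cs\<in>?\<Omega>. run_code (stream cs) code ! p = g j cs" if "j < m + n" for j
  proof -
    have "g j \<in> (\<Union>j<m. {\<lambda>cs. \<chi> cs j}) \<union> (\<Union>i<n. {pay i})"
      using that by (cases "j < m") (auto simp: g_def)
    then show ?thesis using code(3) unfolding avail_def by blast
  qed
  then obtain pos where pos: "\<And>j. j < m + n \<Longrightarrow> pos j < length code \<and> (\<forall>cs\<in>?\<Omega>. run_code (stream cs) code ! pos j = g j cs)"
    by metis
  define outs where "outs = map pos [0..<m + n]"
  \<comment> \<open>\<open>W\<close> is itself an entry of the advice. There is no circularity, as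
    the length of the advice does not depend on the value of this entry.\<close>
  define W where "W = 5 + 4 * length code + (m + n) + 20 * X ^ 2"
  define adv where "adv = code_advice W code outs"
  have len: "length adv = 2 + 4 * length code + (m + n)" by (simp add: adv_def code_advice_def outs_def)
  have pw: "X \<le> X ^ 6" "X ^ 2 \<le> X ^ 6" "1 \<le> X ^ 6" using le(1) self_le_power[of X 6] power_increasing[of 2 6 X] by auto
  have W: "W \<le> 20000 * X ^ 6" using code(1) le(2,3) pw unfolding W_def by linarith
  have "length adv \<le> 20000 * X ^ 6" using code(1) le(2,3) pw unfolding len by linarith
  moreover have "x \<le> 20000 * X ^ 6" if x: "x \<in> set adv" for x
  proof -
    consider "x = W" | "x = length code" | i where "i \<in> set code" "x \<in> set (encode_instr i)" | "x \<in> set outs"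
      using x by (auto simp: adv_def code_advice_def)
    then show ?thesis
    proof cases
      case 3
      then obtain p where "p < length code" "code ! p = i" by (auto simp: in_set_conv_nth)
      then have "instr_wf (10 * X) p i" using code(2) by (auto simp: code_wf_def)
      then have "x \<le> 10 * X + length code + 4" using 3(2) \<open>p < length code\<close> by (cases i) auto
      then show ?thesis using code(1) pw by linarith
    next
      case 4
      then have "x < length code" using pos by (auto simp: outs_def)
      then show ?thesis using code(1) by linarith
    qed (use W code(1) in auto)
  qed
  moreover have "mir_succinct_time n m z (hash_bank n m s H) interpreter adv (real (20000 * X ^ 6))"
    unfolding mir_succinct_time_def
  proof (intro allI impI)
    fix cs assume cs: "length cs = n \<and> (\<forall>c\<in>set cs. circuit_wf m c \<and> real (circuit_size c) \<le> z \<and>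
        circuit_valuation c \<in> monotone_valuations m)"
    then have cs\<Omega>: "cs \<in> ?\<Omega>" by (auto simp: circuit_inputs_def le_nat_floor)
    have "code_wf (10 * X) (20 * X ^ 2) {stream cs} code" using code(2) cs\<Omega> by (auto simp: code_wf_def)
    moreover have "length outs = m + n" "\<And>p. p \<in> set outs \<Longrightarrow> p < length code" using pos by (auto simp: outs_def)
    moreover have "W = 3 + length (code_advice W code outs) + 20 * X ^ 2" using len by (simp add: W_def adv_def)
    ultimately obtain t st where t: "exec interpreter (initial_state (encode_input m adv cs)) t st"
      "t \<le> 41 * length code + 8 * (m + n) + 18" "\<And>j. j < m + n \<Longrightarrow> snd st j = run_code (stream cs) code ! (outs ! j)"
      using interpreter_correct[of "10 * X" "20 * X ^ 2" cs code outs m n W] cs unfolding adv_def by blast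
    have out: "snd st j = g j cs" if "j < m + n" for j using t(3)[OF that] pos[OF that] cs\<Omega> that by (simp add: outs_def)
    \<comment> \<open>Interpretation at 41 steps per instruction dominates with 16400 * X^6 steps;
      output and initialization stay within the rounding to 20000.\<close>
    have "41 * length code \<le> 41 * (400 * X ^ 6)" using code(1) by (rule mult_le_mono2)
    moreover have "8 * (m + n) \<le> 8 * (X ^ 6 + X ^ 6)"
      using order_trans[OF le(2) pw(1)] order_trans[OF le(3) pw(1)] by (intro mult_le_mono2 add_mono)
    ultimately have "t \<le> 16416 * X ^ 6 + 18" using t(2) by simp
    then have "t \<le> 20000 * X ^ 6" using pw(3) by simp
    then have "real t \<le> real (20000 * X ^ 6)" by (rule of_nat_mono)
    moreover have "mir_outcome n (hash_bank n m s H) (\<lambda>i. circuit_valuation (cs ! i)) (decode_outcome n m st)"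
      unfolding decode_outcome_def
    proof (rule mir_outcome_of_optimal_owner[OF F \<chi> \<chi>'])
      have "snd st j = \<chi> cs j" if "j < m" for j using out[of j] that by (simp add: g_def)
      then show "(\<lambda>i\<in>{..<n}. {j. j < m \<and> snd st j = i}) = owner_allocation n m (\<chi> cs)"
        unfolding owner_allocation_def by (intro restrict_ext) auto
      fix i assume i: "i < n"
      show "real (snd st (m + i)) = real (value_sum m (without_bidder i) n (\<chi>' i cs) cs -
          (value_sum m circuit_value n (\<chi> cs) cs - circuit_value i (owned m (\<chi> cs) i) cs))"
        using out[of "m + i"] i by (simp add: g_def pay_def)
    qed
    ultimately show "\<exists>t s'. exec interpreter (initial_state (encode_input m adv cs)) t s' \<and> real t \<le> real (20000 * X ^ 6) \<and>
        mir_outcome n (hash_bank n m s H) (\<lambda>i. circuit_valuation (cs ! i)) (decode_outcome n m s')" using t(1) by blast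
  qed
  ultimately show ?thesis by blast
qed

section \<open>Exponents and asymptotic regimes\<close>

lemma eventually_log_ge:
  fixes c K :: real
  assumes "0 < c"
  obtains m0 :: nat where "2 \<le> m0" "\<And>m. m0 \<le> m \<Longrightarrow> K \<le> c * log 2 (real m)"
proof (rule that[of "max 2 (nat \<lceil>2 powr (K / c)\<rceil>)"])
  fix m assume m: "max 2 (nat \<lceil>2 powr (K / c)\<rceil>) \<le> m"
  then have "2 powr (K / c) \<le> real m" by linarith
  then have "log 2 (2 powr (K / c)) \<le> log 2 (real m)" using m by (subst log_le_cancel_iff) auto
  then have "K / c \<le> log 2 (real m)" by simp
  then show "K \<le> c * log 2 (real m)" using assms by (simp add: pos_divide_le_eq mult.commute)
qed simp

lemma le_powr_of_log_le:
  assumes "1 \<le> m" "log 2 (real m) \<le> y"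
  shows "real m \<le> 2 powr y"
proof -
  have "2 powr log 2 (real m) \<le> 2 powr y" using assms(2) by (intro powr_mono) auto
  moreover have "2 powr log 2 (real m) = real m" using assms(1) by (intro powr_log_cancel) auto
  ultimately show ?thesis by linarith
qed

lemma MIR_Gen_lower:
  fixes \<beta> \<gamma> c0 :: real
  assumes "0 < \<beta>" "0 < \<gamma>" "1 \<le> c0 * \<gamma>"
  shows "\<exists>c>0. \<exists>m0. \<forall>m\<ge>m0. \<forall>k. c0 * log 2 (real m) \<le> k \<longrightarrow> ereal (c * (real m / k)) \<le> MIR_Gen \<beta> \<gamma> m k"
proof -
  have c0: "0 < c0" using assms(2,3) by (smt (verit) mult_nonpos_nonneg)
  obtain c where c: "0 < c" "\<And>m k N B. 1 \<le> m \<Longrightarrow> 1 \<le> k \<Longrightarrow> log 2 (real m) \<le> 1 / c0 * k \<Longrightarrow> real m \<le> N \<Longrightarrow> 2 < B \<Longrightarrow>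
    ereal (c * (real m / k)) \<le> mir_guarantee N B (2 powr k) m"
    using mir_guarantee_lower_bound[of "1 / c0"] c0 by auto
  obtain m0 where m0: "2 \<le> m0" "\<And>m. m0 \<le> m \<Longrightarrow> 1 \<le> c0 * log 2 (real m)" using eventually_log_ge[OF c0] by blast
  have "ereal (c * (real m / k)) \<le> MIR_Gen \<beta> \<gamma> m k" if m: "m0 \<le> m" and k: "c0 * log 2 (real m) \<le> k" for m k
    unfolding MIR_Gen_def
  proof (rule c(2))
    show m1: "1 \<le> m" using m m0(1) by simp
    show k1: "1 \<le> k" using m0(2)[OF m] k by linarith
    show lk: "log 2 (real m) \<le> 1 / c0 * k" using k c0 by (simp add: field_simps)
    have "1 / c0 \<le> \<gamma>" using assms(3) c0 by (simp add: divide_le_eq mult.commute)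
    then have "1 / c0 * k \<le> \<gamma> * k" using k1 by (intro mult_right_mono) auto
    then show "real m \<le> 2 powr (\<gamma> * k)" using lk m1 by (intro le_powr_of_log_le) auto
    have "0 < \<beta> * k" using assms(1) k1 by simp
    then have "1 < 2 powr (\<beta> * k)" by simp
    then have "2 powr 1 < 2 powr (2 powr (\<beta> * k))" by (intro powr_less_mono) auto
    then show "2 < 2 powr (2 powr (\<beta> * k))" by simp
  qed
  then show ?thesis using c(1) by blast
qed

text \<open>The instance k = d * log 2 m, for which 2^k equals m^d; the factor \<open>d\<close>
  moves into the constant.\<close>

lemma polynomial_lower:
  fixes a b d :: real
  assumes "1 \<le> a" "0 < b" "0 < d"
  shows "\<exists>c>0. \<exists>m0. \<forall>m\<ge>m0. ereal (c * (real m / log 2 (real m))) \<le>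
    mir_guarantee (real m powr a) (2 powr (real m powr b)) (real m powr d) m"
proof -
  obtain c where c: "0 < c" "\<And>m k N B. 1 \<le> m \<Longrightarrow> 1 \<le> k \<Longrightarrow> log 2 (real m) \<le> 1 / d * k \<Longrightarrow> real m \<le> N \<Longrightarrow> 2 < B \<Longrightarrow>
    ereal (c * (real m / k)) \<le> mir_guarantee N B (2 powr k) m"
    using mir_guarantee_lower_bound[of "1 / d"] assms(3) by auto
  obtain m0 where m0: "2 \<le> m0" "\<And>m. m0 \<le> m \<Longrightarrow> 1 \<le> d * log 2 (real m)" using eventually_log_ge[OF assms(3)] by blast
  have "ereal (c / d * (real m / log 2 (real m))) \<le> mir_guarantee (real m powr a) (2 powr (real m powr b)) (real m powr d) m"
    if m: "m0 \<le> m" for m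
  proof -
    have m2: "2 \<le> m" using m m0(1) by simp
    have "real m powr d = 2 powr (d * log 2 (real m))" using m2 by (simp add: powr_def log_def)
    moreover have "ereal (c * (real m / (d * log 2 (real m)))) \<le>
        mir_guarantee (real m powr a) (2 powr (real m powr b)) (2 powr (d * log 2 (real m))) m"
    proof (rule c(2))
      show "1 \<le> m" using m2 by simp
      show "1 \<le> d * log 2 (real m)" by (rule m0(2)[OF m])
      show "log 2 (real m) \<le> 1 / d * (d * log 2 (real m))" using assms(3) by simp
      show "real m \<le> real m powr a" using powr_mono[of 1 a "real m"] assms(1) m2 by simp
      have "1 < real m powr b" using assms(2) m2 by simp
      then have "2 powr 1 < 2 powr (real m powr b)" by (intro powr_less_mono) auto
      then show "2 < 2 powr (real m powr b)" by simp
    qed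
    ultimately show ?thesis by (simp add: divide_divide_eq_left)
  qed
  then show ?thesis using c(1) assms(3) by (intro exI[of _ "c / d"]) auto
qed

text \<open>For k = log 2 m, powers of \<open>m\<close> are powers of 2^k with the same exponent, so
  a + b < d is exactly the budget condition of \<open>hash_mechanism\<close>.\<close>

lemma polynomial_upper:
  fixes a b d :: real
  assumes "0 < b" "a + b < d"
  shows "\<exists>C>0. \<exists>m0. \<forall>m\<ge>m0. mir_guarantee (real m powr a) (2 powr (real m powr b)) (real m powr d) m
    \<le> ereal (C * (real m / log 2 (real m)))"
proof -
  obtain \<epsilon> k0 where \<epsilon>: "0 < \<epsilon>" "1 \<le> k0"
    and mech: "\<And>m k n. k0 \<le> k \<Longrightarrow> k \<le> real m \<Longrightarrow> log 2 (real m) \<le> 1 * k \<Longrightarrow> 1 \<le> n \<Longrightarrow> real n \<le> 2 powr (a * k) \<Longrightarrow>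
       suitable_bundles b d \<epsilon> n m k"
    using hash_mechanism[of 1 b a d] assms by auto
  obtain m0 where m0: "2 \<le> m0" "\<And>m. m0 \<le> m \<Longrightarrow> k0 \<le> 1 * log 2 (real m)" using eventually_log_ge[of 1] by auto
  have "mir_guarantee (real m powr a) (2 powr (real m powr b)) (real m powr d) m \<le> ereal (6 / \<epsilon> * (real m / log 2 (real m)))"
    if m: "m0 \<le> m" for m
  proof (rule mir_guarantee_le)
    let ?k = "log 2 (real m)"
    have m2: "2 \<le> m" using m m0(1) by simp
    have k: "k0 \<le> ?k" using m0(2)[OF m] by simp
    have pw: "real m powr x = 2 powr (x * ?k)" for x using m2 by (simp add: powr_def log_def)
    show "0 < 6 / \<epsilon> * (real m / ?k)" using \<epsilon> k m2 by simp
    have "m < 2 ^ m" by (rule less_exp)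
    then have "real m < 2 powr real m" by (simp add: powr_realpow)
    then have km: "?k \<le> real m" using m2 by (simp add: log_le_iff)
    fix n assume n: "1 \<le> n" "real n \<le> real m powr a"
    show "allocation_bank n m (bundle_bank n m (\<epsilon> * ?k)) \<and>
       mir_approx n m (monotone_valuations m) (bundle_bank n m (\<epsilon> * ?k)) (6 / \<epsilon> * (real m / ?k)) \<and>
       mir_communication n (bounded_valuations m (2 powr (real m powr b))) (bundle_bank n m (\<epsilon> * ?k)) (real m powr d)"
      using mech[OF k km _ n(1)] n(2) unfolding pw suitable_bundles_def Let_def by simp
  qed
  then show ?thesis using \<epsilon>(1) by (intro exI[of _ "6 / \<epsilon>"]) auto
qed

lemma mir_succinct_time_mono:
  "mir_succinct_time n m z \<A> P adv T \<Longrightarrow> T \<le> T' \<Longrightarrow> mir_succinct_time n m z \<A> P adv T'"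
  unfolding mir_succinct_time_def by (blast intro: order_trans)

lemma succinct_advice_bound:
  fixes \<gamma> \<kappa> e :: real
  assumes "0 \<le> \<gamma>" "0 \<le> \<kappa>" "0 < e"
  shows "\<exists>E'>0. \<forall>m n k s. 1 \<le> k \<and> 1 \<le> m \<and> log 2 (real m) \<le> \<kappa> * k \<and> 1 \<le> s \<and> s \<le> m \<and>
     real (card (hash_family m s)) * 2 ^ s \<le> 2 powr k \<and> real n \<le> 2 powr (\<gamma> * k) \<longrightarrow>
     (\<exists>adv. real (length adv) \<le> 2 powr (E' * k) \<and> (\<forall>x \<in> set adv. real x \<le> 2 powr (E' * k)) \<and>
       mir_succinct_time n m (real m powr e) (hash_bank n m s (hash_family m s)) interpreter adv (2 powr (E' * k)))"
proof -
  \<comment> \<open>One summand for each quantity that \<open>X\<close> must dominate: the number of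
    bundle sets and the size of the family, the number of bidders, the number of items, and the
    circuit size m^e. The final exponent 15 + 6 * E0 results from 20000 \<le> 2^15 and the degree
    6.\<close>
  define E0 where "E0 = 1 + \<gamma> + \<kappa> + e * \<kappa>"
  have E0: "1 \<le> E0" "\<gamma> \<le> E0" "\<kappa> \<le> E0" "e * \<kappa> \<le> E0" using assms by (auto simp: E0_def)
  have "\<exists>adv. real (length adv) \<le> 2 powr ((15 + 6 * E0) * k) \<and> (\<forall>x \<in> set adv. real x \<le> 2 powr ((15 + 6 * E0) * k)) \<and>
       mir_succinct_time n m (real m powr e) (hash_bank n m s (hash_family m s)) interpreter adv (2 powr ((15 + 6 * E0) * k))"
    if k: "1 \<le> k" and m: "1 \<le> m" "log 2 (real m) \<le> \<kappa> * k" and s: "1 \<le> s" "s \<le> m"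
      and FB: "real (card (hash_family m s)) * 2 ^ s \<le> 2 powr k" and n: "real n \<le> 2 powr (\<gamma> * k)" for m n k s
  proof -
    define X where "X = nat \<lfloor>2 powr (E0 * k)\<rfloor>"
    have XI: "x \<le> X" if "real x \<le> 2 powr (y * k)" "y \<le> E0" for x y
    proof -
      have "y * k \<le> E0 * k" using that(2) k by (intro mult_right_mono) auto
      then have "real x \<le> 2 powr (E0 * k)" using that(1) by (smt (verit) powr_mono)
      then show ?thesis unfolding X_def by (rule le_nat_floor)
    qed
    have F: "perfect_hash_family m s (hash_family m s)" by (rule hash_family(1)[OF s])
    have c1: "1 \<le> card (hash_family m s)"
      using perfect_hash_family_finite[OF F] perfect_hash_family_nonempty[OF F] by (simp add: Suc_le_eq card_gt_0_iff)
    have "real (2 ^ s) \<le> real (card (hash_family m s)) * 2 ^ s" using c1 by simp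
    then have "real (2 ^ s) \<le> 2 powr (1 * k)" using FB by (simp only: mult_1 order_trans)
    then have X_s: "2 ^ s \<le> X" using E0(1) by (rule XI)
    have "real (card (hash_family m s)) * 1 \<le> real (card (hash_family m s)) * 2 ^ s" by (intro mult_left_mono) auto
    then have X_F: "card (hash_family m s) \<le> X" using FB E0(1) XI[of "card (hash_family m s)" 1] by simp
    have X_n: "n \<le> X" using n E0(2) by (rule XI)
    have X_m: "m \<le> X" using le_powr_of_log_le[OF m] E0(3) by (rule XI)
    have X_Z: "nat \<lfloor>real m powr e\<rfloor> \<le> X"
    proof (rule XI[OF _ E0(4)])
      have "real (nat \<lfloor>real m powr e\<rfloor>) \<le> real m powr e" by simp
      also have "\<dots> = 2 powr (e * log 2 (real m))" using m(1) by (simp add: powr_def log_def)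
      also have "\<dots> \<le> 2 powr (e * \<kappa> * k)" using m(2) assms(3) by (simp add: mult.assoc)
      finally show "real (nat \<lfloor>real m powr e\<rfloor>) \<le> 2 powr (e * \<kappa> * k)" .
    qed
    have X_1: "1 \<le> X" using m(1) X_m by simp
    have T: "real (20000 * X ^ 6) \<le> 2 powr ((15 + 6 * E0) * k)"
    proof -
      have "real X \<le> 2 powr (E0 * k)" unfolding X_def by simp
      then have "real X ^ 6 \<le> (2 powr (E0 * k)) ^ 6" by (intro power_mono) auto
      also have "\<dots> = 2 powr (6 * E0 * k)" by (simp add: powr_power mult_ac)
      finally have "real X ^ 6 \<le> 2 powr (6 * E0 * k)" .
      moreover have "(20000::real) \<le> 2 powr (15 * k)"
      proof -
        have "(20000::real) \<le> 2 powr 15" by simp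
        also have "\<dots> \<le> 2 powr (15 * k)" using k by (intro powr_mono) auto
        finally show ?thesis .
      qed
      ultimately have "20000 * real X ^ 6 \<le> 2 powr (15 * k) * 2 powr (6 * E0 * k)" by (intro mult_mono) auto
      then show ?thesis by (simp add: powr_add[symmetric] distrib_right)
    qed
    obtain adv where adv: "length adv \<le> 20000 * X ^ 6" "\<forall>x\<in>set adv. x \<le> 20000 * X ^ 6"
      "mir_succinct_time n m (real m powr e) (hash_bank n m s (hash_family m s)) interpreter adv (real (20000 * X ^ 6))"
      using mir_succinct_time_hash_bank[OF F X_1 X_n X_m X_Z X_s X_F] by blast
    have le: "real x \<le> 2 powr ((15 + 6 * E0) * k)" if "x \<le> 20000 * X ^ 6" for x
      using of_nat_mono[OF that, where 'a = real] T by linarith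
    have "mir_succinct_time n m (real m powr e) (hash_bank n m s (hash_family m s)) interpreter adv (2 powr ((15 + 6 * E0) * k))"
      by (rule mir_succinct_time_mono[OF adv(3) T])
    then show ?thesis using adv(1,2) le by blast
  qed
  then show ?thesis using E0(1) by (intro exI[of _ "15 + 6 * E0"]) auto
qed

text \<open>A single bank, fixed before the exponent \<open>e\<close> of the circuit size, serves
  approximation, communication, queries and time. A larger \<open>e\<close> affects only the advice
  and the exponent of the running time.\<close>

lemma mechanism_main:
  fixes \<beta> \<gamma> c0 :: real
  assumes "0 < \<beta>" and "0 < \<gamma>" and "\<beta> + \<gamma> < 1" and "0 < c0"
  shows "\<exists>C>0. \<exists>E>0. \<exists>m0. \<exists>\<A> :: nat \<Rightarrow> nat \<Rightarrow> real \<Rightarrow> allocation set.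
        (\<forall>m\<ge>m0. \<forall>n\<ge>1. \<forall>k. c0 * log 2 (real m) \<le> k \<and> k \<le> real m \<and> real n \<le> 2 powr (\<gamma> * k) \<longrightarrow>
           allocation_bank n m (\<A> n m k) \<and>
           mir_approx n m (monotone_valuations m) (\<A> n m k) (C * (real m / k)) \<and>
           mir_communication n (bounded_valuations m (2 powr (2 powr (\<beta> * k)))) (\<A> n m k) (2 powr k) \<and>
           mir_value_queries n m (monotone_valuations m) (\<A> n m k) (2 powr (E * k))) \<and>
        (\<forall>e>0. \<exists>E'>0. \<exists>m1. \<exists>P. \<exists>adv :: nat \<Rightarrow> nat \<Rightarrow> real \<Rightarrow> nat list.
           \<forall>m\<ge>m1. \<forall>n\<ge>1. \<forall>k. c0 * log 2 (real m) \<le> k \<and> k \<le> real m \<and> real n \<le> 2 powr (\<gamma> * k) \<longrightarrow>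
             real (length (adv n m k)) \<le> 2 powr (E' * k) \<and>
             (\<forall>x \<in> set (adv n m k). real x \<le> 2 powr (E' * k)) \<and>
             mir_succinct_time n m (real m powr e) (\<A> n m k) P (adv n m k) (2 powr (E' * k)))"
proof -
  obtain \<epsilon> k0 where \<epsilon>: "0 < \<epsilon>" "1 \<le> k0"
    and mech: "\<And>m k n. k0 \<le> k \<Longrightarrow> k \<le> real m \<Longrightarrow> log 2 (real m) \<le> 1 / c0 * k \<Longrightarrow> 1 \<le> n \<Longrightarrow> real n \<le> 2 powr (\<gamma> * k) \<Longrightarrow>
       suitable_bundles \<beta> 1 \<epsilon> n m k"
    using hash_mechanism[of "1 / c0" \<beta> \<gamma> 1] assms by auto
  obtain m0 where m0: "2 \<le> m0" "\<And>m. m0 \<le> m \<Longrightarrow> k0 \<le> c0 * log 2 (real m)" using eventually_log_ge[OF assms(4)] by auto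
  define \<A> where "\<A> n m k = bundle_bank n m (\<epsilon> * k)" for n m k
  have prem: "k0 \<le> k" "1 \<le> k" "1 \<le> m" "log 2 (real m) \<le> 1 / c0 * k" if "m0 \<le> m" "c0 * log 2 (real m) \<le> k" for m k
  proof -
    show "k0 \<le> k" "1 \<le> k" "1 \<le> m" using m0(2)[OF that(1)] that \<epsilon>(2) m0(1) by linarith+
    show "log 2 (real m) \<le> 1 / c0 * k" using that(2) assms(4) by (simp add: field_simps)
  qed
  have main: "allocation_bank n m (\<A> n m k) \<and>
           mir_approx n m (monotone_valuations m) (\<A> n m k) (6 / \<epsilon> * (real m / k)) \<and>
           mir_communication n (bounded_valuations m (2 powr (2 powr (\<beta> * k)))) (\<A> n m k) (2 powr k) \<and>
           mir_value_queries n m (monotone_valuations m) (\<A> n m k) (2 powr (1 * k))"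
    if "m0 \<le> m" "1 \<le> n" "c0 * log 2 (real m) \<le> k" "k \<le> real m" "real n \<le> 2 powr (\<gamma> * k)" for m n k
    using mech[OF prem(1)[OF that(1,3)] that(4) prem(4)[OF that(1,3)] that(2,5)] unfolding \<A>_def suitable_bundles_def Let_def by simp
  have succinct: "\<exists>E'>0. \<exists>m1. \<exists>P. \<exists>adv :: nat \<Rightarrow> nat \<Rightarrow> real \<Rightarrow> nat list.
           \<forall>m\<ge>m1. \<forall>n\<ge>1. \<forall>k. c0 * log 2 (real m) \<le> k \<and> k \<le> real m \<and> real n \<le> 2 powr (\<gamma> * k) \<longrightarrow>
             real (length (adv n m k)) \<le> 2 powr (E' * k) \<and>
             (\<forall>x \<in> set (adv n m k). real x \<le> 2 powr (E' * k)) \<and>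
             mir_succinct_time n m (real m powr e) (\<A> n m k) P (adv n m k) (2 powr (E' * k))" if e: "0 < e" for e
  proof -
    obtain E' where E': "0 < E'" and adv: "\<And>m n k s. 1 \<le> k \<and> 1 \<le> m \<and> log 2 (real m) \<le> 1 / c0 * k \<and> 1 \<le> s \<and> s \<le> m \<and>
       real (card (hash_family m s)) * 2 ^ s \<le> 2 powr k \<and> real n \<le> 2 powr (\<gamma> * k) \<Longrightarrow>
       (\<exists>adv. real (length adv) \<le> 2 powr (E' * k) \<and> (\<forall>x \<in> set adv. real x \<le> 2 powr (E' * k)) \<and>
         mir_succinct_time n m (real m powr e) (hash_bank n m s (hash_family m s)) interpreter adv (2 powr (E' * k)))"
      using succinct_advice_bound[of \<gamma> "1 / c0" e] assms e by auto
    let ?good = "\<lambda>n m k adv. real (length adv) \<le> 2 powr (E' * k) \<and> (\<forall>x \<in> set adv. real x \<le> 2 powr (E' * k)) \<and>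
         mir_succinct_time n m (real m powr e) (\<A> n m k) interpreter adv (2 powr (E' * k))"
    \<comment> \<open>The advice is chosen separately for all parameters by pure existence, while
      the program is always the same \<open>interpreter\<close>.\<close>
    define ad where "ad n m k = (SOME adv. ?good n m k adv)" for n m k
    have "?good n m k (ad n m k)" if "m0 \<le> m" "1 \<le> n" "c0 * log 2 (real m) \<le> k" "k \<le> real m" "real n \<le> 2 powr (\<gamma> * k)" for m n k
    proof -
      have "\<exists>adv. ?good n m k adv"
        using mech[OF prem(1)[OF that(1,3)] that(4) prem(4)[OF that(1,3)] that(2,5)] prem[OF that(1,3)] that(5)
        unfolding \<A>_def bundle_bank_def suitable_bundles_def Let_def by (intro adv) simp
      then show ?thesis unfolding ad_def by (rule someI_ex)
    qed
    then show ?thesis using E' by (intro exI[of _ E'] exI[of _ m0] exI[of _ interpreter] exI[of _ ad] conjI) auto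
  qed
  show ?thesis
    using \<epsilon>(1) main succinct by (intro exI[of _ "6 / \<epsilon>"] exI[of _ 1] exI[of _ m0] exI[of _ \<A>] conjI) auto
qed

theorem theorem1p4:
  fixes \<beta> \<gamma> c0 :: real
  assumes "0 < \<beta>" and "0 < \<gamma>" and "\<beta> + \<gamma> < 1" and "1 \<le> c0 * \<gamma>"
  shows
    "(\<exists>c>0. \<exists>C>0. \<exists>m0. \<forall>m\<ge>m0. \<forall>k::real. c0 * log 2 (real m) \<le> k \<and> k \<le> real m \<longrightarrow>
        ereal (c * (real m / k)) \<le> MIR_Gen \<beta> \<gamma> m k \<and>
        MIR_Gen \<beta> \<gamma> m k \<le> ereal (C * (real m / k))) \<and>
     (\<forall>a\<ge>1. \<forall>b>0.
        (\<forall>d>0. \<exists>c>0. \<exists>m0. \<forall>m\<ge>m0.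
           ereal (c * (real m / log 2 (real m))) \<le>
             mir_guarantee (real m powr a) (2 powr (real m powr b)) (real m powr d) m) \<and>
        (\<forall>d>a + b. \<exists>C>0. \<exists>m0. \<forall>m\<ge>m0.
             mir_guarantee (real m powr a) (2 powr (real m powr b)) (real m powr d) m
               \<le> ereal (C * (real m / log 2 (real m))))) \<and>
     (\<exists>C>0. \<exists>E>0. \<exists>m0. \<exists>\<A> :: nat \<Rightarrow> nat \<Rightarrow> real \<Rightarrow> allocation set.
        (\<forall>m\<ge>m0. \<forall>n\<ge>1. \<forall>k. c0 * log 2 (real m) \<le> k \<and> k \<le> real m \<and> real n \<le> 2 powr (\<gamma> * k) \<longrightarrow>
           allocation_bank n m (\<A> n m k) \<and>
           mir_approx n m (monotone_valuations m) (\<A> n m k) (C * (real m / k)) \<and>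
           mir_communication n (bounded_valuations m (2 powr (2 powr (\<beta> * k)))) (\<A> n m k) (2 powr k) \<and>
           mir_value_queries n m (monotone_valuations m) (\<A> n m k) (2 powr (E * k))) \<and>
        (\<forall>e>0. \<exists>E'>0. \<exists>m1. \<exists>P. \<exists>adv :: nat \<Rightarrow> nat \<Rightarrow> real \<Rightarrow> nat list.
           \<forall>m\<ge>m1. \<forall>n\<ge>1. \<forall>k. c0 * log 2 (real m) \<le> k \<and> k \<le> real m \<and> real n \<le> 2 powr (\<gamma> * k) \<longrightarrow>
             real (length (adv n m k)) \<le> 2 powr (E' * k) \<and>
             (\<forall>x \<in> set (adv n m k). real x \<le> 2 powr (E' * k)) \<and>
             mir_succinct_time n m (real m powr e) (\<A> n m k) P (adv n m k) (2 powr (E' * k))))"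
proof (intro conjI, goal_cases)
  case 1
  have c0: "0 < c0" using assms(2,4) by (smt (verit) mult_nonpos_nonneg)
  note main = mechanism_main[OF assms(1-3) c0]
  obtain c m1 where c: "0 < c" "\<And>m k. m1 \<le> m \<Longrightarrow> c0 * log 2 (real m) \<le> k \<Longrightarrow> ereal (c * (real m / k)) \<le> MIR_Gen \<beta> \<gamma> m k"
    using MIR_Gen_lower[OF assms(1,2,4)] by blast
  obtain C m0 \<A> where C: "0 < C" and mech: "\<And>m n k. m0 \<le> m \<Longrightarrow> 1 \<le> n \<Longrightarrow>
      c0 * log 2 (real m) \<le> k \<and> k \<le> real m \<and> real n \<le> 2 powr (\<gamma> * k) \<Longrightarrow>
      allocation_bank n m (\<A> n m k) \<and> mir_approx n m (monotone_valuations m) (\<A> n m k) (C * (real m / k)) \<and>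
      mir_communication n (bounded_valuations m (2 powr (2 powr (\<beta> * k)))) (\<A> n m k) (2 powr k)"
    using main by (metis (no_types, lifting))
  obtain m2 where m2: "2 \<le> m2" "\<And>m. m2 \<le> m \<Longrightarrow> 1 \<le> c0 * log 2 (real m)" using eventually_log_ge[OF c0] by blast
  have "MIR_Gen \<beta> \<gamma> m k \<le> ereal (C * (real m / k))"
    if m: "m0 \<le> m" "m2 \<le> m" and k: "c0 * log 2 (real m) \<le> k" "k \<le> real m" for m k
    unfolding MIR_Gen_def
  proof (rule mir_guarantee_le)
    have "1 \<le> k" using m2(2)[OF m(2)] k(1) by linarith
    then show "0 < C * (real m / k)" using C m2(1) m(2) by simp
    fix n assume "1 \<le> n" "real n \<le> 2 powr (\<gamma> * k)"
    then show "allocation_bank n m (\<A> n m k) \<and> mir_approx n m (monotone_valuations m) (\<A> n m k) (C * (real m / k)) \<and>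
      mir_communication n (bounded_valuations m (2 powr (2 powr (\<beta> * k)))) (\<A> n m k) (2 powr k)"
      using mech m k by blast
  qed
  then show ?case
    using c C by (intro exI[of _ c] conjI exI[of _ C] exI[of _ "max m0 (max m1 m2)"]) auto
next
  case 2
  show ?case using polynomial_lower polynomial_upper by blast
next
  case 3
  have "0 < c0" using assms(2,4) by (smt (verit) mult_nonpos_nonneg)
  then show ?case by (rule mechanism_main[OF assms(1-3)])
qed

end
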